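(* $OS_f\colon \mathfrak{Comp}\to\mathfrak{Comp}$ is a normal functor.
   Context: $\mathfrak{Comp}$ is the category of compact Hausdorff spaces and continuous maps. For a compact Hausdorff space $X$, $C(X)$ is the algebra of continuous functions $\varphi\colon X\to\mathbb{R}$ with pointwise operations and order; $c_X$ is the constant function with value $c\in\mathbb{R}$. $OS(X)$ is the set of all functionals $\mu\colon C(X)\to\mathbb{R}$ that are: weakly additive ($\mu(\varphi+c_X)=\mu(\varphi)+c$ for all $c\in\mathbb{R}$), order-preserving ($\varphi\le\psi$ implies $\mu(\varphi)\le\mu(\psi)$), normed ($\mu(1_X)=1$), positively homogeneous ($\mu(t\varphi)=t\mu(\varphi)$ for $t\ge 0$), and semiadditive ($\mu(\varphi+\psi)\le\mu(\varphi)+\mu(\psi)$). $OS(X)$ carries the topology of pointwise convergence on $C(X)$. $P(X)\subset OS(X)$ is the subspace of probability measures (linear, non-negative, normed functionals). $\delta_x$ is the Dirac measure at $x$. For nonempty $A\subset P(X)$ put $\nu_A(\varphi)=\sup\{\mu(\varphi):\mu\in A\}$; $cc(P(X))$ is the set of nonempty closed convex subsets of $P(X)$, and $\operatorname{ext}A$ is the set of extreme points of $A\in cc(P(X))$. $P_f(X)$ is the set of finitely supported probability measures $\mu=\sum_{i=1}^n\alpha_i\delta_{x_i}$ (with $x_1,\dots,x_n$ distinct, all $\alpha_i>0$, $\sum_i\alpha_i=1$, so $n=|\operatorname{supp}\mu|$) for which there is $i_0\in\{1,\dots,n\}$ with $\alpha_{i_0}\ge 1-\frac{1}{n+1}$.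 Then $OS_f(X)=\{\nu_A : A\in cc(P(X)),\ \operatorname{ext}A\subset P_f(X)\}\subset OS(X)$, with the subspace topology. For a continuous map $f\colon X\to Y$, $OS(f)\colon OS(X)\to OS(Y)$ is $OS(f)(\mu)(\varphi)=\mu(\varphi\circ f)$, $\varphi\in C(Y)$, and $OS_f(f)\colon OS_f(X)\to OS_f(Y)$ is its restriction (the subscript $f$ in $OS_f$ is part of the functor's name). A covariant functor $F\colon\mathfrak{Comp}\to\mathfrak{Comp}$ is normal if: (1) it is continuous: for every inverse spectrum $S=\{X_\alpha,p_\alpha^\beta;\mathfrak A\}$ of compact Hausdorff spaces, $F(\lim S)=\lim F(S)$, i.e. the natural map $F(\lim S)\to\lim F(S)$ induced by the maps $F(p_\alpha)$, where $p_\alpha$ are the limit projections, is a homeomorphism; (2) it preserves weight: $w(X)=w(F(X))$ for every infinite compact Hausdorff $X$, where $w$ is the smallest cardinality of a base; (3) it is monomorphic: $F(f)$ is injective whenever $f$ is injective (so for closed $A\subset X$ with inclusion $i_A$, $F(A)$ is identified with the subspace $F(i_A)(F(A))$ of $F(X)$); (4) it is epimorphic: $F(f)$ is surjective whenever $f$ is surjective; (5) it preserves intersections: $F(\bigcap_\alpha X_\alpha)=\bigcap_\alpha F(X_\alpha)$ for every family of closed subsets $X_\alpha$ of a compact Hausdorff space $X$; (6) it preserves preimages: $F(f^{-1}(B))=F(f)^{-1}(F(B))$ for every continuous $f\colon X\to Y$ and every closed $B\subset Y$; (7) it preserves a point and the empty set: $F$ of a one-point space is a one-point space, and $F(\varnothing)=\varnothing$.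 *)

theory Defs
  imports "HOL-Analysis.Analysis"
begin

section \<open>The category of compact Hausdorff spaces\<close>

text \<open>
  A space is a topology on a subset of a type, so that the empty space is available. Functions on
  a space are made \<^const>\<open>extensional\<close>, so that equality of morphisms is equality in HOL.
\<close>

definition comp_obj :: "'a topology \<Rightarrow> bool" where
  "comp_obj X \<longleftrightarrow> compact_space X \<and> Hausdorff_space X"

definition comp_hom :: "'a topology \<Rightarrow> 'b topology \<Rightarrow> ('a \<Rightarrow> 'b) set" where
  "comp_hom X Y = {f \<in> extensional (topspace X). continuous_map X Y f}"

definition comp_id :: "'a topology \<Rightarrow> 'a \<Rightarrow> 'a" where
  "comp_id X = (\<lambda>x\<in>topspace X. x)"

definition comp_incl :: "'a topology \<Rightarrow> 'a set \<Rightarrow> 'a \<Rightarrow> 'a" where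
  "comp_incl X A = (\<lambda>x\<in>topspace (subtopology X A). x)"


section \<open>Weight\<close>

definition is_base :: "'a set set \<Rightarrow> 'a topology \<Rightarrow> bool" where
  "is_base B X \<longleftrightarrow> openin X = arbitrary union_of (\<lambda>U. U \<in> B)"

text \<open>Cardinals are compared up to \<^const>\<open>ordIso\<close>; lemma \<open>weight_base\<close> shows that the choice is
  justified.\<close>

definition weight :: "'a topology \<Rightarrow> 'a set rel" where
  "weight X = (SOME r. \<exists>B. is_base B X \<and> r = card_of B \<and>
                 (\<forall>B'. is_base B' X \<longrightarrow> (card_of B, card_of B') \<in> ordLeq))"

lemma is_base_openin: "is_base {U. openin X U} X"
  by (auto simp: is_base_def fun_eq_iff union_of_def arbitrary_def
      intro: exI [of _ "{U}" for U])

lemma weight_base: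
  obtains B where "is_base B X" "weight X = card_of B"
    "\<And>B'. is_base B' X \<Longrightarrow> (weight X, card_of B') \<in> ordLeq"
proof -
  let ?R = "card_of ` {B. is_base B X}"
  have "?R \<noteq> {}"
    using is_base_openin by blast
  moreover have "\<forall>r\<in>?R. Card_order r"
    by (auto simp: card_of_Card_order)
  ultimately have "\<exists>r\<in>?R. \<forall>r'\<in>?R. (r, r') \<in> ordLeq"
    by (rule exists_minim_Card_order)
  then have "\<exists>r B. is_base B X \<and> r = card_of B \<and>
      (\<forall>B'. is_base B' X \<longrightarrow> (card_of B, card_of B') \<in> ordLeq)"
    by blast
  from someI_ex [OF this] that show thesis
    unfolding weight_def [symmetric] by auto
qed


section \<open>Inverse spectra and their limits\<close>

text \<open>
  The index set \<open>I\<close> is directed by \<open>r\<close>, with \<open>(i, j) \<in> r\<close> meaning \<open>i \<le> j\<close>; antisymmetry is not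
  required. The bonding map \<open>p i j\<close> goes from \<open>X j\<close> to \<open>X i\<close>.
\<close>

definition inverse_spectrum ::
    "'i set \<Rightarrow> 'i rel \<Rightarrow> ('i \<Rightarrow> 'a topology) \<Rightarrow> ('i \<Rightarrow> 'i \<Rightarrow> 'a \<Rightarrow> 'a) \<Rightarrow> bool" where
  "inverse_spectrum I r X p \<longleftrightarrow>
     I \<noteq> {} \<and> preorder_on I r \<and>
     (\<forall>i\<in>I. \<forall>j\<in>I. \<exists>k\<in>I. (i, k) \<in> r \<and> (j, k) \<in> r) \<and>
     (\<forall>i\<in>I. comp_obj (X i)) \<and>
     (\<forall>i j. (i, j) \<in> r \<longrightarrow> p i j \<in> comp_hom (X j) (X i)) \<and>
     (\<forall>i\<in>I. p i i = comp_id (X i)) \<and>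
     (\<forall>i j k. (i, j) \<in> r \<longrightarrow> (j, k) \<in> r \<longrightarrow>
        p i k = compose (topspace (X k)) (p i j) (p j k))"

definition spectrum_limit ::
    "'i set \<Rightarrow> 'i rel \<Rightarrow> ('i \<Rightarrow> 'a topology) \<Rightarrow> ('i \<Rightarrow> 'i \<Rightarrow> 'a \<Rightarrow> 'a) \<Rightarrow> ('i \<Rightarrow> 'a) topology" where
  "spectrum_limit I r X p =
     subtopology (product_topology X I) {x. \<forall>i j. (i, j) \<in> r \<longrightarrow> p i j (x j) = x i}"

definition limit_proj ::
    "'i set \<Rightarrow> 'i rel \<Rightarrow> ('i \<Rightarrow> 'a topology) \<Rightarrow> ('i \<Rightarrow> 'i \<Rightarrow> 'a \<Rightarrow> 'a) \<Rightarrow> 'i \<Rightarrow> ('i \<Rightarrow> 'a) \<Rightarrow> 'a" where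
  "limit_proj I r X p i = (\<lambda>x\<in>topspace (spectrum_limit I r X p). x i)"


section \<open>Normal functors\<close>

text \<open>
  A functor consists of an object part and a morphism part, both polymorphic in the types carrying
  the spaces. HOL cannot abstract over a polymorphic constant, so each predicate below takes the
  type instances it involves as separate arguments: \<open>Fa\<close> is the object part on spaces carried by
  \<open>'a\<close>, \<open>Fab\<close> the morphism part from those to spaces carried by \<open>'b\<close>, and so on, with \<open>l\<close> standing
  for the type carrying limits of spectra. A property is asserted of the functor by instantiating
  these arguments with one and the same polymorphic constant.
\<close>

definition comp_functor where
  "comp_functor
      (Fa :: 'a topology \<Rightarrow> 'fa topology)
      (Fb :: 'b topology \<Rightarrow> 'fb topology)
      (Fc :: 'c topology \<Rightarrow> 'fc topology)
      (Faa :: 'a topology \<Rightarrow> 'a topology \<Rightarrow> ('a \<Rightarrow> 'a) \<Rightarrow> 'fa \<Rightarrow> 'fa)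
      (Fab :: 'a topology \<Rightarrow> 'b topology \<Rightarrow> ('a \<Rightarrow> 'b) \<Rightarrow> 'fa \<Rightarrow> 'fb)
      (Fbc :: 'b topology \<Rightarrow> 'c topology \<Rightarrow> ('b \<Rightarrow> 'c) \<Rightarrow> 'fb \<Rightarrow> 'fc)
      (Fac :: 'a topology \<Rightarrow> 'c topology \<Rightarrow> ('a \<Rightarrow> 'c) \<Rightarrow> 'fa \<Rightarrow> 'fc) \<longleftrightarrow>
     (\<forall>X. comp_obj X \<longrightarrow> comp_obj (Fa X)) \<and>
     (\<forall>X Y f. comp_obj X \<longrightarrow> comp_obj Y \<longrightarrow> f \<in> comp_hom X Y \<longrightarrow>
        Fab X Y f \<in> comp_hom (Fa X) (Fb Y)) \<and>
     (\<forall>X. comp_obj X \<longrightarrow> Faa X X (comp_id X) = comp_id (Fa X)) \<and>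
     (\<forall>X Y Z f g. comp_obj X \<longrightarrow> comp_obj Y \<longrightarrow> comp_obj Z \<longrightarrow>
        f \<in> comp_hom X Y \<longrightarrow> g \<in> comp_hom Y Z \<longrightarrow>
        Fac X Z (compose (topspace X) g f) =
          compose (topspace (Fa X)) (Fbc Y Z g) (Fab X Y f))"

definition functor_continuous where
  "functor_continuous (_ :: 'i itself)
      (Fa :: 'a topology \<Rightarrow> 'fa topology)
      (Fl :: ('i \<Rightarrow> 'a) topology \<Rightarrow> 'fl topology)
      (Faa :: 'a topology \<Rightarrow> 'a topology \<Rightarrow> ('a \<Rightarrow> 'a) \<Rightarrow> 'fa \<Rightarrow> 'fa)
      (Fla :: ('i \<Rightarrow> 'a) topology \<Rightarrow> 'a topology \<Rightarrow> (('i \<Rightarrow> 'a) \<Rightarrow> 'a) \<Rightarrow> 'fl \<Rightarrow> 'fa) \<longleftrightarrow>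
     (\<forall>(I :: 'i set) r X p. inverse_spectrum I r X p \<longrightarrow>
        homeomorphic_map
          (Fl (spectrum_limit I r X p))
          (spectrum_limit I r (\<lambda>i. Fa (X i)) (\<lambda>i j. Faa (X j) (X i) (p i j)))
          (\<lambda>\<mu>. \<lambda>i\<in>I. Fla (spectrum_limit I r X p) (X i) (limit_proj I r X p i) \<mu>))"

definition functor_preserves_weight where
  "functor_preserves_weight (Fa :: 'a topology \<Rightarrow> 'fa topology) \<longleftrightarrow>
     (\<forall>X. comp_obj X \<longrightarrow> infinite (topspace X) \<longrightarrow> (weight X, weight (Fa X)) \<in> ordIso)"

definition functor_monomorphic where
  "functor_monomorphic
      (Fa :: 'a topology \<Rightarrow> 'fa topology)
      (Fab :: 'a topology \<Rightarrow> 'b topology \<Rightarrow> ('a \<Rightarrow> 'b) \<Rightarrow> 'fa \<Rightarrow> 'fb) \<longleftrightarrow>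
     (\<forall>X Y f. comp_obj X \<longrightarrow> comp_obj Y \<longrightarrow> f \<in> comp_hom X Y \<longrightarrow>
        inj_on f (topspace X) \<longrightarrow> inj_on (Fab X Y f) (topspace (Fa X)))"

definition functor_epimorphic where
  "functor_epimorphic
      (Fa :: 'a topology \<Rightarrow> 'fa topology)
      (Fb :: 'b topology \<Rightarrow> 'fb topology)
      (Fab :: 'a topology \<Rightarrow> 'b topology \<Rightarrow> ('a \<Rightarrow> 'b) \<Rightarrow> 'fa \<Rightarrow> 'fb) \<longleftrightarrow>
     (\<forall>X Y f. comp_obj X \<longrightarrow> comp_obj Y \<longrightarrow> f \<in> comp_hom X Y \<longrightarrow>
        f ` topspace X = topspace Y \<longrightarrow> Fab X Y f ` topspace (Fa X) = topspace (Fb Y))"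

text \<open>\<open>F(A)\<close> as a subset of \<open>F(X)\<close>, for a closed subset \<open>A\<close> of \<open>X\<close>.\<close>

definition functor_sub where
  "functor_sub
      (Fa :: 'a topology \<Rightarrow> 'fa topology)
      (Faa :: 'a topology \<Rightarrow> 'a topology \<Rightarrow> ('a \<Rightarrow> 'a) \<Rightarrow> 'fa \<Rightarrow> 'fa) X A =
     Faa (subtopology X A) X (comp_incl X A) ` topspace (Fa (subtopology X A))"

text \<open>Intersections are taken inside the ambient space, so that the empty family is covered.\<close>

definition functor_preserves_intersections where
  "functor_preserves_intersections
      (Fa :: 'a topology \<Rightarrow> 'fa topology)
      (Faa :: 'a topology \<Rightarrow> 'a topology \<Rightarrow> ('a \<Rightarrow> 'a) \<Rightarrow> 'fa \<Rightarrow> 'fa) \<longleftrightarrow>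
     (\<forall>X \<A>. comp_obj X \<longrightarrow> (\<forall>A\<in>\<A>. closedin X A) \<longrightarrow>
        functor_sub Fa Faa X (topspace X \<inter> \<Inter>\<A>) =
          topspace (Fa X) \<inter> (\<Inter>A\<in>\<A>. functor_sub Fa Faa X A))"

definition functor_preserves_preimages where
  "functor_preserves_preimages
      (Fa :: 'a topology \<Rightarrow> 'fa topology)
      (Fb :: 'b topology \<Rightarrow> 'fb topology)
      (Faa :: 'a topology \<Rightarrow> 'a topology \<Rightarrow> ('a \<Rightarrow> 'a) \<Rightarrow> 'fa \<Rightarrow> 'fa)
      (Fab :: 'a topology \<Rightarrow> 'b topology \<Rightarrow> ('a \<Rightarrow> 'b) \<Rightarrow> 'fa \<Rightarrow> 'fb)
      (Fbb :: 'b topology \<Rightarrow> 'b topology \<Rightarrow> ('b \<Rightarrow> 'b) \<Rightarrow> 'fb \<Rightarrow> 'fb) \<longleftrightarrow>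
     (\<forall>X Y f B. comp_obj X \<longrightarrow> comp_obj Y \<longrightarrow> f \<in> comp_hom X Y \<longrightarrow> closedin Y B \<longrightarrow>
        functor_sub Fa Faa X {x \<in> topspace X. f x \<in> B} =
          {\<mu> \<in> topspace (Fa X). Fab X Y f \<mu> \<in> functor_sub Fb Fbb Y B})"

definition functor_preserves_point_and_empty where
  "functor_preserves_point_and_empty (Fa :: 'a topology \<Rightarrow> 'fa topology) \<longleftrightarrow>
     (\<forall>X. (\<exists>x. topspace X = {x}) \<longrightarrow> (\<exists>\<mu>. topspace (Fa X) = {\<mu>})) \<and>
     (\<forall>X. topspace X = {} \<longrightarrow> topspace (Fa X) = {})"


section \<open>The functor \<open>OS\<close>\<close>

definition cfun :: "'a topology \<Rightarrow> ('a \<Rightarrow> real) set" where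
  "cfun X = {\<phi> \<in> extensional (topspace X). continuous_map X euclideanreal \<phi>}"

definition OS_set :: "'a topology \<Rightarrow> (('a \<Rightarrow> real) \<Rightarrow> real) set" where
  "OS_set X = {\<mu> \<in> extensional (cfun X).
     (\<forall>\<phi>\<in>cfun X. \<forall>c. \<mu> (\<lambda>x\<in>topspace X. \<phi> x + c) = \<mu> \<phi> + c) \<and>
     (\<forall>\<phi>\<in>cfun X. \<forall>\<psi>\<in>cfun X. (\<forall>x\<in>topspace X. \<phi> x \<le> \<psi> x) \<longrightarrow> \<mu> \<phi> \<le> \<mu> \<psi>) \<and>
     \<mu> (\<lambda>x\<in>topspace X. 1) = 1 \<and>
     (\<forall>\<phi>\<in>cfun X. \<forall>t\<ge>0. \<mu> (\<lambda>x\<in>topspace X. t * \<phi> x) = t * \<mu> \<phi>) \<and>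
     (\<forall>\<phi>\<in>cfun X. \<forall>\<psi>\<in>cfun X. \<mu> (\<lambda>x\<in>topspace X. \<phi> x + \<psi> x) \<le> \<mu> \<phi> + \<mu> \<psi>)}"

text \<open>The points of the product below are the extensional functions on \<^term>\<open>cfun X\<close>, so this is
  the topology of pointwise convergence.\<close>

definition OS :: "'a topology \<Rightarrow> (('a \<Rightarrow> real) \<Rightarrow> real) topology" where
  "OS X = subtopology (product_topology (\<lambda>_. euclideanreal) (cfun X)) (OS_set X)"

definition OS_map ::
    "'a topology \<Rightarrow> 'b topology \<Rightarrow> ('a \<Rightarrow> 'b) \<Rightarrow> (('a \<Rightarrow> real) \<Rightarrow> real) \<Rightarrow> (('b \<Rightarrow> real) \<Rightarrow> real)" where
  "OS_map X Y f = (\<lambda>\<mu>\<in>topspace (OS X). \<lambda>\<phi>\<in>cfun Y. \<mu> (\<lambda>x\<in>topspace X. \<phi> (f x)))"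


section \<open>Probability measures and the functor \<open>OS\<^sub>f\<close>\<close>

definition P_set :: "'a topology \<Rightarrow> (('a \<Rightarrow> real) \<Rightarrow> real) set" where
  "P_set X = {\<mu> \<in> extensional (cfun X).
     (\<forall>\<phi>\<in>cfun X. \<forall>\<psi>\<in>cfun X. \<mu> (\<lambda>x\<in>topspace X. \<phi> x + \<psi> x) = \<mu> \<phi> + \<mu> \<psi>) \<and>
     (\<forall>\<phi>\<in>cfun X. \<forall>t. \<mu> (\<lambda>x\<in>topspace X. t * \<phi> x) = t * \<mu> \<phi>) \<and>
     (\<forall>\<phi>\<in>cfun X. (\<forall>x\<in>topspace X. 0 \<le> \<phi> x) \<longrightarrow> 0 \<le> \<mu> \<phi>) \<and>
     \<mu> (\<lambda>x\<in>topspace X. 1) = 1}"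

definition P :: "'a topology \<Rightarrow> (('a \<Rightarrow> real) \<Rightarrow> real) topology" where
  "P X = subtopology (OS X) (P_set X)"

definition dirac :: "'a topology \<Rightarrow> 'a \<Rightarrow> ('a \<Rightarrow> real) \<Rightarrow> real" where
  "dirac X x = (\<lambda>\<phi>\<in>cfun X. \<phi> x)"

definition nu :: "'a topology \<Rightarrow> (('a \<Rightarrow> real) \<Rightarrow> real) set \<Rightarrow> ('a \<Rightarrow> real) \<Rightarrow> real" where
  "nu X A = (\<lambda>\<phi>\<in>cfun X. SUP \<mu>\<in>A. \<mu> \<phi>)"

text \<open>The function type carries no vector space structure, hence convexity and extreme points are
  spelled out for functionals on \<^term>\<open>cfun X\<close>.\<close>

definition mix ::
    "'a topology \<Rightarrow> real \<Rightarrow> (('a \<Rightarrow> real) \<Rightarrow> real) \<Rightarrow> (('a \<Rightarrow> real) \<Rightarrow> real) \<Rightarrow> ('a \<Rightarrow> real) \<Rightarrow> real" where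
  "mix X t \<mu> \<nu> = (\<lambda>\<phi>\<in>cfun X. (1 - t) * \<mu> \<phi> + t * \<nu> \<phi>)"

definition cc_P :: "'a topology \<Rightarrow> (('a \<Rightarrow> real) \<Rightarrow> real) set set" where
  "cc_P X = {A. A \<noteq> {} \<and> closedin (P X) A \<and>
     (\<forall>\<mu>\<in>A. \<forall>\<nu>\<in>A. \<forall>t\<in>{0..1}. mix X t \<mu> \<nu> \<in> A)}"

definition ext_points ::
    "'a topology \<Rightarrow> (('a \<Rightarrow> real) \<Rightarrow> real) set \<Rightarrow> (('a \<Rightarrow> real) \<Rightarrow> real) set" where
  "ext_points X A = {\<mu> \<in> A. \<forall>a\<in>A. \<forall>b\<in>A. a \<noteq> b \<longrightarrow> (\<forall>t\<in>{0<..<1}. \<mu> \<noteq> mix X t a b)}"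

definition P_f :: "'a topology \<Rightarrow> (('a \<Rightarrow> real) \<Rightarrow> real) set" where
  "P_f X = {\<mu>. \<exists>S \<alpha>. finite S \<and> S \<subseteq> topspace X \<and> (\<forall>x\<in>S. \<alpha> x > 0) \<and> (\<Sum>x\<in>S. \<alpha> x) = 1 \<and>
     \<mu> = (\<lambda>\<phi>\<in>cfun X. \<Sum>x\<in>S. \<alpha> x * dirac X x \<phi>) \<and>
     (\<exists>x\<^sub>0\<in>S. \<alpha> x\<^sub>0 \<ge> 1 - 1 / (real (card S) + 1))}"

definition OSf_set :: "'a topology \<Rightarrow> (('a \<Rightarrow> real) \<Rightarrow> real) set" where
  "OSf_set X = {nu X A |A. A \<in> cc_P X \<and> ext_points X A \<subseteq> P_f X}"

definition OSf :: "'a topology \<Rightarrow> (('a \<Rightarrow> real) \<Rightarrow> real) topology" where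
  "OSf X = subtopology (OS X) (OSf_set X)"

definition OSf_map ::
    "'a topology \<Rightarrow> 'b topology \<Rightarrow> ('a \<Rightarrow> 'b) \<Rightarrow> (('a \<Rightarrow> real) \<Rightarrow> real) \<Rightarrow> (('b \<Rightarrow> real) \<Rightarrow> real)" where
  "OSf_map X Y f = restrict (OS_map X Y f) (topspace (OSf X))"

end

theory Submission
  imports Defs
begin

text \<open>
  The definition of \<open>OSf_set X\<close> through extreme points is replaced by a pointwise one: a functional
  \<open>F\<close> belongs to it iff for each \<open>\<phi>\<close> there is \<open>\<mu> \<in> P_f X\<close> with \<open>\<mu> \<le> F\<close> on all of \<open>cfun X\<close> and
  \<open>\<mu> \<phi> = F \<phi>\<close> (lemma \<open>OSf_set_iff\<close>). One direction holds since a compact convex set has, for each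
  \<open>\<phi>\<close>, an extreme point at which \<open>\<phi>\<close> is largest (\<open>ext_point_attains_max\<close>, by Zorn's lemma for
  closed faces). For the other, \<open>F\<close> is the supremum of the compact set \<open>K\<close> of all \<open>\<mu> \<in> P_f X\<close>
  below it, hence also of the closed convex hull of \<open>K\<close>, and by Milman's theorem the extreme points
  of the hull lie in \<open>K\<close> (\<open>ext_points_closed_hull\<close>). Compactness of \<open>K\<close> rests on that of \<open>P_f X\<close>
  (\<open>closedin_P_f\<close>): measures with a bounded number of atoms form a compact set, and when the number
  of atoms grows the dominating weight tends to \<open>1\<close>, so that the limit is a Dirac measure.

  After this, each property of \<open>OS\<^sub>f\<close> comes from the same property of the measures in \<open>P_f\<close>, which
  are finite convex combinations of points and are moved by moving the points. Images of functionals
  are immediate. Preimages are given by \<open>OSf_common_lift\<close>: a functional (or a family of functionals)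
  lifts along a map as soon as enough measures below it do, for the compact set of all
  liftable measures has the required supremum. This gives surjectivity for surjective maps, and it
  gives \<open>functor_sub_OSf\<close>: a functional comes from a closed subset \<open>A\<close> iff it is nonpositive on the
  functions that vanish on \<open>A\<close>, i.e. iff every \<open>\<mu> \<in> P_f X\<close> below it is supported in \<open>A\<close>.
  Intersections and preimages follow by looking at supports. Injectivity for injective maps is
  Tietze's extension theorem.

  Functionals in \<open>OSf_set X\<close> are nonexpansive for the supremum norm, so they are determined by their
  values on a dense set of functions. A variant of the Stone--Weierstrass theorem that needs only
  binary maxima (\<open>approximating_if_max_closed\<close>) provides such sets: one of cardinality at most the
  weight of \<open>X\<close>, which bounds the weight of \<open>OSf X\<close> (the converse bound comes from the Dirac
  embedding), and, on the limit of a spectrum, the functions that factor through a projection, which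
  makes the canonical map of continuity injective. Its surjectivity needs measures on the limit that
  lie below a given thread of functionals (\<open>limit_lift\<close>). These are found in the product of the
  spectrum, which contains the limit but admits a section over each space: push suitable measures
  forward along the sections and use that \<open>P_f\<close> of the product is compact.
\<close>



section \<open>Closed conditions and compactness\<close>

lemma closedin_Collect_ball:
  assumes "\<And>i. i \<in> I \<Longrightarrow> closedin X {x \<in> topspace X. Q i x}"
  shows "closedin X {x \<in> topspace X. \<forall>i\<in>I. Q i x}"
proof (cases "I = {}")
  case False
  have "{x \<in> topspace X. \<forall>i\<in>I. Q i x} = (\<Inter>i\<in>I. {x \<in> topspace X. Q i x})"
    using False by auto
  then show ?thesis
    using assms False by auto
qed auto

lemma closedin_Collect_imp:
  assumes "R \<Longrightarrow> closedin X {x \<in> topspace X. Q x}"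
  shows "closedin X {x \<in> topspace X. R \<longrightarrow> Q x}"
  using assms by (cases R) auto

lemma closedin_Collect_conj:
  assumes "closedin X {x \<in> topspace X. Q x}" "closedin X {x \<in> topspace X. R x}"
  shows "closedin X {x \<in> topspace X. Q x \<and> R x}"
proof -
  have "{x \<in> topspace X. Q x \<and> R x} = {x \<in> topspace X. Q x} \<inter> {x \<in> topspace X. R x}"
    by auto
  then show ?thesis
    using assms by (simp add: closedin_Int)
qed

lemma closedin_Collect_le:
  assumes "continuous_map X euclideanreal f" "continuous_map X euclideanreal g"
  shows "closedin X {x \<in> topspace X. f x \<le> g x}"
proof -
  have "continuous_map X euclideanreal (\<lambda>x. g x - f x)"
    using assms by (intro continuous_intros)
  from closedin_continuous_map_preimage [OF this, of "{0..}"]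
  show ?thesis
    by simp
qed

lemma closedin_Collect_eq:
  assumes "continuous_map X euclideanreal f" "continuous_map X euclideanreal g"
  shows "closedin X {x \<in> topspace X. f x = g x}"
  by (rule closedin_continuous_maps_eq [OF _ assms]) simp

lemma openin_Collect_less:
  assumes "continuous_map X euclideanreal f" "continuous_map X euclideanreal g"
  shows "openin X {x \<in> topspace X. f x < g x}"
proof -
  have "continuous_map X euclideanreal (\<lambda>x. g x - f x)"
    using assms by (intro continuous_intros)
  from openin_continuous_map_preimage [OF this, of "{0<..}"]
  show ?thesis
    by simp
qed

lemma openin_Collect_finite_ball:
  assumes "finite J" "\<And>i. i \<in> J \<Longrightarrow> openin X {x \<in> topspace X. Q i x}"
  shows "openin X {x \<in> topspace X. \<forall>i\<in>J. Q i x}"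
  using assms
proof (induction J)
  case (insert i J)
  have "{x \<in> topspace X. \<forall>k\<in>insert i J. Q k x} =
      {x \<in> topspace X. Q i x} \<inter> {x \<in> topspace X. \<forall>k\<in>J. Q k x}"
    by auto
  with insert show ?case
    by (metis (no_types, lifting) insert_iff openin_Int)
qed auto

text \<open>The finite intersection property, phrased for conditions, so that an object subject to infinitely
  many closed conditions can be found by meeting finitely many of them at a time.\<close>

lemma compactin_common_point:
  assumes K: "compactin X K"
    and closed: "\<And>i. i \<in> I \<Longrightarrow> closedin X {x \<in> topspace X. Q i x}"
    and fin: "\<And>J. finite J \<Longrightarrow> J \<subseteq> I \<Longrightarrow> \<exists>x\<in>K. \<forall>i\<in>J. Q i x"
  shows "\<exists>x\<in>K. \<forall>i\<in>I. Q i x"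
proof -
  let ?C = "\<lambda>i. {x \<in> topspace X. Q i x}"
  have KX: "K \<subseteq> topspace X"
    using K by (rule compactin_subset_topspace)
  have "K \<inter> \<Inter>\<F> \<noteq> {}" if F: "finite \<F>" "\<F> \<subseteq> ?C ` I" for \<F>
  proof -
    obtain J where J: "J \<subseteq> I" "finite J" "\<F> = ?C ` J"
      using finite_subset_image [OF F] by blast
    then show ?thesis
      using fin [OF J(2,1)] KX by auto
  qed
  then have "K \<inter> \<Inter>(?C ` I) \<noteq> {}"
    using K closed by (auto simp: compactin_fip)
  then show ?thesis
    by auto
qed

lemma compactin_attains_max:
  assumes "compactin X K" "K \<noteq> {}" "continuous_map X euclideanreal f"
  obtains x where "x \<in> K" "\<And>y. y \<in> K \<Longrightarrow> f y \<le> f x"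
proof -
  have "compact (f ` K)"
    using image_compactin [OF assms(1,3)] by simp
  then obtain m where "m \<in> f ` K" "\<And>t. t \<in> f ` K \<Longrightarrow> t \<le> m"
    using assms(2) compact_attains_sup [of "f ` K"] by blast
  with that show thesis
    by blast
qed


section \<open>Continuous functions\<close>

abbreviation pw_topology :: "'a topology \<Rightarrow> (('a \<Rightarrow> real) \<Rightarrow> real) topology" where
  "pw_topology X \<equiv> product_topology (\<lambda>_. euclideanreal) (cfun X)"

lemma topspace_pw [simp]: "topspace (pw_topology X) = extensional (cfun X)"
  by (simp add: PiE_def)

lemma Hausdorff_pw: "Hausdorff_space (pw_topology X)"
  by (simp add: Hausdorff_space_product_topology)

lemma continuous_map_eval:
  "\<phi> \<in> cfun X \<Longrightarrow> continuous_map (pw_topology X) euclideanreal (\<lambda>F. F \<phi>)"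
  by (rule continuous_map_product_projection)

lemma cfunI: "continuous_map X euclideanreal g \<Longrightarrow> restrict g (topspace X) \<in> cfun X"
  by (simp add: cfun_def continuous_map_eq)

lemma cfunD: "\<phi> \<in> cfun X \<Longrightarrow> continuous_map X euclideanreal \<phi>"
  by (simp add: cfun_def)

lemma restrict_cfun [simp]: "\<phi> \<in> cfun X \<Longrightarrow> restrict \<phi> (topspace X) = \<phi>"
  by (simp add: cfun_def extensional_restrict)

lemma cfun_eqI:
  "\<phi> \<in> cfun X \<Longrightarrow> \<psi> \<in> cfun X \<Longrightarrow> (\<And>x. x \<in> topspace X \<Longrightarrow> \<phi> x = \<psi> x) \<Longrightarrow> \<phi> = \<psi>"
  unfolding cfun_def using extensionalityI by blast

lemma cfun_const [simp]: "(\<lambda>x\<in>topspace X. c) \<in> cfun X"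
  by (intro cfunI) simp

lemma cfun_add [simp]:
  "\<phi> \<in> cfun X \<Longrightarrow> \<psi> \<in> cfun X \<Longrightarrow> (\<lambda>x\<in>topspace X. \<phi> x + \<psi> x) \<in> cfun X"
  by (intro cfunI continuous_map_add cfunD)

lemma cfun_add_const [simp]:
  "\<phi> \<in> cfun X \<Longrightarrow> (\<lambda>x\<in>topspace X. \<phi> x + c) \<in> cfun X"
  by (intro cfunI continuous_map_add) (simp_all add: cfunD)

lemma cfun_scale [simp]: "\<phi> \<in> cfun X \<Longrightarrow> (\<lambda>x\<in>topspace X. t * \<phi> x) \<in> cfun X"
  by (intro cfunI continuous_map_real_mult_left cfunD)

lemma cfun_comp [simp]:
  "f \<in> comp_hom X Y \<Longrightarrow> \<phi> \<in> cfun Y \<Longrightarrow> (\<lambda>x\<in>topspace X. \<phi> (f x)) \<in> cfun X"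
  unfolding comp_hom_def
  using cfunI [of X "\<phi> \<circ> f"] continuous_map_compose [of X Y f euclideanreal \<phi>]
  by (auto dest: cfunD simp: o_def)

lemma comp_hom_in: "f \<in> comp_hom X Y \<Longrightarrow> x \<in> topspace X \<Longrightarrow> f x \<in> topspace Y"
  unfolding comp_hom_def using continuous_map_funspace by fastforce

lemma comp_hom_cont: "f \<in> comp_hom X Y \<Longrightarrow> continuous_map X Y f"
  by (simp add: comp_hom_def)

lemma cfun_bounded:
  assumes "comp_obj X" "\<phi> \<in> cfun X"
  obtains M where "0 \<le> M" "\<And>x. x \<in> topspace X \<Longrightarrow> \<bar>\<phi> x\<bar> \<le> M"
proof -
  have "compact (\<phi> ` topspace X)"
    using image_compactin [of X "topspace X" euclideanreal \<phi>] assms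
    by (auto simp: comp_obj_def compact_space_def dest: cfunD)
  then obtain M where "\<And>x. x \<in> topspace X \<Longrightarrow> \<bar>\<phi> x\<bar> \<le> M"
    by (meson bounded_real compact_imp_bounded imageI)
  with that [of "max M 0"] show thesis
    by (meson max.cobounded2 max.coboundedI1)
qed

lemma Urysohn_off_closed:
  assumes X: "comp_obj X" and A: "closedin X A" and x: "x \<in> topspace X" "x \<notin> A"
  obtains u where "u \<in> cfun X" "u x = 1" "\<forall>y\<in>A. u y = 0" "\<forall>y\<in>topspace X. 0 \<le> u y \<and> u y \<le> 1"
proof -
  have "normal_space X"
    using X by (auto simp: comp_obj_def compact_Hausdorff_or_regular_imp_normal_space)
  moreover have "closedin X {x}"
    using X x(1) by (simp add: comp_obj_def closedin_Hausdorff_singleton)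
  ultimately obtain g where g: "continuous_map X (top_of_set {0..1::real}) g" "g ` A \<subseteq> {0}" "g ` {x} \<subseteq> {1}"
    using Urysohn_lemma [of X A "{x}" 0 1] A x(2) by auto
  have "g y \<in> {0..1}" if "y \<in> topspace X" for y
    using g(1) that continuous_map_funspace by fastforce
  moreover have "restrict g (topspace X) \<in> cfun X"
    using g(1) by (intro cfunI) (auto simp: continuous_map_in_subtopology)
  ultimately show thesis
    using that [of "restrict g (topspace X)"] g(2,3) x(1) closedin_subset [OF A] by fastforce
qed


section \<open>Probability functionals\<close>

lemma P_set_ext: "\<mu> \<in> P_set X \<Longrightarrow> \<mu> \<in> extensional (cfun X)"
  by (simp add: P_set_def)

lemma P_add:
  "\<mu> \<in> P_set X \<Longrightarrow> \<phi> \<in> cfun X \<Longrightarrow> \<psi> \<in> cfun X \<Longrightarrow>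
    \<mu> (\<lambda>x\<in>topspace X. \<phi> x + \<psi> x) = \<mu> \<phi> + \<mu> \<psi>"
  by (simp add: P_set_def)

lemma P_scale: "\<mu> \<in> P_set X \<Longrightarrow> \<phi> \<in> cfun X \<Longrightarrow> \<mu> (\<lambda>x\<in>topspace X. t * \<phi> x) = t * \<mu> \<phi>"
  by (simp add: P_set_def)

lemma P_nonneg:
  "\<mu> \<in> P_set X \<Longrightarrow> \<phi> \<in> cfun X \<Longrightarrow> (\<And>x. x \<in> topspace X \<Longrightarrow> 0 \<le> \<phi> x) \<Longrightarrow> 0 \<le> \<mu> \<phi>"
  by (simp add: P_set_def)

lemma P_const:
  assumes "\<mu> \<in> P_set X"
  shows "\<mu> (\<lambda>x\<in>topspace X. c) = c"
proof -
  have "(\<lambda>x\<in>topspace X. c) = (\<lambda>x\<in>topspace X. c * (\<lambda>x\<in>topspace X. 1) x)"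
    by auto
  then have "\<mu> (\<lambda>x\<in>topspace X. c) = c * \<mu> (\<lambda>x\<in>topspace X. 1)"
    using P_scale [OF assms, of "\<lambda>x\<in>topspace X. 1" c] by simp
  with assms show ?thesis
    by (simp add: P_set_def)
qed

lemma P_add_const:
  assumes "\<mu> \<in> P_set X" "\<phi> \<in> cfun X"
  shows "\<mu> (\<lambda>x\<in>topspace X. \<phi> x + c) = \<mu> \<phi> + c"
proof -
  have "(\<lambda>x\<in>topspace X. \<phi> x + c) = (\<lambda>x\<in>topspace X. \<phi> x + (\<lambda>x\<in>topspace X. c) x)"
    by auto
  then show ?thesis
    using P_add [OF assms cfun_const] by (simp add: P_const [OF assms(1)])
qed

lemma P_mono:
  assumes "\<mu> \<in> P_set X" "\<phi> \<in> cfun X" "\<psi> \<in> cfun X"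
    and le: "\<And>x. x \<in> topspace X \<Longrightarrow> \<phi> x \<le> \<psi> x"
  shows "\<mu> \<phi> \<le> \<mu> \<psi>"
proof -
  define \<theta> where "\<theta> = (\<lambda>x\<in>topspace X. \<psi> x + (\<lambda>x\<in>topspace X. -1 * \<phi> x) x)"
  have "\<mu> \<theta> = \<mu> \<psi> + -1 * \<mu> \<phi>"
    unfolding \<theta>_def by (simp only: P_add [OF assms(1,3) cfun_scale [OF assms(2)]] P_scale [OF assms(1,2)])
  moreover have "\<theta> \<in> cfun X"
    unfolding \<theta>_def by (intro cfun_add cfun_scale assms)
  then have "0 \<le> \<mu> \<theta>"
    by (rule P_nonneg [OF assms(1)]) (simp add: \<theta>_def le)
  ultimately show ?thesis
    by simp
qed

lemma P_bounded:
  assumes "\<mu> \<in> P_set X" "\<phi> \<in> cfun X" "\<And>x. x \<in> topspace X \<Longrightarrow> \<bar>\<phi> x\<bar> \<le> M"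
  shows "\<bar>\<mu> \<phi>\<bar> \<le> M"
proof -
  have "\<mu> \<phi> \<le> \<mu> (\<lambda>x\<in>topspace X. M)"
    using assms(3) by (rule_tac P_mono [OF assms(1,2)]) (force simp: abs_le_iff)+
  moreover have "\<mu> (\<lambda>x\<in>topspace X. -M) \<le> \<mu> \<phi>"
    using assms(3) by (rule_tac P_mono [OF assms(1) _ assms(2)]) (force simp: abs_le_iff minus_le_iff)+
  ultimately show ?thesis
    by (simp add: P_const [OF assms(1)])
qed

lemma closedin_P_set: "closedin (pw_topology X) (P_set X)"
proof -
  have eq: "P_set X = {\<mu> \<in> topspace (pw_topology X).
     (\<forall>\<phi>\<in>cfun X. \<forall>\<psi>\<in>cfun X. \<mu> (\<lambda>x\<in>topspace X. \<phi> x + \<psi> x) = \<mu> \<phi> + \<mu> \<psi>) \<and>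
     (\<forall>\<phi>\<in>cfun X. \<forall>t\<in>UNIV. \<mu> (\<lambda>x\<in>topspace X. t * \<phi> x) = t * \<mu> \<phi>) \<and>
     (\<forall>\<phi>\<in>cfun X. (\<forall>x\<in>topspace X. 0 \<le> \<phi> x) \<longrightarrow> 0 \<le> \<mu> \<phi>) \<and>
     \<mu> (\<lambda>x\<in>topspace X. 1) = 1}"
    unfolding P_set_def topspace_pw by simp
  have "closedin (pw_topology X) {\<mu> \<in> topspace (pw_topology X).
      \<forall>\<phi>\<in>cfun X. \<forall>\<psi>\<in>cfun X. \<mu> (\<lambda>x\<in>topspace X. \<phi> x + \<psi> x) = \<mu> \<phi> + \<mu> \<psi>}"
    by (rule closedin_Collect_ball, rule closedin_Collect_ball, rule closedin_Collect_eq)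
      (rule continuous_map_eval continuous_map_add cfun_add | assumption)+
  moreover have "closedin (pw_topology X) {\<mu> \<in> topspace (pw_topology X).
      \<forall>\<phi>\<in>cfun X. \<forall>t\<in>UNIV. \<mu> (\<lambda>x\<in>topspace X. t * \<phi> x) = t * \<mu> \<phi>}"
    by (rule closedin_Collect_ball, rule closedin_Collect_ball, rule closedin_Collect_eq)
      (rule continuous_map_eval continuous_map_real_mult_left cfun_scale | assumption)+
  moreover have "closedin (pw_topology X) {\<mu> \<in> topspace (pw_topology X).
      \<forall>\<phi>\<in>cfun X. (\<forall>x\<in>topspace X. 0 \<le> \<phi> x) \<longrightarrow> 0 \<le> \<mu> \<phi>}"
    by (rule closedin_Collect_ball, rule closedin_Collect_imp, rule closedin_Collect_le)
      (simp, rule continuous_map_eval, assumption)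
  moreover have "closedin (pw_topology X) {\<mu> \<in> topspace (pw_topology X).
      \<mu> (\<lambda>x\<in>topspace X. 1) = 1}"
    by (rule closedin_Collect_eq, rule continuous_map_eval) simp_all
  ultimately show ?thesis
    unfolding eq by (rule closedin_Collect_conj [OF _ closedin_Collect_conj [OF _ closedin_Collect_conj]])
qed

lemma closed_bounded_compactin_pw:
  assumes "comp_obj X" "closedin (pw_topology X) C"
    and "\<And>F \<phi> M. F \<in> C \<Longrightarrow> \<phi> \<in> cfun X \<Longrightarrow> (\<And>x. x \<in> topspace X \<Longrightarrow> \<bar>\<phi> x\<bar> \<le> M) \<Longrightarrow> \<bar>F \<phi>\<bar> \<le> M"
  shows "compactin (pw_topology X) C"
proof -
  have "\<forall>\<phi>\<in>cfun X. \<exists>M. \<forall>x\<in>topspace X. \<bar>\<phi> x\<bar> \<le> M"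
    by (meson assms(1) cfun_bounded)
  then obtain M where M: "\<And>\<phi> x. \<phi> \<in> cfun X \<Longrightarrow> x \<in> topspace X \<Longrightarrow> \<bar>\<phi> x\<bar> \<le> M \<phi>"
    by metis
  have "compactin (pw_topology X) (PiE (cfun X) (\<lambda>\<phi>. {- M \<phi>..M \<phi>}))"
    by (simp add: compactin_PiE)
  moreover have "C \<subseteq> PiE (cfun X) (\<lambda>\<phi>. {- M \<phi>..M \<phi>})"
  proof
    fix F assume F: "F \<in> C"
    have "\<bar>F \<phi>\<bar> \<le> M \<phi>" if "\<phi> \<in> cfun X" for \<phi>
      using assms(3) [OF F that] M that by blast
    moreover have "F \<in> extensional (cfun X)"
      using F closedin_subset [OF assms(2)] by (auto simp: PiE_def)
    ultimately show "F \<in> PiE (cfun X) (\<lambda>\<phi>. {- M \<phi>..M \<phi>})"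
      by (auto simp: PiE_def abs_le_iff minus_le_iff)
  qed
  ultimately show ?thesis
    using assms(2) closed_compactin by blast
qed

lemma compactin_P_set: "comp_obj X \<Longrightarrow> compactin (pw_topology X) (P_set X)"
  by (rule closed_bounded_compactin_pw [OF _ closedin_P_set]) (use P_bounded in blast)+

lemma P_set_sub_OS_set: "P_set X \<subseteq> OS_set X"
proof
  fix \<mu> assume \<mu>: "\<mu> \<in> P_set X"
  have "\<mu> \<phi> \<le> \<mu> \<psi>"
    if "\<phi> \<in> cfun X" "\<psi> \<in> cfun X" "\<forall>x\<in>topspace X. \<phi> x \<le> \<psi> x" for \<phi> \<psi>
    using P_mono [OF \<mu> that(1,2)] that(3) by blast
  then show "\<mu> \<in> OS_set X"
    unfolding OS_set_def
    by (simp add: P_set_ext [OF \<mu>] P_add [OF \<mu>] P_scale [OF \<mu>] P_add_const [OF \<mu>] P_const [OF \<mu>])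
qed

lemma topspace_OS: "topspace (OS X) = OS_set X"
  by (auto simp: OS_def OS_set_def PiE_def)

lemma P_eq: "P X = subtopology (pw_topology X) (P_set X)"
  unfolding P_def OS_def subtopology_subtopology
  using P_set_sub_OS_set [of X] by (simp add: inf_absorb2)

lemma closedin_P_iff: "closedin (P X) A \<longleftrightarrow> A \<subseteq> P_set X \<and> closedin (pw_topology X) A"
  unfolding P_eq using closedin_P_set by (metis closedin_closed_subtopology)



section \<open>Finite convex combinations of point evaluations\<close>

definition comb :: "'a topology \<Rightarrow> 'j set \<Rightarrow> ('j \<Rightarrow> real) \<Rightarrow> ('j \<Rightarrow> 'a) \<Rightarrow> ('a \<Rightarrow> real) \<Rightarrow> real" where
  "comb X J \<alpha> x = (\<lambda>\<phi>\<in>cfun X. \<Sum>j\<in>J. \<alpha> j * \<phi> (x j))"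

lemma comb_apply: "\<phi> \<in> cfun X \<Longrightarrow> comb X J \<alpha> x \<phi> = (\<Sum>j\<in>J. \<alpha> j * \<phi> (x j))"
  by (simp add: comb_def)

lemma comb_ext [simp]: "comb X J \<alpha> x \<in> extensional (cfun X)"
  by (simp add: comb_def)

lemma comb_in_P_set:
  fixes x :: "'j \<Rightarrow> 'a"
  assumes x: "\<And>j. j \<in> J \<Longrightarrow> x j \<in> topspace X" and \<alpha>: "\<And>j. j \<in> J \<Longrightarrow> 0 \<le> \<alpha> j" "sum \<alpha> J = 1"
  shows "comb X J \<alpha> x \<in> P_set X"
proof -
  have "(\<Sum>j\<in>J. \<alpha> j * (t * \<phi> (x j))) = t * (\<Sum>j\<in>J. \<alpha> j * \<phi> (x j))" for t :: real and \<phi> :: "'a \<Rightarrow> real"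
    by (simp add: sum_distrib_left mult.left_commute)
  then show ?thesis
    unfolding P_set_def
    by (simp add: comb_apply x \<alpha> distrib_left sum.distrib sum_nonneg cong: sum.cong)
qed

lemma P_f_obtain:
  assumes "\<mu> \<in> P_f X"
  obtains S \<alpha> x\<^sub>0 where "finite S" "S \<subseteq> topspace X" "\<forall>x\<in>S. 0 < \<alpha> x" "sum \<alpha> S = 1"
    "x\<^sub>0 \<in> S" "1 - 1 / (real (card S) + 1) \<le> \<alpha> x\<^sub>0" "\<mu> = comb X S \<alpha> (\<lambda>x. x)"
proof -
  have eq: "(\<lambda>\<phi>\<in>cfun X. \<Sum>x\<in>S. \<alpha> x * dirac X x \<phi>) = comb X S \<alpha> (\<lambda>x. x)" for S \<alpha>
    by (auto simp: comb_def dirac_def)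
  from assms obtain S \<alpha> where S: "finite S" "S \<subseteq> topspace X" "\<forall>x\<in>S. 0 < \<alpha> x" "sum \<alpha> S = 1"
    "\<mu> = comb X S \<alpha> (\<lambda>x. x)" "\<exists>x\<^sub>0\<in>S. 1 - 1 / (real (card S) + 1) \<le> \<alpha> x\<^sub>0"
    unfolding P_f_def eq by blast
  then show thesis
    using that by blast
qed

lemma P_f_sub_P_set: "P_f X \<subseteq> P_set X"
proof
  fix \<mu> assume "\<mu> \<in> P_f X"
  then obtain S \<alpha> x\<^sub>0 where "finite S" "S \<subseteq> topspace X" "\<forall>x\<in>S. 0 < \<alpha> x" "sum \<alpha> S = 1"
    "x\<^sub>0 \<in> S" "1 - 1 / (real (card S) + 1) \<le> \<alpha> x\<^sub>0" and \<mu>: "\<mu> = comb X S \<alpha> (\<lambda>x. x)"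
    by (rule P_f_obtain)
  then show "\<mu> \<in> P_set X"
    unfolding \<mu> by (rule_tac comb_in_P_set) (auto simp: less_imp_le)
qed

text \<open>Merging indices with the same point and dropping those of weight zero decreases the number
  of points and does not decrease the largest weight, whereas the bound \<open>1 - 1 / (n + 1)\<close> increases
  with \<open>n\<close>. So a representation with redundant indices still gives an element of \<open>P_f X\<close>. This is
  what makes \<open>P_f\<close> stable under limits with bounded supports and under images of maps.\<close>

lemma comb_in_P_f:
  assumes J: "finite J" and x: "\<And>j. j \<in> J \<Longrightarrow> x j \<in> topspace X"
    and \<alpha>: "\<And>j. j \<in> J \<Longrightarrow> 0 \<le> \<alpha> j" "sum \<alpha> J = 1"
    and j0: "j\<^sub>0 \<in> J" "1 - 1 / (real (card J) + 1) \<le> \<alpha> j\<^sub>0"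
  shows "comb X J \<alpha> x \<in> P_f X"
proof -
  define J' where "J' = {j\<in>J. 0 < \<alpha> j}"
  define S where "S = x ` J'"
  define \<beta> where "\<beta> y = (\<Sum>j\<in>{j\<in>J'. x j = y}. \<alpha> j)" for y
  have J': "finite J'" "J' \<subseteq> J" "\<And>j. j \<in> J' \<Longrightarrow> 0 < \<alpha> j"
    using J by (auto simp: J'_def)
  have zero: "\<And>j. j \<in> J - J' \<Longrightarrow> \<alpha> j = 0"
    using \<alpha>(1) by (force simp: J'_def)
  have S: "finite S" "S \<subseteq> topspace X"
    using J' x by (auto simp: S_def)
  have cardS: "card S \<le> card J"
    using J J' card_image_le [of J' x] card_mono [of J J'] by (simp add: S_def)
  have sum_eq: "(\<Sum>y\<in>S. \<beta> y * g y) = (\<Sum>j\<in>J. \<alpha> j * g (x j))" for g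
  proof -
    have "(\<Sum>j\<in>J. \<alpha> j * g (x j)) = (\<Sum>j\<in>J'. \<alpha> j * g (x j))"
      by (rule sum.mono_neutral_right) (use J J' zero in auto)
    also have "\<dots> = (\<Sum>y\<in>S. \<Sum>j\<in>{j\<in>J'. x j = y}. \<alpha> j * g (x j))"
      unfolding S_def by (rule sum.image_gen [OF J'(1)])
    also have "\<dots> = (\<Sum>y\<in>S. \<beta> y * g y)"
      by (intro sum.cong) (simp_all add: \<beta>_def sum_distrib_right)
    finally show ?thesis by simp
  qed
  have "1 \<le> card J"
    using J j0(1) by (metis card_gt_0_iff empty_iff less_eq_Suc_le One_nat_def)
  then have "1 / (real (card J) + 1) \<le> 1 / 2"
    by (intro divide_left_mono) auto
  then have "0 < \<alpha> j\<^sub>0"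
    using j0(2) by linarith
  then have j0': "j\<^sub>0 \<in> J'"
    using j0 by (simp add: J'_def)
  have "\<alpha> j\<^sub>0 \<le> \<beta> (x j\<^sub>0)"
    unfolding \<beta>_def by (rule member_le_sum) (use j0' J' in \<open>auto intro: less_imp_le\<close>)
  moreover have "1 - 1 / (real (card S) + 1) \<le> 1 - 1 / (real (card J) + 1)"
    using cardS by (intro diff_mono divide_left_mono) auto
  ultimately have big: "x j\<^sub>0 \<in> S" "1 - 1 / (real (card S) + 1) \<le> \<beta> (x j\<^sub>0)"
    using j0(2) j0' by (auto simp: S_def)
  have pos: "\<forall>y\<in>S. 0 < \<beta> y"
  proof
    fix y assume "y \<in> S"
    then obtain j where "j \<in> J'" "x j = y"
      by (auto simp: S_def)
    then show "0 < \<beta> y"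
      unfolding \<beta>_def using J' by (intro sum_pos) auto
  qed
  have "sum \<beta> S = 1"
    using sum_eq [of "\<lambda>_. 1"] \<alpha>(2) by simp
  moreover have "comb X J \<alpha> x = (\<lambda>\<phi>\<in>cfun X. \<Sum>y\<in>S. \<beta> y * dirac X y \<phi>)"
    by (rule ext) (simp add: comb_def dirac_def sum_eq restrict_def)
  ultimately show ?thesis
    unfolding P_f_def using S pos big by blast
qed

lemma dirac_in_P_f: "x \<in> topspace X \<Longrightarrow> dirac X x \<in> P_f X"
  using comb_in_P_f [of "{()}" "\<lambda>_. x" X "\<lambda>_. 1" "()"]
  by (simp add: comb_def dirac_def restrict_def)


section \<open>The space \<open>P\<^sub>f\<close> is compact\<close>

text \<open>The combination depends continuously on the points and the weights, which range over a compact
  space.\<close>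

lemma compactin_comb_image:
  fixes n :: nat
  assumes "comp_obj X" and k: "k < n"
  shows "compactin (pw_topology X) {comb X {..<n} \<alpha> x |\<alpha> x.
    x \<in> (\<Pi>\<^sub>E j\<in>{..<n}. topspace X) \<and> \<alpha> \<in> (\<Pi>\<^sub>E j\<in>{..<n}. {0..1}) \<and> sum \<alpha> {..<n} = 1 \<and> c \<le> \<alpha> k}"
    (is "compactin _ ?R")
proof -
  define D where "D = prod_topology (product_topology (\<lambda>_. X) {..<n})
    (product_topology (\<lambda>_. top_of_set {0..1::real}) {..<n})"
  define C where "C = {p \<in> topspace D. sum (snd p) {..<n} = 1 \<and> c \<le> snd p k}"
  have topD: "topspace D = (\<Pi>\<^sub>E j\<in>{..<n}. topspace X) \<times> (\<Pi>\<^sub>E j\<in>{..<n}. {0..1})"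
    by (simp add: D_def)
  have "compact_space (top_of_set {0..1::real})"
    by (simp add: compact_space_subtopology)
  then have "compact_space D"
    using assms unfolding D_def comp_obj_def
    by (auto simp: compact_space_prod_topology compact_space_product_topology)
  have weight: "continuous_map D euclideanreal (\<lambda>p. snd p j)" if "j < n" for j
  proof -
    have "continuous_map D (top_of_set {0..1::real}) ((\<lambda>g. g j) \<circ> snd)"
      unfolding D_def using that
      by (intro continuous_map_compose [OF continuous_map_snd]) (auto intro: continuous_map_product_projection)
    then show ?thesis
      by (simp add: o_def continuous_map_in_subtopology)
  qed
  have point: "continuous_map D X (\<lambda>p. fst p j)" if "j < n" for j
  proof -
    have "continuous_map D X ((\<lambda>g. g j) \<circ> fst)"
      unfolding D_def using that
      by (intro continuous_map_compose [OF continuous_map_fst]) (auto intro: continuous_map_product_projection)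
    then show ?thesis
      by (simp add: o_def)
  qed
  have "closedin D C"
    unfolding C_def using weight [OF k] continuous_map_sum [of "{..<n}" D "\<lambda>p. snd p"] weight
    by (intro closedin_Collect_conj closedin_Collect_eq closedin_Collect_le) auto
  then have "compactin D C"
    using \<open>compact_space D\<close> closedin_compact_space by blast
  moreover have "continuous_map D (pw_topology X) (\<lambda>p. comb X {..<n} (snd p) (fst p))"
    unfolding continuous_map_componentwise
  proof (intro conjI ballI)
    fix \<phi> assume \<phi>: "\<phi> \<in> cfun X"
    have "continuous_map D euclideanreal (\<lambda>p. \<phi> (fst p j))" if "j < n" for j
      using continuous_map_compose [OF point [OF that] cfunD [OF \<phi>]] by (simp add: o_def)
    then have "continuous_map D euclideanreal (\<lambda>p. \<Sum>j<n. snd p j * \<phi> (fst p j))"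
      by (intro continuous_map_sum continuous_map_real_mult weight) auto
    then show "continuous_map D euclideanreal (\<lambda>p. comb X {..<n} (snd p) (fst p) \<phi>)"
      by (simp add: comb_apply [OF \<phi>])
  qed auto
  ultimately have "compactin (pw_topology X) ((\<lambda>p. comb X {..<n} (snd p) (fst p)) ` C)"
    by (rule image_compactin)
  also have "(\<lambda>p. comb X {..<n} (snd p) (fst p)) ` C =
      {comb X {..<n} \<alpha> x |\<alpha> x. (x, \<alpha>) \<in> C}"
    by (force simp del: PiE_iff)
  also have "\<dots> = ?R"
    unfolding C_def topD mem_Collect_eq mem_Times_iff fst_conv snd_conv conj_assoc ..
  finally show ?thesis .
qed

text \<open>The elements of \<open>P_f X\<close> carried by at most \<open>n\<close> points: the points \<open>x j\<close> may coincide and the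
  weights \<open>\<alpha> j\<close> may vanish, which makes the parameter space closed. The index \<open>k\<close> of the large weight
  stays fixed along a limit; taking the union over \<open>k\<close> avoids renumbering.\<close>

definition P_f_card :: "'a topology \<Rightarrow> nat \<Rightarrow> (('a \<Rightarrow> real) \<Rightarrow> real) set" where
  "P_f_card X n = (\<Union>k<n. {comb X {..<n} \<alpha> x |\<alpha> x.
    x \<in> (\<Pi>\<^sub>E j\<in>{..<n}. topspace X) \<and> \<alpha> \<in> (\<Pi>\<^sub>E j\<in>{..<n}. {0..1}) \<and> sum \<alpha> {..<n} = 1 \<and>
    1 - 1 / (real n + 1) \<le> \<alpha> k})"

lemma closedin_P_f_card:
  assumes "comp_obj X"
  shows "closedin (pw_topology X) (P_f_card X n)"
  unfolding P_f_card_def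
proof (rule closedin_Union)
  fix S
  assume "S \<in> (\<lambda>k. {comb X {..<n} \<alpha> x |\<alpha> x.
    x \<in> (\<Pi>\<^sub>E j\<in>{..<n}. topspace X) \<and> \<alpha> \<in> (\<Pi>\<^sub>E j\<in>{..<n}. {0..1}) \<and> sum \<alpha> {..<n} = 1 \<and>
    1 - 1 / (real n + 1) \<le> \<alpha> k}) ` {..<n}"
  then show "closedin (pw_topology X) S"
    using compactin_imp_closedin [OF Hausdorff_pw compactin_comb_image [OF assms]] by blast
qed simp

lemma P_f_eq_UN: "P_f X = (\<Union>n. P_f_card X n)"
proof (intro equalityI subsetI)
  fix \<mu> assume "\<mu> \<in> P_f X"
  then obtain S \<alpha> x\<^sub>0 where S: "finite S" "S \<subseteq> topspace X" "\<forall>x\<in>S. 0 < \<alpha> x" "sum \<alpha> S = 1"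
    "x\<^sub>0 \<in> S" "1 - 1 / (real (card S) + 1) \<le> \<alpha> x\<^sub>0" and \<mu>: "\<mu> = comb X S \<alpha> (\<lambda>x. x)"
    by (rule P_f_obtain)
  define n where "n = card S"
  obtain h where h: "bij_betw h {..<n} S"
    using ex_bij_betw_nat_finite [OF S(1)] by (auto simp: n_def lessThan_atLeast0)
  define x where "x = restrict h {..<n}"
  define \<beta> where "\<beta> = restrict (\<alpha> \<circ> h) {..<n}"
  have sum_eq: "(\<Sum>j<n. \<beta> j * g (x j)) = (\<Sum>y\<in>S. \<alpha> y * g y)" for g
    using sum.reindex_bij_betw [OF h, of "\<lambda>y. \<alpha> y * g y"] by (simp add: x_def \<beta>_def)
  have hS: "h j \<in> S" if "j < n" for j
    using h that by (auto simp: bij_betw_def)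
  have "x \<in> (\<Pi>\<^sub>E j\<in>{..<n}. topspace X)"
    using hS S(2) by (auto simp: x_def)
  moreover have "\<beta> \<in> (\<Pi>\<^sub>E j\<in>{..<n}. {0..1})"
    using hS S(1,3,4) member_le_sum [of _ S \<alpha>] by (auto simp: \<beta>_def less_imp_le)
  moreover have "sum \<beta> {..<n} = 1"
    using sum_eq [of "\<lambda>_. 1"] S(4) by simp
  moreover obtain k where "k < n" "h k = x\<^sub>0"
    using h S(5) by (auto simp: bij_betw_def)
  moreover have "\<mu> = comb X {..<n} \<beta> x"
    unfolding \<mu> comb_def sum_eq ..
  moreover from calculation have "1 - 1 / (real n + 1) \<le> \<beta> k"
    using S(6) by (simp add: n_def \<beta>_def)
  ultimately have "\<mu> \<in> P_f_card X n"
    unfolding P_f_card_def by blast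
  then show "\<mu> \<in> (\<Union>n. P_f_card X n)"
    by blast
next
  fix \<mu> assume "\<mu> \<in> (\<Union>n. P_f_card X n)"
  then obtain n k \<alpha> x where k: "k < n" and x: "x \<in> (\<Pi>\<^sub>E j\<in>{..<n}. topspace X)"
    and \<alpha>: "\<alpha> \<in> (\<Pi>\<^sub>E j\<in>{..<n}. {0..1})" "sum \<alpha> {..<n} = 1" "1 - 1 / (real n + 1) \<le> \<alpha> k"
    and \<mu>: "\<mu> = comb X {..<n} \<alpha> x"
    unfolding P_f_card_def by blast
  show "\<mu> \<in> P_f X"
    unfolding \<mu> using k x \<alpha> by (rule_tac comb_in_P_f [where j\<^sub>0 = k]) (auto simp: PiE_iff)
qed

text \<open>With \<open>n\<close> growing, this inequality forces a limit to dominate point evaluation at a limit of the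
  points \<open>y\<close>.\<close>

lemma P_f_card_dominates:
  assumes "\<mu> \<in> P_f_card X n"
  obtains y where "y \<in> topspace X"
    "\<And>\<phi>. \<phi> \<in> cfun X \<Longrightarrow> (\<And>x. x \<in> topspace X \<Longrightarrow> 0 \<le> \<phi> x) \<Longrightarrow> (1 - 1 / (real n + 1)) * \<phi> y \<le> \<mu> \<phi>"
proof -
  obtain k \<alpha> x where k: "k < n" and x: "x \<in> (\<Pi>\<^sub>E j\<in>{..<n}. topspace X)"
    and \<alpha>: "\<alpha> \<in> (\<Pi>\<^sub>E j\<in>{..<n}. {0..1})" "1 - 1 / (real n + 1) \<le> \<alpha> k"
    and \<mu>: "\<mu> = comb X {..<n} \<alpha> x"
    using assms unfolding P_f_card_def by blast
  show thesis
  proof (rule that [of "x k"])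
    show "x k \<in> topspace X"
      using x k by auto
    fix \<phi> assume \<phi>: "\<phi> \<in> cfun X" "\<And>x. x \<in> topspace X \<Longrightarrow> 0 \<le> \<phi> x"
    have "(1 - 1 / (real n + 1)) * \<phi> (x k) \<le> \<alpha> k * \<phi> (x k)"
      using \<alpha>(2) \<phi>(2) x k by (intro mult_right_mono) auto
    also have "\<dots> \<le> (\<Sum>j<n. \<alpha> j * \<phi> (x j))"
      using k x \<alpha>(1) \<phi>(2) by (intro member_le_sum) (auto simp: PiE_iff)
    finally show "(1 - 1 / (real n + 1)) * \<phi> (x k) \<le> \<mu> \<phi>"
      by (simp add: \<mu> comb_apply [OF \<phi>(1)])
  qed
qed

lemma P_set_eq_dirac:
  assumes "comp_obj X" "F \<in> P_set X" "x \<in> topspace X"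
    and dom: "\<And>\<phi>. \<phi> \<in> cfun X \<Longrightarrow> (\<And>y. y \<in> topspace X \<Longrightarrow> 0 \<le> \<phi> y) \<Longrightarrow> \<phi> x \<le> F \<phi>"
  shows "F = dirac X x"
proof -
  have le: "\<phi> x \<le> F \<phi>" if \<phi>: "\<phi> \<in> cfun X" for \<phi>
  proof -
    obtain M where M: "\<And>y. y \<in> topspace X \<Longrightarrow> \<bar>\<phi> y\<bar> \<le> M"
      using cfun_bounded assms(1) \<phi> by blast
    have "(\<lambda>y\<in>topspace X. \<phi> y + M) x \<le> F (\<lambda>y\<in>topspace X. \<phi> y + M)"
      using M by (intro dom cfun_add_const \<phi>) (force simp: abs_le_iff)
    then show ?thesis
      using assms(3) by (simp add: P_add_const [OF assms(2) \<phi>])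
  qed
  have "F \<phi> = \<phi> x" if "\<phi> \<in> cfun X" for \<phi>
    using le [OF that] le [OF cfun_scale [OF that, of "-1"]] assms(3)
    unfolding P_scale [OF assms(2) that] by simp
  then show ?thesis
    using P_set_ext [OF assms(2)] by (auto simp: dirac_def extensional_def)
qed

text \<open>A point of the closure that is not in any of the closed sets \<open>P_f_card X n\<close> is a limit of measures
  with arbitrarily many atoms. Their dominating atoms have weights tending to \<open>1\<close>, and compactness of
  \<open>X\<close> gives a point \<open>x\<close> such that the limit dominates, and therefore is, the evaluation at \<open>x\<close>.\<close>

lemma closedin_P_f:
  assumes X: "comp_obj X"
  shows "closedin (pw_topology X) (P_f X)"
proof -
  have "F \<in> P_f X" if F: "F \<in> pw_topology X closure_of P_f X" for F
  proof (rule ccontr)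
    assume nF: "F \<notin> P_f X"
    have FP: "F \<in> P_set X"
      using F closure_of_minimal [OF P_f_sub_P_set closedin_P_set] by blast
    have near: "\<exists>n\<ge>N. \<exists>\<mu>\<in>P_f_card X n. \<mu> \<in> U"
      if U: "openin (pw_topology X) U" "F \<in> U" for U N
    proof -
      let ?E = "\<Union>n<N. P_f_card X n"
      have "closedin (pw_topology X) ?E"
        using closedin_P_f_card [OF X] by (intro closedin_Union) auto
      then have "openin (pw_topology X) (U - ?E)"
        using U(1) by (rule openin_diff [rotated])
      moreover have "F \<in> U - ?E"
        using nF U(2) by (auto simp: P_f_eq_UN)
      ultimately obtain \<mu> where "\<mu> \<in> P_f X" "\<mu> \<in> U - ?E"
        using F unfolding in_closure_of by blast
      then show ?thesis
        by (force simp: P_f_eq_UN not_less)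
    qed
    \<comment> \<open>The inequalities asked of \<open>x\<close>, relaxed by \<open>\<epsilon>\<close> so that each finite set of them concerns
      only an open neighbourhood of \<open>F\<close>.\<close>
    define I where "I = (UNIV :: nat set) \<times> {\<phi> \<in> cfun X. \<forall>y\<in>topspace X. 0 \<le> \<phi> y} \<times> {0 :: real<..}"
    have "\<exists>x\<in>topspace X. \<forall>i\<in>I. (1 - 1 / (real (fst i) + 1)) * fst (snd i) x \<le> F (fst (snd i)) + snd (snd i)"
    proof (rule compactin_common_point)
      show "compactin X (topspace X)"
        using X by (simp add: comp_obj_def compact_space_def)
    next
      fix i assume "i \<in> I"
      then show "closedin X {x \<in> topspace X.
          (1 - 1 / (real (fst i) + 1)) * fst (snd i) x \<le> F (fst (snd i)) + snd (snd i)}"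
        by (intro closedin_Collect_le continuous_map_real_mult_left) (auto simp: I_def cfunD)
    next
      fix J assume J: "finite J" "J \<subseteq> I"
      define N where "N = Max (insert 0 (fst ` J))"
      define U where "U = {G \<in> topspace (pw_topology X).
        \<forall>i\<in>J. G (fst (snd i)) < F (fst (snd i)) + snd (snd i)}"
      have "openin (pw_topology X) U"
        unfolding U_def
      proof (rule openin_Collect_finite_ball [OF J(1)])
        fix i assume "i \<in> J"
        then show "openin (pw_topology X) {G \<in> topspace (pw_topology X).
            G (fst (snd i)) < F (fst (snd i)) + snd (snd i)}"
          using J(2) by (intro openin_Collect_less continuous_map_eval) (auto simp: I_def)
      qed
      moreover have "F \<in> U"
        using J(2) P_set_ext [OF FP] unfolding U_def topspace_pw by (auto simp: I_def)
      ultimately obtain n \<mu> where n: "N \<le> n" and \<mu>: "\<mu> \<in> P_f_card X n" "\<mu> \<in> U"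
        using near by blast
      obtain y where y: "y \<in> topspace X"
        and dom: "\<And>\<phi>. \<phi> \<in> cfun X \<Longrightarrow> (\<And>x. x \<in> topspace X \<Longrightarrow> 0 \<le> \<phi> x) \<Longrightarrow>
          (1 - 1 / (real n + 1)) * \<phi> y \<le> \<mu> \<phi>"
        using P_f_card_dominates [OF \<mu>(1)] by blast
      show "\<exists>x\<in>topspace X. \<forall>i\<in>J.
          (1 - 1 / (real (fst i) + 1)) * fst (snd i) x \<le> F (fst (snd i)) + snd (snd i)"
      proof (intro bexI [OF _ y] ballI)
        fix i assume i: "i \<in> J"
        obtain m \<phi> \<epsilon> where i_eq: "i = (m, \<phi>, \<epsilon>)"
          by (cases i) auto
        have \<phi>: "\<phi> \<in> cfun X" "\<And>x. x \<in> topspace X \<Longrightarrow> 0 \<le> \<phi> x"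
          using i J(2) by (auto simp: I_def i_eq)
        have "m \<le> N"
          unfolding N_def using J(1) i by (intro Max_ge) (force simp: i_eq)+
        then have "1 - 1 / (real m + 1) \<le> 1 - 1 / (real n + 1)"
          using n by (intro diff_mono divide_left_mono) auto
        then have "(1 - 1 / (real m + 1)) * \<phi> y \<le> (1 - 1 / (real n + 1)) * \<phi> y"
          using \<phi>(2) [OF y] by (rule mult_right_mono)
        also have "\<dots> \<le> \<mu> \<phi>"
          by (rule dom [OF \<phi>])
        also have "\<dots> \<le> F \<phi> + \<epsilon>"
          using \<mu>(2) i by (auto simp: U_def i_eq intro: less_imp_le)
        finally show "(1 - 1 / (real (fst i) + 1)) * fst (snd i) y \<le> F (fst (snd i)) + snd (snd i)"
          by (simp add: i_eq)
      qed
    qed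
    then obtain x where x: "x \<in> topspace X" and
      le: "\<And>n \<phi> \<epsilon>. (n, \<phi>, \<epsilon>) \<in> I \<Longrightarrow> (1 - 1 / (real n + 1)) * \<phi> x \<le> F \<phi> + \<epsilon>"
      by force
    have "\<phi> x \<le> F \<phi>" if \<phi>: "\<phi> \<in> cfun X" "\<And>y. y \<in> topspace X \<Longrightarrow> 0 \<le> \<phi> y" for \<phi>
    proof (rule field_le_epsilon)
      fix e :: real assume e: "0 < e"
      obtain n where "\<phi> x / (e / 2) < real n"
        using reals_Archimedean2 by blast
      then have "\<phi> x / (real n + 1) \<le> e / 2"
        using e by (simp add: field_simps)
      moreover have "(1 - 1 / (real n + 1)) * \<phi> x \<le> F \<phi> + e / 2"
        using e \<phi> by (intro le) (simp add: I_def)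
      moreover have "(1 - 1 / (real n + 1)) * \<phi> x = \<phi> x - \<phi> x / (real n + 1)"
        by (simp add: algebra_simps)
      ultimately show "\<phi> x \<le> F \<phi> + e"
        by linarith
    qed
    then have "F = dirac X x"
      by (rule P_set_eq_dirac [OF X FP x])
    with dirac_in_P_f [OF x] nF show False
      by simp
  qed
  moreover have "P_f X \<subseteq> topspace (pw_topology X)"
    using P_f_sub_P_set closedin_subset [OF closedin_P_set] by blast
  ultimately show ?thesis
    using closure_of_subset_eq [of "P_f X" "pw_topology X"] by blast
qed

lemma compactin_P_f: "comp_obj X \<Longrightarrow> compactin (pw_topology X) (P_f X)"
  using closed_compactin [OF compactin_P_set P_f_sub_P_set closedin_P_f] .



section \<open>Extreme points of compact convex sets of probability functionals\<close>

lemma mix_apply: "\<phi> \<in> cfun X \<Longrightarrow> mix X t \<mu> \<nu> \<phi> = (1 - t) * \<mu> \<phi> + t * \<nu> \<phi>"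
  by (simp add: mix_def)

lemma mix_ext [simp]: "mix X t \<mu> \<nu> \<in> extensional (cfun X)"
  by (simp add: mix_def)

lemma functional_eqI:
  "F \<in> extensional (cfun X) \<Longrightarrow> G \<in> extensional (cfun X) \<Longrightarrow>
    (\<And>\<phi>. \<phi> \<in> cfun X \<Longrightarrow> F \<phi> = G \<phi>) \<Longrightarrow> F = G"
  by (rule extensionalityI)

lemma mix_in_P_set:
  assumes "\<mu> \<in> P_set X" "\<nu> \<in> P_set X" "t \<in> {0..1}"
  shows "mix X t \<mu> \<nu> \<in> P_set X"
proof -
  have "0 \<le> (1 - t) * \<mu> \<phi> + t * \<nu> \<phi>"
    if "\<phi> \<in> cfun X" "\<forall>x\<in>topspace X. 0 \<le> \<phi> x" for \<phi>
    using P_nonneg [OF assms(1) that(1)] P_nonneg [OF assms(2) that(1)] that(2) assms(3) by simp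
  then show ?thesis
    unfolding P_set_def
    by (simp add: mix_apply P_add [OF assms(1)] P_add [OF assms(2)] P_scale [OF assms(1)]
        P_scale [OF assms(2)] P_const [OF assms(1)] P_const [OF assms(2)] algebra_simps)
qed

lemma mix_0: "\<mu> \<in> extensional (cfun X) \<Longrightarrow> mix X 0 \<mu> \<nu> = \<mu>"
  by (rule functional_eqI) (auto simp: mix_apply)

lemma mix_1: "\<nu> \<in> extensional (cfun X) \<Longrightarrow> mix X 1 \<mu> \<nu> = \<nu>"
  by (rule functional_eqI) (auto simp: mix_apply)

lemma mix_same: "\<mu> \<in> extensional (cfun X) \<Longrightarrow> mix X t \<mu> \<mu> = \<mu>"
  by (rule functional_eqI) (auto simp: mix_apply algebra_simps)

definition mix_convex :: "'a topology \<Rightarrow> (('a \<Rightarrow> real) \<Rightarrow> real) set \<Rightarrow> bool" where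
  "mix_convex X A \<longleftrightarrow> (\<forall>\<mu>\<in>A. \<forall>\<nu>\<in>A. \<forall>t\<in>{0..1}. mix X t \<mu> \<nu> \<in> A)"

lemma mix_convexD: "mix_convex X A \<Longrightarrow> \<mu> \<in> A \<Longrightarrow> \<nu> \<in> A \<Longrightarrow> t \<in> {0..1} \<Longrightarrow> mix X t \<mu> \<nu> \<in> A"
  by (simp add: mix_convex_def)

lemma cc_P_iff:
  "A \<in> cc_P X \<longleftrightarrow> A \<noteq> {} \<and> A \<subseteq> P_set X \<and> closedin (pw_topology X) A \<and> mix_convex X A"
  by (auto simp: cc_P_def closedin_P_iff mix_convex_def)

lemma compactin_cc_P: "comp_obj X \<Longrightarrow> A \<in> cc_P X \<Longrightarrow> compactin (pw_topology X) A"
  using closed_compactin [OF compactin_P_set] by (auto simp: cc_P_iff)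

text \<open>The point of a one-point face is extreme, so extreme points are found by shrinking faces.\<close>

definition face :: "'a topology \<Rightarrow> (('a \<Rightarrow> real) \<Rightarrow> real) set \<Rightarrow> (('a \<Rightarrow> real) \<Rightarrow> real) set \<Rightarrow> bool" where
  "face X A E \<longleftrightarrow> E \<noteq> {} \<and> E \<subseteq> A \<and> closedin (pw_topology X) E \<and>
     (\<forall>a\<in>A. \<forall>b\<in>A. \<forall>t\<in>{0<..<1}. mix X t a b \<in> E \<longrightarrow> a \<in> E \<and> b \<in> E)"

lemma face_argmax:
  assumes A: "compactin (pw_topology X) A" and E: "face X A E" and \<psi>: "\<psi> \<in> cfun X"
  shows "face X A {\<nu>\<in>E. \<forall>\<kappa>\<in>E. \<kappa> \<psi> \<le> \<nu> \<psi>}"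
proof -
  have cE: "closedin (pw_topology X) E" and sub: "E \<subseteq> A" and ne: "E \<noteq> {}"
    using E by (auto simp: face_def)
  obtain m where m: "m \<in> E" "\<And>\<kappa>. \<kappa> \<in> E \<Longrightarrow> \<kappa> \<psi> \<le> m \<psi>"
    using compactin_attains_max [OF closed_compactin [OF A sub cE] ne continuous_map_eval [OF \<psi>]]
    by blast
  have eq: "{\<nu>\<in>E. \<forall>\<kappa>\<in>E. \<kappa> \<psi> \<le> \<nu> \<psi>} = E \<inter> {\<nu> \<in> topspace (pw_topology X). m \<psi> \<le> \<nu> \<psi>}"
    using m closedin_subset [OF cE] by (auto intro: order_trans)
  have "closedin (pw_topology X) {\<nu> \<in> topspace (pw_topology X). m \<psi> \<le> \<nu> \<psi>}"
    by (intro closedin_Collect_le continuous_map_eval [OF \<psi>]) simp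
  then have "closedin (pw_topology X) {\<nu>\<in>E. \<forall>\<kappa>\<in>E. \<kappa> \<psi> \<le> \<nu> \<psi>}"
    unfolding eq using cE by (rule closedin_Int [rotated])
  moreover have "a \<psi> = m \<psi> \<and> b \<psi> = m \<psi>"
    if ab: "a \<in> E" "b \<in> E" "t \<in> {0<..<1}" "\<forall>\<kappa>\<in>E. \<kappa> \<psi> \<le> mix X t a b \<psi>" for a b t
  proof -
    have le: "a \<psi> \<le> m \<psi>" "b \<psi> \<le> m \<psi>"
      using m ab by auto
    have "m \<psi> \<le> (1 - t) * a \<psi> + t * b \<psi>"
      using ab(4) m(1) by (auto simp: mix_apply [OF \<psi>])
    then have "(1 - t) * (m \<psi> - a \<psi>) + t * (m \<psi> - b \<psi>) \<le> 0"
      by (simp add: algebra_simps)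
    moreover have "0 \<le> (1 - t) * (m \<psi> - a \<psi>)" "0 \<le> t * (m \<psi> - b \<psi>)"
      using le ab(3) by auto
    ultimately have "(1 - t) * (m \<psi> - a \<psi>) = 0" "t * (m \<psi> - b \<psi>) = 0"
      by linarith+
    with ab(3) show ?thesis
      by simp
  qed
  moreover have "a \<in> {\<nu>\<in>E. \<forall>\<kappa>\<in>E. \<kappa> \<psi> \<le> \<nu> \<psi>} \<and> b \<in> {\<nu>\<in>E. \<forall>\<kappa>\<in>E. \<kappa> \<psi> \<le> \<nu> \<psi>}"
    if ab: "a \<in> A" "b \<in> A" "t \<in> {0<..<1}" "mix X t a b \<in> {\<nu>\<in>E. \<forall>\<kappa>\<in>E. \<kappa> \<psi> \<le> \<nu> \<psi>}" for a b t
  proof -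
    have "a \<in> E" "b \<in> E"
      using E ab unfolding face_def by blast+
    then show ?thesis
      using calculation(2) [of a b t] ab(3,4) m by simp
  qed
  ultimately show ?thesis
    using m sub unfolding face_def by blast
qed

lemma face_Inter_chain:
  assumes A: "compactin (pw_topology X) A" and ne: "\<E> \<noteq> {}"
    and faces: "\<And>E. E \<in> \<E> \<Longrightarrow> face X A E"
    and chain: "\<And>E E'. E \<in> \<E> \<Longrightarrow> E' \<in> \<E> \<Longrightarrow> E \<subseteq> E' \<or> E' \<subseteq> E"
  shows "face X A (\<Inter>\<E>)"
proof -
  have closed: "closedin (pw_topology X) E" and sub: "E \<subseteq> A" and nonempty: "E \<noteq> {}"
    if "E \<in> \<E>" for E
    using faces [OF that] by (auto simp: face_def)
  have "\<exists>x\<in>A. \<forall>E\<in>\<E>. x \<in> E"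
  proof (rule compactin_common_point [OF A])
    fix E assume "E \<in> \<E>"
    then have "{x \<in> topspace (pw_topology X). x \<in> E} = E"
      using closedin_subset [OF closed] by blast
    then show "closedin (pw_topology X) {x \<in> topspace (pw_topology X). x \<in> E}"
      using closed [OF \<open>E \<in> \<E>\<close>] by simp
  next
    fix J assume J: "finite J" "J \<subseteq> \<E>"
    then have "\<exists>E\<in>\<E>. \<forall>E'\<in>J. E \<subseteq> E'"
    proof (induction J)
      case empty
      then show ?case using ne by auto
    next
      case (insert E' J)
      then obtain E where "E \<in> \<E>" "\<forall>E'\<in>J. E \<subseteq> E'" by auto
      with chain [of E E'] insert.prems show ?case
        by (metis insert_iff insert_subset order_trans order_refl)
    qed
    then obtain E where E: "E \<in> \<E>" "\<forall>E'\<in>J. E \<subseteq> E'"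
      by blast
    obtain x where "x \<in> E"
      using nonempty [OF E(1)] by blast
    with E sub [OF E(1)] show "\<exists>x\<in>A. \<forall>E\<in>J. x \<in> E"
      by blast
  qed
  then have "\<Inter>\<E> \<noteq> {}"
    by blast
  moreover have "closedin (pw_topology X) (\<Inter>\<E>)"
    using ne closed by (rule closedin_Inter)
  moreover have "\<Inter>\<E> \<subseteq> A"
    using ne sub by blast
  moreover have "a \<in> E \<and> b \<in> E"
    if "a \<in> A" "b \<in> A" "t \<in> {0<..<1}" "mix X t a b \<in> \<Inter>\<E>" "E \<in> \<E>" for a b t E
    using faces [OF that(5)] that unfolding face_def by blast
  ultimately show ?thesis
    unfolding face_def by blast
qed

text \<open>Zorn's lemma gives a minimal closed face. By \<open>face_argmax\<close> every \<open>\<psi>\<close> is constant on it, so it is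
  a single point, and this point is extreme.\<close>

lemma face_contains_extreme_point:
  assumes A: "compactin (pw_topology X) A" and E0: "face X A E\<^sub>0"
  obtains \<mu> where "\<mu> \<in> E\<^sub>0" "\<mu> \<in> ext_points X A"
proof -
  \<comment> \<open>Complements of faces, since Zorn's lemma for inclusion provides maximal sets.\<close>
  define \<A> where "\<A> = {A - E |E. face X A E \<and> E \<subseteq> E\<^sub>0}"
  have "\<exists>M\<in>\<A>. \<forall>C\<in>\<A>. M \<subseteq> C \<longrightarrow> C = M"
  proof (rule subset_Zorn_nonempty)
    show "\<A> \<noteq> {}"
      using E0 by (auto simp: \<A>_def)
    fix \<C> assume \<C>: "\<C> \<noteq> {}" "subset.chain \<A> \<C>"
    define \<E> where "\<E> = (\<lambda>C. A - C) ` \<C>"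
    have \<C>_sub: "\<C> \<subseteq> \<A>" and \<C>_chain: "\<And>C D. C \<in> \<C> \<Longrightarrow> D \<in> \<C> \<Longrightarrow> C \<subseteq> D \<or> D \<subseteq> C"
      using \<C>(2) by (auto simp: subset_chain_def)
    have el: "face X A (A - C)" "A - C \<subseteq> E\<^sub>0" "A - (A - C) = C" if C: "C \<in> \<C>" for C
    proof -
      obtain E where E: "C = A - E" "face X A E" "E \<subseteq> E\<^sub>0"
        using \<C>_sub C by (auto simp: \<A>_def)
      then have "A - C = E"
        by (auto simp: face_def)
      with E show "face X A (A - C)" "A - C \<subseteq> E\<^sub>0" "A - (A - C) = C"
        by auto
    qed
    have "face X A (\<Inter>\<E>)"
    proof (rule face_Inter_chain [OF A])
      show "\<E> \<noteq> {}" using \<C>(1) by (simp add: \<E>_def)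
      show "face X A E" if "E \<in> \<E>" for E
        using that el by (auto simp: \<E>_def)
      show "E \<subseteq> E' \<or> E' \<subseteq> E" if EE: "E \<in> \<E>" "E' \<in> \<E>" for E E'
      proof -
        obtain C C' where "C \<in> \<C>" "C' \<in> \<C>" "E = A - C" "E' = A - C'"
          using EE by (auto simp: \<E>_def)
        with \<C>_chain [of C C'] show ?thesis
          by blast
      qed
    qed
    moreover have "\<Inter>\<E> \<subseteq> E\<^sub>0"
      using \<C>(1) el(2) by (auto simp: \<E>_def)
    moreover have "\<Union>\<C> = A - \<Inter>\<E>"
      using \<C>(1) el(3) by (auto simp: \<E>_def)
    ultimately show "\<Union>\<C> \<in> \<A>"
      unfolding \<A>_def by blast
  qed
  then obtain M where M: "M \<in> \<A>" "\<And>C. C \<in> \<A> \<Longrightarrow> M \<subseteq> C \<Longrightarrow> C = M"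
    by blast
  then obtain E where E: "face X A E" "E \<subseteq> E\<^sub>0" and ME: "M = A - E"
    by (auto simp: \<A>_def)
  have minimal: "E' = E" if E': "face X A E'" "E' \<subseteq> E" for E'
  proof -
    have "A - E' \<in> \<A>"
      using E' E(2) by (auto simp: \<A>_def)
    then have "A - E' = A - E"
      using M(2) [of "A - E'"] E'(2) unfolding ME by blast
    moreover have "E \<subseteq> A" "E' \<subseteq> A"
      using E E' by (auto simp: face_def)
    ultimately show ?thesis
      by blast
  qed
  have sub: "E \<subseteq> A" "E \<subseteq> extensional (cfun X)"
    using E closedin_subset [of "pw_topology X" E] unfolding topspace_pw by (auto simp: face_def)
  have const: "\<mu> \<psi> = \<nu> \<psi>" if "\<mu> \<in> E" "\<nu> \<in> E" "\<psi> \<in> cfun X" for \<mu> \<nu> \<psi>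
  proof -
    have "{\<nu>\<in>E. \<forall>\<kappa>\<in>E. \<kappa> \<psi> \<le> \<nu> \<psi>} = E"
      using face_argmax [OF A E(1) that(3)] by (rule minimal) auto
    then have "\<mu> \<psi> \<le> \<nu> \<psi>" "\<nu> \<psi> \<le> \<mu> \<psi>"
      using that by blast+
    then show ?thesis
      by simp
  qed
  have single: "\<mu> = \<nu>" if "\<mu> \<in> E" "\<nu> \<in> E" for \<mu> \<nu>
    using that sub(2) const by (intro functional_eqI [of \<mu> X \<nu>]) auto
  obtain \<mu> where \<mu>: "\<mu> \<in> E"
    using E by (auto simp: face_def)
  have "\<mu> \<noteq> mix X t a b" if "a \<in> A" "b \<in> A" "a \<noteq> b" "t \<in> {0<..<1}" for a b t
    using E(1) \<mu> single that unfolding face_def by metis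
  then have "\<mu> \<in> ext_points X A"
    using \<mu> sub(1) by (auto simp: ext_points_def)
  with \<mu> E(2) that show thesis
    by blast
qed

lemma ext_point_attains_max:
  assumes X: "comp_obj X" and A: "A \<in> cc_P X" and \<phi>: "\<phi> \<in> cfun X"
  obtains \<mu> where "\<mu> \<in> ext_points X A" "\<And>\<nu>. \<nu> \<in> A \<Longrightarrow> \<nu> \<phi> \<le> \<mu> \<phi>"
proof -
  have cA: "compactin (pw_topology X) A"
    by (rule compactin_cc_P [OF X A])
  have "face X A A"
    using A by (auto simp: face_def cc_P_iff)
  from face_argmax [OF cA this \<phi>] obtain \<mu>
    where "\<mu> \<in> {\<nu>\<in>A. \<forall>\<kappa>\<in>A. \<kappa> \<phi> \<le> \<nu> \<phi>}" "\<mu> \<in> ext_points X A"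
    using face_contains_extreme_point [OF cA] by blast
  with that show thesis
    by blast
qed


section \<open>Extreme points of a closed convex hull\<close>

definition mix_join ::
    "'a topology \<Rightarrow> (('a \<Rightarrow> real) \<Rightarrow> real) set \<Rightarrow> (('a \<Rightarrow> real) \<Rightarrow> real) set \<Rightarrow> (('a \<Rightarrow> real) \<Rightarrow> real) set" where
  "mix_join X C D = {mix X t u v |t u v. t \<in> {0..1} \<and> u \<in> C \<and> v \<in> D}"

lemma compactin_mix_join:
  assumes "compactin (pw_topology X) C" "compactin (pw_topology X) D"
  shows "compactin (pw_topology X) (mix_join X C D)"
proof -
  define T where "T = prod_topology euclideanreal (prod_topology (pw_topology X) (pw_topology X))"
  have "compactin T ({0..1} \<times> C \<times> D)"
    unfolding T_def using assms by (simp add: compactin_Times)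
  moreover have "continuous_map T (pw_topology X) (\<lambda>(t, u, v). mix X t u v)"
    unfolding continuous_map_componentwise
  proof (intro conjI ballI)
    fix \<phi> assume \<phi>: "\<phi> \<in> cfun X"
    have t: "continuous_map T euclideanreal fst"
      unfolding T_def by (rule continuous_map_fst)
    have "continuous_map T (pw_topology X) (fst \<circ> snd)" "continuous_map T (pw_topology X) (snd \<circ> snd)"
      unfolding T_def by (meson continuous_map_compose continuous_map_fst continuous_map_snd)+
    from this [THEN continuous_map_compose, OF continuous_map_eval [OF \<phi>]]
    have "continuous_map T euclideanreal (\<lambda>p. (1 - fst p) * fst (snd p) \<phi> + fst p * snd (snd p) \<phi>)"
      using t by (intro continuous_map_add continuous_map_real_mult continuous_map_diff) (auto simp: o_def)
    then show "continuous_map T euclideanreal (\<lambda>x. (case x of (t, u, v) \<Rightarrow> mix X t u v) \<phi>)"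
      by (simp add: case_prod_beta mix_apply [OF \<phi>])
  qed (auto simp: case_prod_beta)
  ultimately have "compactin (pw_topology X) ((\<lambda>(t, u, v). mix X t u v) ` ({0..1} \<times> C \<times> D))"
    by (rule image_compactin)
  also have "(\<lambda>(t, u, v). mix X t u v) ` ({0..1} \<times> C \<times> D) = mix_join X C D"
    by (force simp: mix_join_def)
  finally show ?thesis .
qed

lemma weight_split:
  fixes x y :: real
  assumes "0 \<le> x" "0 \<le> y"
  shows "y / (x + y) \<in> {0..1}" "(x + y) * (y / (x + y)) = y" "(x + y) * (1 - y / (x + y)) = x"
  using assms by (auto simp: divide_le_eq_1 right_diff_distrib add_nonneg_eq_0_iff)

text \<open>A mixture of two points of the join is regrouped into a mixture of a point of \<open>C\<close> and a point
  of \<open>D\<close>.\<close>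

lemma mix_convex_join:
  assumes C: "mix_convex X C" and D: "mix_convex X D"
  shows "mix_convex X (mix_join X C D)"
  unfolding mix_convex_def
proof (intro ballI)
  fix \<mu> \<nu> and s :: real
  assume "\<mu> \<in> mix_join X C D" "\<nu> \<in> mix_join X C D" and s: "s \<in> {0..1}"
  then obtain t u v t' u' v' where t: "t \<in> {0..1}" "t' \<in> {0..1}"
    and u: "u \<in> C" "u' \<in> C" and v: "v \<in> D" "v' \<in> D"
    and \<mu>: "\<mu> = mix X t u v" and \<nu>: "\<nu> = mix X t' u' v'"
    by (auto simp: mix_join_def)
  define p where "p = (1 - s) * (1 - t) + s * (1 - t')"
  define q where "q = (1 - s) * t + s * t'"
  have nn: "0 \<le> (1 - s) * (1 - t)" "0 \<le> s * (1 - t')" "0 \<le> (1 - s) * t" "0 \<le> s * t'"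
    using s t by auto
  have pq: "p = 1 - q"
    by (simp add: p_def q_def algebra_simps)
  \<comment> \<open>If \<open>p\<close> or \<open>q\<close> vanishes, division by zero picks the first of the two points.\<close>
  define \<alpha> where "\<alpha> = s * (1 - t') / p"
  define \<beta> where "\<beta> = s * t' / q"
  have \<alpha>: "\<alpha> \<in> {0..1}" "p * \<alpha> = s * (1 - t')" "p * (1 - \<alpha>) = (1 - s) * (1 - t)"
    unfolding \<alpha>_def p_def using weight_split [OF nn(1,2)] by auto
  have \<beta>: "\<beta> \<in> {0..1}" "q * \<beta> = s * t'" "q * (1 - \<beta>) = (1 - s) * t"
    unfolding \<beta>_def q_def using weight_split [OF nn(3,4)] by auto
  have "mix X s \<mu> \<nu> = mix X q (mix X \<alpha> u u') (mix X \<beta> v v')"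
  proof (rule functional_eqI)
    fix \<phi> assume \<phi>: "\<phi> \<in> cfun X"
    have "mix X q (mix X \<alpha> u u') (mix X \<beta> v v') \<phi> =
        p * (1 - \<alpha>) * u \<phi> + p * \<alpha> * u' \<phi> + (q * (1 - \<beta>) * v \<phi> + q * \<beta> * v' \<phi>)"
      by (simp add: mix_apply [OF \<phi>] pq algebra_simps)
    also have "\<dots> = mix X s \<mu> \<nu> \<phi>"
      unfolding \<alpha> \<beta> by (simp add: \<mu> \<nu> mix_apply [OF \<phi>] algebra_simps)
    finally show "mix X s \<mu> \<nu> \<phi> = mix X q (mix X \<alpha> u u') (mix X \<beta> v v') \<phi>"
      by simp
  qed auto
  moreover have "q \<in> {0..1}"
    using nn pq by (auto simp: p_def q_def)
  moreover have "mix X \<alpha> u u' \<in> C" "mix X \<beta> v v' \<in> D"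
    using C D u v \<alpha>(1) \<beta>(1) by (auto intro: mix_convexD)
  ultimately show "mix X s \<mu> \<nu> \<in> mix_join X C D"
    unfolding mix_join_def by blast
qed

text \<open>An extreme point of \<open>A\<close> is not a proper mixture, so it can lie in the join only at an end.\<close>

lemma ext_points_notin_join:
  assumes a: "a \<in> ext_points X A" and sub: "C \<subseteq> A" "D \<subseteq> A" "A \<subseteq> extensional (cfun X)"
    and "a \<notin> C" "a \<notin> D"
  shows "a \<notin> mix_join X C D"
proof
  assume "a \<in> mix_join X C D"
  then obtain t u v where t: "t \<in> {0..1}" and uv: "u \<in> C" "v \<in> D" and eq: "a = mix X t u v"
    by (auto simp: mix_join_def)
  have ext: "u \<in> extensional (cfun X)" "v \<in> extensional (cfun X)"
    using uv sub by auto
  consider "t = 0" | "t = 1" | "u = v" | "t \<in> {0<..<1}" "u \<noteq> v"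
    using t by fastforce
  then show False
  proof cases
    case 4
    then show False
      using a uv sub(1,2) eq unfolding ext_points_def by blast
  qed (use assms uv eq ext in \<open>auto simp: mix_0 mix_1 mix_same\<close>)
qed

text \<open>The induction step of Milman's theorem: finitely many closed half-spaces that avoid the extreme
  point \<open>a\<close> cut closed convex pieces from \<open>A\<close>, and joining these one by one gives a closed convex set
  that contains all of them and still avoids \<open>a\<close>.\<close>

lemma hull_without_extreme_point:
  assumes X: "comp_obj X" and A: "A \<in> cc_P X" and a: "a \<in> ext_points X A"
    and J: "finite J" "\<And>\<phi> c. (\<phi>, c) \<in> J \<Longrightarrow> \<phi> \<in> cfun X \<and> a \<phi> < c"
  shows "\<exists>C. closedin (pw_topology X) C \<and> mix_convex X C \<and> C \<subseteq> A \<and> a \<notin> C \<and>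
    {\<nu> \<in> A. \<exists>(\<phi>, c)\<in>J. c < \<nu> \<phi>} \<subseteq> C"
  using J
proof (induction J)
  case empty
  then show ?case
    by (intro exI [of _ "{}"]) (auto simp: mix_convex_def)
next
  case (insert i J)
  obtain \<phi> c where i: "i = (\<phi>, c)"
    by (cases i)
  have \<phi>: "\<phi> \<in> cfun X" "a \<phi> < c"
    using insert.prems i by auto
  obtain C where C: "closedin (pw_topology X) C" "mix_convex X C" "C \<subseteq> A" "a \<notin> C"
    "{\<nu> \<in> A. \<exists>(\<phi>, c)\<in>J. c < \<nu> \<phi>} \<subseteq> C"
    using insert.IH insert.prems by (meson insertI2)
  have cA: "closedin (pw_topology X) A" "mix_convex X A" "A \<subseteq> P_set X"
    using A by (auto simp: cc_P_iff)
  define D where "D = {\<nu> \<in> A. c \<le> \<nu> \<phi>}"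
  have D: "D \<subseteq> A" "a \<notin> D"
    using \<phi> by (auto simp: D_def)
  have "closedin (pw_topology X) D"
  proof -
    have "closedin (pw_topology X) {\<nu> \<in> topspace (pw_topology X). c \<le> \<nu> \<phi>}"
      by (intro closedin_Collect_le continuous_map_eval \<phi>) simp
    moreover have "D = A \<inter> {\<nu> \<in> topspace (pw_topology X). c \<le> \<nu> \<phi>}"
      using closedin_subset [OF cA(1)] by (auto simp: D_def)
    ultimately show ?thesis
      using closedin_Int [OF cA(1)] by simp
  qed
  have "mix_convex X D"
    unfolding mix_convex_def
  proof (intro ballI)
    fix \<mu> \<nu> and t :: real assume "\<mu> \<in> D" "\<nu> \<in> D" "t \<in> {0..1}"
    moreover from this have "(1 - t) * c + t * c \<le> (1 - t) * \<mu> \<phi> + t * \<nu> \<phi>"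
      by (intro add_mono mult_left_mono) (auto simp: D_def)
    ultimately show "mix X t \<mu> \<nu> \<in> D"
      using cA(2) by (auto simp: D_def mix_apply [OF \<phi>(1)] mix_convex_def algebra_simps)
  qed
  show ?case
  proof (cases "C = {} \<or> D = {}")
    case True
    then have "closedin (pw_topology X) (C \<union> D) \<and> mix_convex X (C \<union> D)"
      using C(1,2) \<open>closedin (pw_topology X) D\<close> \<open>mix_convex X D\<close> by auto
    moreover have "{\<nu> \<in> A. \<exists>(\<phi>, c)\<in>insert i J. c < \<nu> \<phi>} \<subseteq> C \<union> D"
      using C(5) by (auto simp: i D_def)
    ultimately show ?thesis
      using C(3,4) D by (intro exI [of _ "C \<union> D"]) simp
  next
    case False
    have compact: "compactin (pw_topology X) C" "compactin (pw_topology X) D"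
      using closed_compactin [OF compactin_cc_P [OF X A]] C D \<open>closedin (pw_topology X) D\<close> by auto
    have extA: "A \<subseteq> extensional (cfun X)"
      using cA(3) P_set_ext by blast
    have "C \<subseteq> mix_join X C D"
    proof
      fix u assume "u \<in> C"
      moreover obtain v where "v \<in> D"
        using False by auto
      moreover have "u = mix X 0 u v"
        using \<open>u \<in> C\<close> C(3) extA by (simp add: mix_0 subset_iff)
      ultimately show "u \<in> mix_join X C D"
        unfolding mix_join_def by (metis (mono_tags, lifting) atLeastAtMost_iff mem_Collect_eq order_refl zero_le_one)
    qed
    moreover have "D \<subseteq> mix_join X C D"
    proof
      fix v assume "v \<in> D"
      moreover obtain u where "u \<in> C"
        using False by auto
      moreover have "v = mix X 1 u v"
        using \<open>v \<in> D\<close> D(1) extA by (simp add: mix_1 subset_iff)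
      ultimately show "v \<in> mix_join X C D"
        unfolding mix_join_def by (metis (mono_tags, lifting) atLeastAtMost_iff mem_Collect_eq order_refl zero_le_one)
    qed
    moreover have "mix_join X C D \<subseteq> A"
      using cA(2) C(3) D(1) by (auto simp: mix_join_def mix_convex_def subset_iff)
    moreover have "{\<nu> \<in> A. \<exists>(\<phi>, c)\<in>insert i J. c < \<nu> \<phi>} \<subseteq> C \<union> D"
      using C(5) by (auto simp: i D_def)
    moreover have "a \<notin> mix_join X C D"
      using ext_points_notin_join [OF a C(3) D(1) extA C(4) D(2)] .
    moreover have "closedin (pw_topology X) (mix_join X C D)"
      by (rule compactin_imp_closedin [OF Hausdorff_pw compactin_mix_join [OF compact]])
    moreover have "mix_convex X (mix_join X C D)"
      by (rule mix_convex_join [OF C(2) \<open>mix_convex X D\<close>])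
    ultimately show ?thesis
      by (meson Un_least order_trans)
  qed
qed

definition closed_hull :: "'a topology \<Rightarrow> (('a \<Rightarrow> real) \<Rightarrow> real) set \<Rightarrow> (('a \<Rightarrow> real) \<Rightarrow> real) set" where
  "closed_hull X K = \<Inter>{C. closedin (pw_topology X) C \<and> mix_convex X C \<and> C \<subseteq> P_set X \<and> K \<subseteq> C}"

lemma closed_hull_minimal:
  "closedin (pw_topology X) C \<Longrightarrow> mix_convex X C \<Longrightarrow> C \<subseteq> P_set X \<Longrightarrow> K \<subseteq> C \<Longrightarrow> closed_hull X K \<subseteq> C"
  by (auto simp: closed_hull_def)

lemma closed_hull_sup: "K \<subseteq> closed_hull X K"
  by (auto simp: closed_hull_def)

lemma closed_hull_cc_P:
  assumes "K \<noteq> {}" "K \<subseteq> P_set X"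
  shows "closed_hull X K \<in> cc_P X"
  unfolding cc_P_iff
proof (intro conjI)
  have "mix_convex X (P_set X)"
    by (auto simp: mix_convex_def intro: mix_in_P_set)
  with closedin_P_set assms(2) show "closed_hull X K \<subseteq> P_set X"
    by (intro closed_hull_minimal) auto
  show "closedin (pw_topology X) (closed_hull X K)"
    unfolding closed_hull_def
    using closedin_P_set \<open>mix_convex X (P_set X)\<close> assms(2) by (intro closedin_Inter) auto
  show "mix_convex X (closed_hull X K)"
    by (auto simp: mix_convex_def closed_hull_def)
  show "closed_hull X K \<noteq> {}"
    using closed_hull_sup [of K X] assms(1) by auto
qed

text \<open>Milman's theorem. If the extreme point \<open>a\<close> is not in \<open>K\<close>, each point of \<open>K\<close> is separated from
  \<open>a\<close> by an open half-space given by some \<open>\<phi>\<close>. By compactness finitely many of these cover \<open>K\<close>, and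
  the set from \<open>hull_without_extreme_point\<close> would be a closed convex set containing \<open>K\<close> but not \<open>a\<close>.\<close>

lemma ext_points_closed_hull:
  assumes X: "comp_obj X" and K: "closedin (pw_topology X) K" "K \<noteq> {}" "K \<subseteq> P_set X"
  shows "ext_points X (closed_hull X K) \<subseteq> K"
proof
  fix a assume a: "a \<in> ext_points X (closed_hull X K)"
  define A where "A = closed_hull X K"
  have A: "A \<in> cc_P X"
    unfolding A_def by (rule closed_hull_cc_P [OF K(2,3)])
  have aA: "a \<in> A" and aP: "a \<in> P_set X"
    using a A by (auto simp: A_def ext_points_def cc_P_iff)
  show "a \<in> K"
  proof (rule ccontr)
    assume "a \<notin> K"
    define I where "I = {(\<phi>, c). \<phi> \<in> cfun X \<and> a \<phi> < c}"
    have "\<not> (\<exists>\<nu>\<in>K. \<forall>i\<in>I. \<nu> (fst i) \<le> snd i)"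
    proof
      assume "\<exists>\<nu>\<in>K. \<forall>i\<in>I. \<nu> (fst i) \<le> snd i"
      then obtain \<nu> where \<nu>: "\<nu> \<in> K" "\<And>\<phi> c. \<phi> \<in> cfun X \<Longrightarrow> a \<phi> < c \<Longrightarrow> \<nu> \<phi> \<le> c"
        by (auto simp: I_def)
      have \<nu>P: "\<nu> \<in> P_set X"
        using \<nu>(1) K(3) by auto
      \<comment> \<open>An inequality between two linear functionals is an equality: apply it to \<open>-\<phi>\<close>.\<close>
      have le: "\<nu> \<phi> \<le> a \<phi>" if "\<phi> \<in> cfun X" for \<phi>
        using \<nu>(2) [OF that] by (rule dense_ge)
      have "\<nu> \<phi> = a \<phi>" if "\<phi> \<in> cfun X" for \<phi>
        using le [OF that] le [OF cfun_scale [OF that, of "-1"]]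
        unfolding P_scale [OF \<nu>P that] P_scale [OF aP that] by simp
      then have "\<nu> = a"
        by (rule functional_eqI [OF P_set_ext [OF \<nu>P] P_set_ext [OF aP]])
      with \<nu>(1) \<open>a \<notin> K\<close> show False
        by simp
    qed
    moreover have "compactin (pw_topology X) K"
      by (rule closed_compactin [OF compactin_P_set [OF X] K(3,1)])
    moreover have "closedin (pw_topology X) {\<nu> \<in> topspace (pw_topology X). \<nu> (fst i) \<le> snd i}" if "i \<in> I" for i
      using that by (intro closedin_Collect_le continuous_map_eval) (auto simp: I_def)
    ultimately obtain J where J: "finite J" "J \<subseteq> I" "\<not> (\<exists>\<nu>\<in>K. \<forall>i\<in>J. \<nu> (fst i) \<le> snd i)"
      using compactin_common_point [of "pw_topology X" K I "\<lambda>i \<nu>. \<nu> (fst i) \<le> snd i"] by blast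
    then obtain C where C: "closedin (pw_topology X) C" "mix_convex X C" "C \<subseteq> A" "a \<notin> C"
      "{\<nu> \<in> A. \<exists>(\<phi>, c)\<in>J. c < \<nu> \<phi>} \<subseteq> C"
      using hull_without_extreme_point [OF X A, of a J] a by (auto simp: I_def A_def)
    have "K \<subseteq> C"
    proof
      fix \<nu> assume "\<nu> \<in> K"
      then have "\<exists>(\<phi>, c)\<in>J. c < \<nu> \<phi>"
        using J(3) by (force simp: not_le)
      with \<open>\<nu> \<in> K\<close> C(5) show "\<nu> \<in> C"
        using closed_hull_sup [of K X] by (auto simp: A_def)
    qed
    moreover have "C \<subseteq> P_set X"
      using C(3) A by (auto simp: cc_P_iff)
    ultimately have "A \<subseteq> C"
      unfolding A_def using C by (intro closed_hull_minimal) auto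
    with aA C(4) show False
      by auto
  qed
qed


section \<open>\<open>OS\<^sub>f\<close> as the upper envelopes of \<open>P\<^sub>f\<close>\<close>

definition below :: "'a topology \<Rightarrow> (('a \<Rightarrow> real) \<Rightarrow> real) \<Rightarrow> (('a \<Rightarrow> real) \<Rightarrow> real) \<Rightarrow> bool" where
  "below X \<mu> F \<longleftrightarrow> (\<forall>\<psi>\<in>cfun X. \<mu> \<psi> \<le> F \<psi>)"

lemma nu_eq_max:
  assumes "\<phi> \<in> cfun X" "\<mu> \<in> A" "\<And>\<nu>. \<nu> \<in> A \<Longrightarrow> \<nu> \<phi> \<le> \<mu> \<phi>"
  shows "nu X A \<phi> = \<mu> \<phi>"
proof -
  have "(SUP \<mu>\<in>A. \<mu> \<phi>) = \<mu> \<phi>"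
    using assms(2,3) by (intro cSup_eq_maximum) auto
  then show ?thesis
    using assms(1) by (simp add: nu_def)
qed

text \<open>The pointwise description of \<open>OS\<^sub>f\<close> on which everything else is based. From left to right, the
  measures are extreme points of the given convex set at which \<open>\<phi>\<close> is largest. From right to left, the
  convex set is the closed hull of all \<open>\<mu> \<in> P_f X\<close> below \<open>F\<close>; it stays below \<open>F\<close> since that is a closed
  and convex condition.\<close>

lemma OSf_set_iff:
  assumes X: "comp_obj X"
  shows "F \<in> OSf_set X \<longleftrightarrow>
    F \<in> extensional (cfun X) \<and> (\<forall>\<phi>\<in>cfun X. \<exists>\<mu>\<in>P_f X. \<mu> \<phi> = F \<phi> \<and> below X \<mu> F)"
proof (intro iffI conjI ballI)
  assume "F \<in> OSf_set X"
  then obtain A where A: "A \<in> cc_P X" "ext_points X A \<subseteq> P_f X" and F: "F = nu X A"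
    by (auto simp: OSf_set_def)
  show "F \<in> extensional (cfun X)"
    by (simp add: F nu_def)
  have max: "\<exists>\<mu>\<in>ext_points X A. F \<phi> = \<mu> \<phi> \<and> (\<forall>\<nu>\<in>A. \<nu> \<phi> \<le> F \<phi>)" if \<phi>: "\<phi> \<in> cfun X" for \<phi>
  proof -
    obtain \<mu> where \<mu>: "\<mu> \<in> ext_points X A" "\<And>\<nu>. \<nu> \<in> A \<Longrightarrow> \<nu> \<phi> \<le> \<mu> \<phi>"
      using ext_point_attains_max [OF X A(1) \<phi>] by blast
    then have "F \<phi> = \<mu> \<phi>"
      unfolding F by (intro nu_eq_max \<phi>) (auto simp: ext_points_def)
    with \<mu> show ?thesis
      by auto
  qed
  fix \<phi> assume "\<phi> \<in> cfun X"
  from max [OF this] obtain \<mu> where \<mu>: "\<mu> \<in> ext_points X A" "F \<phi> = \<mu> \<phi>"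
    by blast
  have "below X \<mu> F"
    unfolding below_def using max \<mu>(1) by (auto simp: ext_points_def)
  with \<mu> A(2) show "\<exists>\<mu>\<in>P_f X. \<mu> \<phi> = F \<phi> \<and> below X \<mu> F"
    by auto
next
  assume F: "F \<in> extensional (cfun X) \<and> (\<forall>\<phi>\<in>cfun X. \<exists>\<mu>\<in>P_f X. \<mu> \<phi> = F \<phi> \<and> below X \<mu> F)"
  define H where "H = {\<mu> \<in> topspace (pw_topology X). \<forall>\<psi>\<in>cfun X. \<mu> \<psi> \<le> F \<psi>}"
  define K where "K = P_f X \<inter> H"
  have topP: "P_set X \<subseteq> topspace (pw_topology X)"
    using closedin_subset [OF closedin_P_set] .
  have H: "closedin (pw_topology X) H"
    unfolding H_def by (intro closedin_Collect_ball closedin_Collect_le continuous_map_eval) auto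
  have inK: "\<mu> \<in> K" if "\<mu> \<in> P_f X" "below X \<mu> F" for \<mu>
    using that P_f_sub_P_set [of X] topP unfolding K_def H_def below_def by blast
  have K: "closedin (pw_topology X) K" "K \<subseteq> P_f X" "K \<subseteq> P_set X"
    using H closedin_P_f [OF X] P_f_sub_P_set [of X] by (auto simp: K_def)
  have "K \<noteq> {}"
    using F inK cfun_const [where X = X] by blast
  define A where "A = closed_hull X K"
  have "A \<subseteq> P_set X \<inter> H"
    unfolding A_def
  proof (rule closed_hull_minimal)
    show "mix_convex X (P_set X \<inter> H)"
      unfolding mix_convex_def
    proof (intro ballI)
      fix \<mu> \<nu> and t :: real assume *: "\<mu> \<in> P_set X \<inter> H" "\<nu> \<in> P_set X \<inter> H" "t \<in> {0..1}"
      have "mix X t \<mu> \<nu> \<psi> \<le> F \<psi>" if \<psi>: "\<psi> \<in> cfun X" for \<psi>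
      proof -
        have "(1 - t) * \<mu> \<psi> + t * \<nu> \<psi> \<le> (1 - t) * F \<psi> + t * F \<psi>"
          using * \<psi> by (intro add_mono mult_left_mono) (auto simp: H_def)
        then show ?thesis
          by (simp add: mix_apply [OF \<psi>] algebra_simps)
      qed
      moreover have "mix X t \<mu> \<nu> \<in> P_set X"
        using * by (intro mix_in_P_set) auto
      ultimately show "mix X t \<mu> \<nu> \<in> P_set X \<inter> H"
        using topP unfolding H_def by blast
    qed
  qed (use H closedin_P_set K(3) K_def in auto)
  have "nu X A = F"
  proof (rule functional_eqI)
    fix \<phi> assume \<phi>: "\<phi> \<in> cfun X"
    then obtain \<mu> where \<mu>: "\<mu> \<in> P_f X" "\<mu> \<phi> = F \<phi>" "below X \<mu> F"
      using F by blast
    have "\<mu> \<in> A"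
      using inK [OF \<mu>(1,3)] closed_hull_sup [of K X] by (auto simp: A_def)
    then show "nu X A \<phi> = F \<phi>"
      using \<open>A \<subseteq> P_set X \<inter> H\<close> \<phi> \<mu>(2) by (subst nu_eq_max [OF \<phi>, of \<mu>]) (auto simp: H_def)
  qed (use F in \<open>auto simp: nu_def\<close>)
  moreover have "A \<in> cc_P X"
    unfolding A_def by (rule closed_hull_cc_P [OF \<open>K \<noteq> {}\<close> K(3)])
  moreover have "ext_points X A \<subseteq> P_f X"
    unfolding A_def using ext_points_closed_hull [OF X K(1) \<open>K \<noteq> {}\<close> K(3)] K(2) by blast
  ultimately show "F \<in> OSf_set X"
    unfolding OSf_set_def by blast
qed



section \<open>The spaces \<open>OS\<^sub>f(X)\<close> are compact Hausdorff\<close>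

lemma OSf_attained:
  assumes "comp_obj X" "F \<in> OSf_set X" "\<phi> \<in> cfun X"
  obtains \<mu> where "\<mu> \<in> P_f X" "\<mu> \<in> P_set X" "\<mu> \<phi> = F \<phi>" "below X \<mu> F"
  using assms OSf_set_iff P_f_sub_P_set by blast

lemma OSf_ext: "F \<in> OSf_set X \<Longrightarrow> F \<in> extensional (cfun X)"
  by (auto simp: OSf_set_def nu_def)

lemma belowD: "below X \<mu> F \<Longrightarrow> \<psi> \<in> cfun X \<Longrightarrow> \<mu> \<psi> \<le> F \<psi>"
  by (simp add: below_def)

lemma OSf_const:
  assumes "comp_obj X" "F \<in> OSf_set X"
  shows "F (\<lambda>x\<in>topspace X. c) = c"
  using OSf_attained [OF assms cfun_const] P_const by metis

lemma OSf_mono: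
  assumes "comp_obj X" "F \<in> OSf_set X" "\<phi> \<in> cfun X" "\<psi> \<in> cfun X"
    and "\<And>x. x \<in> topspace X \<Longrightarrow> \<phi> x \<le> \<psi> x"
  shows "F \<phi> \<le> F \<psi>"
proof -
  obtain \<mu> where \<mu>: "\<mu> \<in> P_set X" "\<mu> \<phi> = F \<phi>" "below X \<mu> F"
    using OSf_attained assms(1-3) by blast
  have "\<mu> \<phi> \<le> \<mu> \<psi>"
    by (rule P_mono [OF \<mu>(1) assms(3,4)]) (rule assms(5))
  with \<mu> belowD [OF \<mu>(3) assms(4)] show ?thesis
    by simp
qed

lemma OSf_add_const:
  assumes X: "comp_obj X" and F: "F \<in> OSf_set X" and \<phi>: "\<phi> \<in> cfun X"
  shows "F (\<lambda>x\<in>topspace X. \<phi> x + c) = F \<phi> + c"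
proof (rule antisym)
  obtain \<mu> where \<mu>: "\<mu> \<in> P_set X" "\<mu> (\<lambda>x\<in>topspace X. \<phi> x + c) = F (\<lambda>x\<in>topspace X. \<phi> x + c)" "below X \<mu> F"
    using OSf_attained [OF X F cfun_add_const [OF \<phi>]] by blast
  then show "F (\<lambda>x\<in>topspace X. \<phi> x + c) \<le> F \<phi> + c"
    using belowD [OF \<mu>(3) \<phi>] by (simp add: P_add_const [OF \<mu>(1) \<phi>])
  obtain \<mu> where \<mu>: "\<mu> \<in> P_set X" "\<mu> \<phi> = F \<phi>" "below X \<mu> F"
    using OSf_attained [OF X F \<phi>] by blast
  then show "F \<phi> + c \<le> F (\<lambda>x\<in>topspace X. \<phi> x + c)"
    using belowD [OF \<mu>(3) cfun_add_const [OF \<phi>], of c] by (simp add: P_add_const [OF \<mu>(1) \<phi>])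
qed

lemma OSf_scale:
  assumes X: "comp_obj X" and F: "F \<in> OSf_set X" and \<phi>: "\<phi> \<in> cfun X" and t: "0 \<le> t"
  shows "F (\<lambda>x\<in>topspace X. t * \<phi> x) = t * F \<phi>"
proof (rule antisym)
  obtain \<mu> where \<mu>: "\<mu> \<in> P_set X" "\<mu> (\<lambda>x\<in>topspace X. t * \<phi> x) = F (\<lambda>x\<in>topspace X. t * \<phi> x)" "below X \<mu> F"
    using OSf_attained [OF X F cfun_scale [OF \<phi>]] by blast
  then show "F (\<lambda>x\<in>topspace X. t * \<phi> x) \<le> t * F \<phi>"
    using mult_left_mono [OF belowD [OF \<mu>(3) \<phi>] t] by (simp add: P_scale [OF \<mu>(1) \<phi>])
  obtain \<mu> where \<mu>: "\<mu> \<in> P_set X" "\<mu> \<phi> = F \<phi>" "below X \<mu> F"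
    using OSf_attained [OF X F \<phi>] by blast
  then show "t * F \<phi> \<le> F (\<lambda>x\<in>topspace X. t * \<phi> x)"
    using belowD [OF \<mu>(3) cfun_scale [OF \<phi>], of t] by (simp add: P_scale [OF \<mu>(1) \<phi>])
qed

lemma OSf_subadd:
  assumes X: "comp_obj X" and F: "F \<in> OSf_set X" and \<phi>: "\<phi> \<in> cfun X" "\<psi> \<in> cfun X"
  shows "F (\<lambda>x\<in>topspace X. \<phi> x + \<psi> x) \<le> F \<phi> + F \<psi>"
proof -
  obtain \<mu> where \<mu>: "\<mu> \<in> P_set X" "\<mu> (\<lambda>x\<in>topspace X. \<phi> x + \<psi> x) = F (\<lambda>x\<in>topspace X. \<phi> x + \<psi> x)" "below X \<mu> F"
    using OSf_attained [OF X F cfun_add [OF \<phi>]] by blast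
  then show ?thesis
    using belowD [OF \<mu>(3) \<phi>(1)] belowD [OF \<mu>(3) \<phi>(2)] by (simp add: P_add [OF \<mu>(1) \<phi>])
qed

lemma OSf_sub_OS_set:
  assumes X: "comp_obj X"
  shows "OSf_set X \<subseteq> OS_set X"
proof
  fix F assume F: "F \<in> OSf_set X"
  have "F \<phi> \<le> F \<psi>"
    if "\<phi> \<in> cfun X" "\<psi> \<in> cfun X" "\<forall>x\<in>topspace X. \<phi> x \<le> \<psi> x" for \<phi> \<psi>
    using OSf_mono [OF X F that(1,2)] that(3) by blast
  then show "F \<in> OS_set X"
    unfolding OS_set_def
    by (simp add: OSf_ext [OF F] OSf_add_const [OF X F] OSf_scale [OF X F] OSf_subadd [OF X F]
        OSf_const [OF X F])
qed

lemma OSf_eq: "comp_obj X \<Longrightarrow> OSf X = subtopology (pw_topology X) (OSf_set X)"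
  unfolding OSf_def OS_def subtopology_subtopology
  using OSf_sub_OS_set [of X] by (simp add: inf_absorb2)

lemma topspace_OSf [simp]: "comp_obj X \<Longrightarrow> topspace (OSf X) = OSf_set X"
  unfolding OSf_def using OSf_sub_OS_set [of X] by (auto simp: topspace_OS)

lemma OSf_bounded:
  assumes X: "comp_obj X" and F: "F \<in> OSf_set X" and \<phi>: "\<phi> \<in> cfun X"
    and M: "\<And>x. x \<in> topspace X \<Longrightarrow> \<bar>\<phi> x\<bar> \<le> M"
  shows "\<bar>F \<phi>\<bar> \<le> M"
proof -
  obtain \<mu> where "\<mu> \<in> P_set X" "\<mu> \<phi> = F \<phi>"
    using OSf_attained [OF X F \<phi>] by blast
  then show ?thesis
    using P_bounded [of \<mu> X \<phi> M] \<phi> M by simp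
qed

lemma dirac_in_OSf_set:
  assumes X: "comp_obj X" and x: "x \<in> topspace X"
  shows "dirac X x \<in> OSf_set X"
proof -
  have "below X (dirac X x) (dirac X x)"
    by (simp add: below_def)
  moreover have "dirac X x \<in> extensional (cfun X)"
    by (simp add: dirac_def)
  ultimately show ?thesis
    unfolding OSf_set_iff [OF X] using dirac_in_P_f [OF x] by blast
qed

text \<open>If \<open>F\<close> is approximated by elements \<open>G\<close> of the set on finitely many functions, the measures that
  attain \<open>G \<phi>\<close> are nearly below \<open>F\<close> on these functions and nearly attain \<open>F \<phi>\<close>. Compactness of \<open>P_f X\<close>
  removes both approximations at once.\<close>

lemma closedin_OSf_set:
  assumes X: "comp_obj X"
  shows "closedin (pw_topology X) (OSf_set X)"
proof -
  have "F \<in> OSf_set X" if F: "F \<in> pw_topology X closure_of OSf_set X" for F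
    unfolding OSf_set_iff [OF X]
  proof (intro conjI ballI)
    show "F \<in> extensional (cfun X)"
      using F unfolding in_closure_of topspace_pw by blast
    fix \<phi> assume \<phi>: "\<phi> \<in> cfun X"
    define I where "I = cfun X \<times> {0 :: real<..}"
    have "\<exists>\<mu>\<in>P_f X. \<forall>i\<in>I. \<mu> (fst i) \<le> F (fst i) + snd i \<and> F \<phi> - snd i \<le> \<mu> \<phi>"
    proof (rule compactin_common_point [OF compactin_P_f [OF X]])
      fix i assume "i \<in> I"
      then show "closedin (pw_topology X) {\<mu> \<in> topspace (pw_topology X).
          \<mu> (fst i) \<le> F (fst i) + snd i \<and> F \<phi> - snd i \<le> \<mu> \<phi>}"
        using \<phi> by (intro closedin_Collect_conj closedin_Collect_le continuous_map_eval) (auto simp: I_def)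
    next
      fix J assume J: "finite J" "J \<subseteq> I"
      define \<epsilon> where "\<epsilon> = Min (insert 1 (snd ` J))"
      have \<epsilon>: "0 < \<epsilon>" "\<And>i. i \<in> J \<Longrightarrow> \<epsilon> \<le> snd i"
        using J by (auto simp: \<epsilon>_def I_def)
      define U where "U = {G \<in> topspace (pw_topology X). \<forall>\<psi>\<in>insert \<phi> (fst ` J). \<bar>G \<psi> - F \<psi>\<bar> < \<epsilon>}"
      have "openin (pw_topology X) U"
        unfolding U_def
      proof (rule openin_Collect_finite_ball)
        fix \<psi> assume "\<psi> \<in> insert \<phi> (fst ` J)"
        then have "\<psi> \<in> cfun X"
          using J(2) \<phi> by (auto simp: I_def)
        then have "continuous_map (pw_topology X) euclideanreal (\<lambda>G. \<bar>G \<psi> - F \<psi>\<bar>)"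
          by (intro continuous_map_real_abs continuous_map_diff continuous_map_eval) auto
        then show "openin (pw_topology X) {G \<in> topspace (pw_topology X). \<bar>G \<psi> - F \<psi>\<bar> < \<epsilon>}"
          by (rule openin_Collect_less) simp
      qed (use J in auto)
      moreover have "F \<in> U"
        using F \<epsilon> by (simp add: U_def in_closure_of)
      ultimately obtain G where G: "G \<in> OSf_set X" "G \<in> U"
        using F unfolding in_closure_of by blast
      obtain \<mu> where \<mu>: "\<mu> \<in> P_f X" "\<mu> \<phi> = G \<phi>" "below X \<mu> G"
        using OSf_attained [OF X G(1) \<phi>] by blast
      show "\<exists>\<mu>\<in>P_f X. \<forall>i\<in>J. \<mu> (fst i) \<le> F (fst i) + snd i \<and> F \<phi> - snd i \<le> \<mu> \<phi>"
      proof (intro bexI [OF _ \<mu>(1)] ballI conjI)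
        fix i assume i: "i \<in> J"
        then have "\<mu> (fst i) \<le> G (fst i)"
          using J(2) by (rule_tac belowD [OF \<mu>(3)]) (auto simp: I_def)
        moreover have "\<bar>G (fst i) - F (fst i)\<bar> < \<epsilon>" "\<bar>G \<phi> - F \<phi>\<bar> < \<epsilon>"
          using G(2) i by (auto simp: U_def)
        ultimately show "\<mu> (fst i) \<le> F (fst i) + snd i" "F \<phi> - snd i \<le> \<mu> \<phi>"
          using \<epsilon>(2) [OF i] \<mu>(2) by linarith+
      qed
    qed
    then obtain \<mu> where \<mu>: "\<mu> \<in> P_f X"
      and le: "\<And>\<psi> \<epsilon>. \<psi> \<in> cfun X \<Longrightarrow> 0 < \<epsilon> \<Longrightarrow> \<mu> \<psi> \<le> F \<psi> + \<epsilon> \<and> F \<phi> - \<epsilon> \<le> \<mu> \<phi>"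
      by (auto simp: I_def)
    have "\<mu> \<psi> \<le> F \<psi>" if "\<psi> \<in> cfun X" for \<psi>
      using le [OF that] by (rule_tac field_le_epsilon) auto
    moreover have "F \<phi> \<le> \<mu> \<phi>"
      using le [OF \<phi>] by (rule_tac field_le_epsilon) (auto simp: algebra_simps)
    ultimately have "below X \<mu> F" "\<mu> \<phi> = F \<phi>"
      using \<phi> by (auto simp: below_def intro: antisym)
    with \<mu> show "\<exists>\<mu>\<in>P_f X. \<mu> \<phi> = F \<phi> \<and> below X \<mu> F"
      by blast
  qed
  moreover have "OSf_set X \<subseteq> topspace (pw_topology X)"
    unfolding topspace_pw using OSf_ext by blast
  ultimately show ?thesis
    using closure_of_subset_eq [of "OSf_set X" "pw_topology X"] by blast
qed

lemma comp_obj_OSf: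
  assumes X: "comp_obj X"
  shows "comp_obj (OSf X)"
proof -
  have "compactin (pw_topology X) (OSf_set X)"
    by (rule closed_bounded_compactin_pw [OF X closedin_OSf_set [OF X]]) (rule OSf_bounded [OF X])
  then show ?thesis
    unfolding comp_obj_def OSf_eq [OF X]
    by (simp add: compact_space_subtopology Hausdorff_space_subtopology Hausdorff_pw)
qed


section \<open>Functoriality\<close>

text \<open>\<open>OS_map\<close> without the restriction to \<open>OS\<close>, so that it applies to measures and functionals
  alike.\<close>

definition push ::
    "'a topology \<Rightarrow> 'b topology \<Rightarrow> ('a \<Rightarrow> 'b) \<Rightarrow> (('a \<Rightarrow> real) \<Rightarrow> real) \<Rightarrow> ('b \<Rightarrow> real) \<Rightarrow> real" where
  "push X Y f F = (\<lambda>\<phi>\<in>cfun Y. F (\<lambda>x\<in>topspace X. \<phi> (f x)))"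

lemma push_apply: "\<phi> \<in> cfun Y \<Longrightarrow> push X Y f F \<phi> = F (\<lambda>x\<in>topspace X. \<phi> (f x))"
  by (simp add: push_def)

lemma push_ext [simp]: "push X Y f F \<in> extensional (cfun Y)"
  by (simp add: push_def)

lemma push_comb:
  assumes "f \<in> comp_hom X Y" "\<And>j. j \<in> J \<Longrightarrow> x j \<in> topspace X"
  shows "push X Y f (comb X J \<alpha> x) = comb Y J \<alpha> (\<lambda>j. f (x j))"
  using assms
  by (intro functional_eqI [of _ Y]) (auto simp: push_apply comb_apply intro!: sum.cong)

lemma push_P_f:
  assumes f: "f \<in> comp_hom X Y" and \<mu>: "\<mu> \<in> P_f X"
  shows "push X Y f \<mu> \<in> P_f Y"
proof -
  obtain S \<alpha> x\<^sub>0 where S: "finite S" "S \<subseteq> topspace X" "\<forall>x\<in>S. 0 < \<alpha> x" "sum \<alpha> S = 1"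
    "x\<^sub>0 \<in> S" "1 - 1 / (real (card S) + 1) \<le> \<alpha> x\<^sub>0" and \<mu>: "\<mu> = comb X S \<alpha> (\<lambda>x. x)"
    using \<mu> by (rule P_f_obtain)
  have "push X Y f \<mu> = comb Y S \<alpha> f"
    unfolding \<mu> using S(2) push_comb [OF f, of S "\<lambda>x. x" \<alpha>] by auto
  also have "\<dots> \<in> P_f Y"
    using S comp_hom_in [OF f] by (rule_tac comb_in_P_f [where j\<^sub>0 = x\<^sub>0]) (auto simp: less_imp_le)
  finally show ?thesis .
qed

lemma push_below:
  "f \<in> comp_hom X Y \<Longrightarrow> below X \<mu> F \<Longrightarrow> below Y (push X Y f \<mu>) (push X Y f F)"
  by (simp add: below_def push_apply)

lemma push_OSf_set:
  assumes X: "comp_obj X" and Y: "comp_obj Y" and f: "f \<in> comp_hom X Y" and F: "F \<in> OSf_set X"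
  shows "push X Y f F \<in> OSf_set Y"
  unfolding OSf_set_iff [OF Y]
proof (intro conjI ballI)
  fix \<phi> assume \<phi>: "\<phi> \<in> cfun Y"
  obtain \<mu> where \<mu>: "\<mu> \<in> P_f X"
    "\<mu> (\<lambda>x\<in>topspace X. \<phi> (f x)) = F (\<lambda>x\<in>topspace X. \<phi> (f x))" "below X \<mu> F"
    using OSf_attained [OF X F cfun_comp [OF f \<phi>]] by blast
  have "push X Y f \<mu> \<phi> = push X Y f F \<phi>"
    using \<mu>(2) by (simp add: push_apply [OF \<phi>])
  with push_P_f [OF f \<mu>(1)] push_below [OF f \<mu>(3)]
  show "\<exists>\<nu>\<in>P_f Y. \<nu> \<phi> = push X Y f F \<phi> \<and> below Y \<nu> (push X Y f F)"
    by blast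
qed simp

lemma continuous_map_push:
  assumes "f \<in> comp_hom X Y"
  shows "continuous_map (pw_topology X) (pw_topology Y) (push X Y f)"
  unfolding continuous_map_componentwise
proof (intro conjI ballI)
  fix \<phi> assume "\<phi> \<in> cfun Y"
  then show "continuous_map (pw_topology X) euclideanreal (\<lambda>F. push X Y f F \<phi>)"
    using continuous_map_eval [OF cfun_comp [OF assms]] by (simp add: push_apply)
qed auto

lemma push_compose:
  assumes f: "f \<in> comp_hom X Y" and g: "g \<in> comp_hom Y Z"
    and h: "\<And>x. x \<in> topspace X \<Longrightarrow> h x = g (f x)"
  shows "push Y Z g (push X Y f F) = push X Z h F"
proof (rule functional_eqI)
  fix \<phi> assume \<phi>: "\<phi> \<in> cfun Z"
  have "(\<lambda>x\<in>topspace X. (\<lambda>y\<in>topspace Y. \<phi> (g y)) (f x)) = (\<lambda>x\<in>topspace X. \<phi> (h x))"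
    using comp_hom_in [OF f] h by auto
  then show "push Y Z g (push X Y f F) \<phi> = push X Z h F \<phi>"
    using \<phi> g by (simp add: push_apply)
qed auto

lemma push_id:
  assumes "F \<in> extensional (cfun X)" "\<And>x. x \<in> topspace X \<Longrightarrow> f x = x"
  shows "push X X f F = F"
proof (rule functional_eqI)
  fix \<phi> assume \<phi>: "\<phi> \<in> cfun X"
  have "(\<lambda>x\<in>topspace X. \<phi> (f x)) = \<phi>"
    using assms(2) restrict_cfun [OF \<phi>] by (metis (no_types, lifting) restrict_ext)
  then show "push X X f F \<phi> = F \<phi>"
    by (simp add: push_apply [OF \<phi>])
qed (use assms in auto)

lemma OSf_map_apply:
  assumes "comp_obj X" "F \<in> OSf_set X"
  shows "OSf_map X Y f F = push X Y f F"
  using assms OSf_sub_OS_set [of X]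
  by (auto simp: OSf_map_def OS_map_def push_def topspace_OS)

lemma OSf_map_ext: "comp_obj X \<Longrightarrow> OSf_map X Y f \<in> extensional (OSf_set X)"
  unfolding OSf_map_def by (metis restrict_extensional topspace_OSf)

lemma OSf_map_hom:
  assumes X: "comp_obj X" and Y: "comp_obj Y" and f: "f \<in> comp_hom X Y"
  shows "OSf_map X Y f \<in> comp_hom (OSf X) (OSf Y)"
proof -
  have "continuous_map (OSf X) (OSf Y) (push X Y f)"
    unfolding OSf_eq [OF X] OSf_eq [OF Y]
    using continuous_map_push [OF f] push_OSf_set [OF X Y f]
    by (auto simp: continuous_map_in_subtopology continuous_map_from_subtopology)
  then have "continuous_map (OSf X) (OSf Y) (OSf_map X Y f)"
    by (rule continuous_map_eq) (simp add: X OSf_map_apply)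
  then show ?thesis
    using OSf_map_ext [OF X] X by (simp add: comp_hom_def)
qed

theorem OSf_functor:
  "comp_functor
     (OSf :: 'a topology \<Rightarrow> _) (OSf :: 'b topology \<Rightarrow> _) (OSf :: 'c topology \<Rightarrow> _)
     OSf_map OSf_map OSf_map OSf_map"
  unfolding comp_functor_def
proof (intro conjI allI impI)
  fix X :: "'a topology" assume X: "comp_obj X"
  show "comp_obj (OSf X)"
    by (rule comp_obj_OSf [OF X])
  show "OSf_map X X (comp_id X) = comp_id (OSf X)"
  proof (rule extensionalityI [of _ "OSf_set X"])
    fix F assume F: "F \<in> OSf_set X"
    have "push X X (comp_id X) F = F"
      by (rule push_id [OF OSf_ext [OF F]]) (simp add: comp_id_def)
    then show "OSf_map X X (comp_id X) F = comp_id (OSf X) F"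
      using F by (simp add: OSf_map_apply [OF X F] comp_id_def X)
  qed (simp_all add: OSf_map_ext X comp_id_def)
next
  fix X :: "'a topology" and Y :: "'b topology" and f
  assume "comp_obj X" "comp_obj Y" "f \<in> comp_hom X Y"
  then show "OSf_map X Y f \<in> comp_hom (OSf X) (OSf Y)"
    by (rule OSf_map_hom)
next
  fix X :: "'a topology" and Y :: "'b topology" and Z :: "'c topology" and f g
  assume X: "comp_obj X" and Y: "comp_obj Y" and Z: "comp_obj Z"
    and f: "f \<in> comp_hom X Y" and g: "g \<in> comp_hom Y Z"
  show "OSf_map X Z (compose (topspace X) g f) =
      compose (topspace (OSf X)) (OSf_map Y Z g) (OSf_map X Y f)"
  proof (rule extensionalityI [of _ "OSf_set X"])
    fix F assume F: "F \<in> OSf_set X"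
    show "OSf_map X Z (compose (topspace X) g f) F =
        compose (topspace (OSf X)) (OSf_map Y Z g) (OSf_map X Y f) F"
      using F push_OSf_set [OF X Y f F] push_compose [OF f g, of "compose (topspace X) g f" F]
      by (simp add: compose_def OSf_map_apply X Y)
  qed (simp_all add: OSf_map_ext X compose_def)
qed


section \<open>Lifting functionals along maps\<close>

lemma closedin_push_below:
  assumes "f \<in> comp_hom X Y"
  shows "closedin (pw_topology X) {\<mu> \<in> topspace (pw_topology X). below Y (push X Y f \<mu>) F}"
  unfolding below_def
proof (rule closedin_Collect_ball)
  fix \<psi> assume "\<psi> \<in> cfun Y"
  then show "closedin (pw_topology X) {\<mu> \<in> topspace (pw_topology X). push X Y f \<mu> \<psi> \<le> F \<psi>}"
    unfolding push_apply [OF \<open>\<psi> \<in> cfun Y\<close>]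
    by (intro closedin_Collect_le continuous_map_eval cfun_comp [OF assms]) auto
qed

text \<open>Compactness of \<open>L\<close> turns the supremum into a maximum, as \<open>OSf_set_iff\<close> requires.\<close>

lemma nu_in_OSf_set:
  assumes X: "comp_obj X" and L: "compactin (pw_topology X) L" "L \<noteq> {}" "L \<subseteq> P_f X"
  shows "nu X L \<in> OSf_set X"
    and "\<And>\<phi>. \<phi> \<in> cfun X \<Longrightarrow> \<exists>\<mu>\<in>L. nu X L \<phi> = \<mu> \<phi> \<and> (\<forall>\<nu>\<in>L. \<nu> \<phi> \<le> nu X L \<phi>)"
proof -
  show max: "\<exists>\<mu>\<in>L. nu X L \<phi> = \<mu> \<phi> \<and> (\<forall>\<nu>\<in>L. \<nu> \<phi> \<le> nu X L \<phi>)" if \<phi>: "\<phi> \<in> cfun X" for \<phi>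
  proof -
    obtain \<mu> where "\<mu> \<in> L" "\<And>\<nu>. \<nu> \<in> L \<Longrightarrow> \<nu> \<phi> \<le> \<mu> \<phi>"
      using compactin_attains_max [OF L(1,2) continuous_map_eval [OF \<phi>]] by blast
    moreover from this have "nu X L \<phi> = \<mu> \<phi>"
      by (rule nu_eq_max [OF \<phi>])
    ultimately show ?thesis
      by auto
  qed
  have "below X \<mu> (nu X L)" if "\<mu> \<in> L" for \<mu>
    unfolding below_def using max that by blast
  with max L(3) show "nu X L \<in> OSf_set X"
    unfolding OSf_set_iff [OF X] by (fastforce simp: nu_def)
qed

text \<open>The lift is the supremum over the set \<open>L\<close> of all measures whose images lie below all of the
  \<open>F i\<close>. It is not too large because of the choice of \<open>L\<close>, and not too small by the assumption that the
  values of each \<open>F i\<close> are attained in \<open>L\<close>.\<close>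

lemma OSf_common_lift:
  assumes X: "comp_obj X" and I: "I \<noteq> {}"
    and f: "\<And>i. i \<in> I \<Longrightarrow> f i \<in> comp_hom X (Y i)"
    and F: "\<And>i. i \<in> I \<Longrightarrow> F i \<in> extensional (cfun (Y i))"
    and att: "\<And>i \<phi>. i \<in> I \<Longrightarrow> \<phi> \<in> cfun (Y i) \<Longrightarrow> \<exists>\<mu>\<in>P_f X.
      push X (Y i) (f i) \<mu> \<phi> = F i \<phi> \<and> (\<forall>j\<in>I. below (Y j) (push X (Y j) (f j) \<mu>) (F j))"
  shows "\<exists>G\<in>OSf_set X. \<forall>i\<in>I. push X (Y i) (f i) G = F i"
proof -
  define H where "H = {\<mu> \<in> topspace (pw_topology X). \<forall>j\<in>I. below (Y j) (push X (Y j) (f j) \<mu>) (F j)}"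
  define L where "L = P_f X \<inter> H"
  have "closedin (pw_topology X) H"
    unfolding H_def by (intro closedin_Collect_ball closedin_push_below f)
  then have L: "compactin (pw_topology X) L" "L \<subseteq> P_f X"
    using compactin_P_f [OF X] compact_Int_closedin by (auto simp: L_def)
  have inL: "\<mu> \<in> L" if "\<mu> \<in> P_f X" "\<forall>j\<in>I. below (Y j) (push X (Y j) (f j) \<mu>) (F j)" for \<mu>
    using that compactin_subset_topspace [OF compactin_P_f [OF X]] unfolding L_def H_def by blast
  obtain i where "i \<in> I"
    using I by blast
  then have "L \<noteq> {}"
    using att [OF _ cfun_const] inL by blast
  note nu = nu_in_OSf_set [OF X L(1) this L(2)]
  have "push X (Y i) (f i) (nu X L) = F i" if i: "i \<in> I" for i
  proof (rule functional_eqI)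
    fix \<phi> assume \<phi>: "\<phi> \<in> cfun (Y i)"
    let ?\<psi> = "\<lambda>x\<in>topspace X. \<phi> (f i x)"
    have \<psi>: "?\<psi> \<in> cfun X"
      by (rule cfun_comp [OF f [OF i] \<phi>])
    obtain \<mu> where \<mu>: "\<mu> \<in> L" "nu X L ?\<psi> = \<mu> ?\<psi>"
      using nu(2) [OF \<psi>] by blast
    have "below (Y i) (push X (Y i) (f i) \<mu>) (F i)"
      using \<mu>(1) i by (simp add: L_def H_def)
    then have "nu X L ?\<psi> \<le> F i \<phi>"
      using belowD [OF _ \<phi>] \<mu>(2) by (fastforce simp: push_apply [OF \<phi>])
    moreover obtain \<kappa> where "\<kappa> \<in> P_f X" "push X (Y i) (f i) \<kappa> \<phi> = F i \<phi>"
      "\<forall>j\<in>I. below (Y j) (push X (Y j) (f j) \<kappa>) (F j)"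
      using att [OF i \<phi>] by blast
    then have "F i \<phi> \<le> nu X L ?\<psi>"
      using nu(2) [OF \<psi>] inL by (force simp: push_apply [OF \<phi>])
    ultimately show "push X (Y i) (f i) (nu X L) \<phi> = F i \<phi>"
      by (simp add: push_apply [OF \<phi>])
  qed (use F i in auto)
  with nu(1) show ?thesis
    by blast
qed

lemma OSf_lift:
  assumes X: "comp_obj X" and f: "f \<in> comp_hom X Y" and F: "F \<in> extensional (cfun Y)"
    and att: "\<And>\<phi>. \<phi> \<in> cfun Y \<Longrightarrow> \<exists>\<mu>\<in>P_f X. push X Y f \<mu> \<phi> = F \<phi> \<and> below Y (push X Y f \<mu>) F"
  shows "\<exists>G\<in>OSf_set X. push X Y f G = F"
  using OSf_common_lift [OF X, of "{()}" "\<lambda>_. f" "\<lambda>_. Y" "\<lambda>_. F"] f F att by simp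

text \<open>A measure in \<open>P_f Y\<close> is lifted by choosing a preimage of each of its atoms: number and weights of
  the atoms stay the same.\<close>

theorem OSf_epimorphic:
  "functor_epimorphic (OSf :: 'a topology \<Rightarrow> _) (OSf :: 'b topology \<Rightarrow> _) OSf_map"
  unfolding functor_epimorphic_def
proof (intro allI impI)
  fix X :: "'a topology" and Y :: "'b topology" and f
  assume X: "comp_obj X" and Y: "comp_obj Y" and f: "f \<in> comp_hom X Y"
    and onto: "f ` topspace X = topspace Y"
  have lift: "\<exists>\<mu>\<in>P_f X. push X Y f \<mu> = \<nu>" if \<nu>: "\<nu> \<in> P_f Y" for \<nu>
  proof -
    obtain S \<alpha> y\<^sub>0 where S: "finite S" "S \<subseteq> topspace Y" "\<forall>y\<in>S. 0 < \<alpha> y" "sum \<alpha> S = 1"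
      "y\<^sub>0 \<in> S" "1 - 1 / (real (card S) + 1) \<le> \<alpha> y\<^sub>0" and \<nu>: "\<nu> = comb Y S \<alpha> (\<lambda>y. y)"
      using \<nu> by (rule P_f_obtain)
    define g where "g = inv_into (topspace X) f"
    have g: "g y \<in> topspace X" "f (g y) = y" if "y \<in> S" for y
      using that S(2) onto by (auto simp: g_def inv_into_into f_inv_into_f)
    have "comb X S \<alpha> g \<in> P_f X"
      using S g by (rule_tac comb_in_P_f [where j\<^sub>0 = y\<^sub>0]) (auto simp: less_imp_le)
    moreover have "push X Y f (comb X S \<alpha> g) = \<nu>"
      unfolding \<nu> using g push_comb [OF f, of S g \<alpha>] by (simp add: comb_def)
    ultimately show ?thesis
      by blast
  qed
  have "\<exists>G\<in>OSf_set X. push X Y f G = F" if F: "F \<in> OSf_set Y" for F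
  proof (rule OSf_lift [OF X f OSf_ext [OF F]])
    fix \<phi> assume "\<phi> \<in> cfun Y"
    then show "\<exists>\<mu>\<in>P_f X. push X Y f \<mu> \<phi> = F \<phi> \<and> below Y (push X Y f \<mu>) F"
      using OSf_attained [OF Y F] lift by metis
  qed
  then show "OSf_map X Y f ` topspace (OSf X) = topspace (OSf Y)"
    using push_OSf_set [OF X Y f] by (force simp: X Y OSf_map_apply)
qed

text \<open>For injective \<open>f\<close> each \<open>\<psi> \<in> cfun X\<close> has the form \<open>\<phi> \<circ> f\<close>, because \<open>f\<close> embeds \<open>X\<close> as a closed
  subspace and Tietze's theorem extends \<open>\<psi>\<close> to \<open>Y\<close>.\<close>

theorem OSf_monomorphic:
  "functor_monomorphic
     (OSf :: 'a topology \<Rightarrow> _) (OSf_map :: 'a topology \<Rightarrow> 'b topology \<Rightarrow> _)"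
  unfolding functor_monomorphic_def
proof (intro allI impI)
  fix X :: "'a topology" and Y :: "'b topology" and f
  assume X: "comp_obj X" and Y: "comp_obj Y" and f: "f \<in> comp_hom X Y"
    and inj: "inj_on f (topspace X)"
  have extend: "\<exists>\<phi>\<in>cfun Y. (\<lambda>x\<in>topspace X. \<phi> (f x)) = \<psi>" if \<psi>: "\<psi> \<in> cfun X" for \<psi>
  proof -
    let ?S = "f ` topspace X"
    have cf: "continuous_map X Y f"
      by (rule comp_hom_cont [OF f])
    have "embedding_map X Y f"
      using X Y cf inj by (auto simp: comp_obj_def intro: continuous_imp_embedding_map)
    then obtain g where g: "homeomorphic_maps X (subtopology Y ?S) f g"
      by (auto simp: embedding_map_def homeomorphic_map_maps)
    then have cg: "continuous_map (subtopology Y ?S) X g"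
      and gf: "\<And>x. x \<in> topspace X \<Longrightarrow> g (f x) = x"
      by (auto simp: homeomorphic_maps_def)
    have "continuous_map (subtopology Y ?S) euclideanreal (\<psi> \<circ> g)"
      using cg cfunD [OF \<psi>] by (rule continuous_map_compose)
    moreover have "normal_space Y"
      using Y by (auto simp: comp_obj_def compact_Hausdorff_or_regular_imp_normal_space)
    moreover have "closedin Y ?S"
      using X Y cf by (meson comp_obj_def compact_space_def compactin_imp_closedin image_compactin)
    ultimately obtain h where h: "continuous_map Y euclideanreal h" "\<And>y. y \<in> ?S \<Longrightarrow> h y = (\<psi> \<circ> g) y"
      using Tietze_extension_realinterval [of Y ?S UNIV "\<psi> \<circ> g"] by auto
    show ?thesis
    proof (rule bexI [of _ "restrict h (topspace Y)"])
      show "restrict h (topspace Y) \<in> cfun Y"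
        by (rule cfunI [OF h(1)])
      have "(\<lambda>x\<in>topspace X. restrict h (topspace Y) (f x)) = (\<lambda>x\<in>topspace X. \<psi> x)"
        using h(2) gf comp_hom_in [OF f] by (intro restrict_ext) auto
      then show "(\<lambda>x\<in>topspace X. restrict h (topspace Y) (f x)) = \<psi>"
        using \<psi> by simp
    qed
  qed
  have "F = G" if F: "F \<in> OSf_set X" "G \<in> OSf_set X" "push X Y f F = push X Y f G" for F G
  proof (rule functional_eqI [OF OSf_ext [OF F(1)] OSf_ext [OF F(2)]])
    fix \<psi> assume "\<psi> \<in> cfun X"
    then obtain \<phi> where "\<phi> \<in> cfun Y" "(\<lambda>x\<in>topspace X. \<phi> (f x)) = \<psi>"
      using extend by blast
    then show "F \<psi> = G \<psi>"
      using F(3) push_apply [of \<phi> Y X f] by metis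
  qed
  then show "inj_on (OSf_map X Y f) (topspace (OSf X))"
    by (auto simp: X OSf_map_apply intro!: inj_onI)
qed


section \<open>Supports\<close>

lemma comp_obj_subtopology: "comp_obj X \<Longrightarrow> closedin X A \<Longrightarrow> comp_obj (subtopology X A)"
  by (simp add: comp_obj_def closedin_compact_space compact_space_subtopology Hausdorff_space_subtopology)

lemma comp_incl_hom: "comp_incl X A \<in> comp_hom (subtopology X A) X"
  unfolding comp_hom_def comp_incl_def
  by (auto intro!: continuous_map_eq [of _ _ "\<lambda>x. x"] simp: continuous_map_from_subtopology)

text \<open>An atom outside of \<open>A\<close> would be detected by a Urysohn function that vanishes on \<open>A\<close>.\<close>

lemma comb_support:
  assumes X: "comp_obj X" and A: "closedin X A"
    and J: "finite J" and x: "\<And>j. j \<in> J \<Longrightarrow> x j \<in> topspace X" and \<alpha>: "\<forall>j\<in>J. 0 < \<alpha> j"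
    and vanish: "\<And>\<phi>. \<phi> \<in> cfun X \<Longrightarrow> (\<forall>x\<in>A. \<phi> x = 0) \<Longrightarrow> comb X J \<alpha> x \<phi> \<le> 0"
    and j: "j \<in> J"
  shows "x j \<in> A"
proof (rule ccontr)
  assume "x j \<notin> A"
  then obtain u where u: "u \<in> cfun X" "u (x j) = 1" "\<forall>y\<in>A. u y = 0"
    "\<forall>y\<in>topspace X. 0 \<le> u y \<and> u y \<le> 1"
    using Urysohn_off_closed [OF X A] x [OF j] by blast
  have "\<alpha> j * u (x j) \<le> (\<Sum>i\<in>J. \<alpha> i * u (x i))"
    using J x \<alpha> j u(4) by (intro member_le_sum) (auto simp: less_imp_le)
  then have "0 < comb X J \<alpha> x u"
    using \<alpha> j u(1,2) by (auto simp: comb_apply)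
  then show False
    using vanish [OF u(1,3)] by simp
qed

lemma P_f_restrict:
  assumes X: "comp_obj X" and A: "closedin X A" and \<mu>: "\<mu> \<in> P_f X"
    and vanish: "\<And>\<phi>. \<phi> \<in> cfun X \<Longrightarrow> (\<forall>x\<in>A. \<phi> x = 0) \<Longrightarrow> \<mu> \<phi> \<le> 0"
  shows "\<exists>\<nu>\<in>P_f (subtopology X A). push (subtopology X A) X (comp_incl X A) \<nu> = \<mu>"
proof -
  obtain S \<alpha> x\<^sub>0 where S: "finite S" "S \<subseteq> topspace X" "\<forall>x\<in>S. 0 < \<alpha> x" "sum \<alpha> S = 1"
    "x\<^sub>0 \<in> S" "1 - 1 / (real (card S) + 1) \<le> \<alpha> x\<^sub>0" and \<mu>_eq: "\<mu> = comb X S \<alpha> (\<lambda>x. x)"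
    using \<mu> by (rule P_f_obtain)
  have "x \<in> A" if "x \<in> S" for x
    using S(2) vanish by (intro comb_support [OF X A S(1) _ S(3) _ that]) (auto simp: \<mu>_eq)
  then have sub: "S \<subseteq> topspace (subtopology X A)"
    using S(2) by auto
  have "comb (subtopology X A) S \<alpha> (\<lambda>x. x) \<in> P_f (subtopology X A)"
    using S sub by (rule_tac comb_in_P_f [where j\<^sub>0 = x\<^sub>0]) (auto simp: less_imp_le)
  moreover have "push (subtopology X A) X (comp_incl X A) (comb (subtopology X A) S \<alpha> (\<lambda>x. x)) = \<mu>"
    unfolding \<mu>_eq using push_comb [OF comp_incl_hom, of S "\<lambda>x. x" X A \<alpha>] sub
    by (auto simp: comb_def comp_incl_def subset_iff intro!: restrict_ext sum.cong)
  ultimately show ?thesis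
    by blast
qed

text \<open>The functionals that come from \<open>A\<close>. The inequality passes to every measure below \<open>F\<close>, which by
  \<open>P_f_restrict\<close> then lives on \<open>A\<close>, and \<open>OSf_lift\<close> applies. For \<open>A = {}\<close> both sides are empty.\<close>

lemma functor_sub_OSf:
  assumes X: "comp_obj X" and A: "closedin X A"
  shows "functor_sub OSf OSf_map X A =
    {F \<in> OSf_set X. \<forall>\<phi>\<in>cfun X. (\<forall>x\<in>A. \<phi> x = 0) \<longrightarrow> F \<phi> \<le> 0}"
proof -
  define XA where "XA = subtopology X A"
  have XA: "comp_obj XA"
    unfolding XA_def by (rule comp_obj_subtopology [OF X A])
  have i: "comp_incl X A \<in> comp_hom XA X"
    unfolding XA_def by (rule comp_incl_hom)
  have "functor_sub OSf OSf_map X A = push XA X (comp_incl X A) ` OSf_set XA"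
    unfolding functor_sub_def XA_def [symmetric] topspace_OSf [OF XA]
    by (intro image_cong refl OSf_map_apply [OF XA])
  also have "\<dots> = {F \<in> OSf_set X. \<forall>\<phi>\<in>cfun X. (\<forall>x\<in>A. \<phi> x = 0) \<longrightarrow> F \<phi> \<le> 0}"
  proof (intro equalityI subsetI CollectI conjI ballI impI)
    fix F assume "F \<in> push XA X (comp_incl X A) ` OSf_set XA"
    then obtain G where G: "G \<in> OSf_set XA" "F = push XA X (comp_incl X A) G"
      by blast
    show "F \<in> OSf_set X"
      unfolding G(2) by (rule push_OSf_set [OF XA X i G(1)])
    fix \<phi> assume \<phi>: "\<phi> \<in> cfun X" "\<forall>x\<in>A. \<phi> x = 0"
    have "(\<lambda>x\<in>topspace XA. \<phi> (comp_incl X A x)) = (\<lambda>x\<in>topspace XA. 0)"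
      using \<phi>(2) by (intro restrict_ext) (simp add: comp_incl_def XA_def)
    then show "F \<phi> \<le> 0"
      by (simp add: G(2) push_apply [OF \<phi>(1)] OSf_const [OF XA G(1)])
  next
    fix F assume "F \<in> {F \<in> OSf_set X. \<forall>\<phi>\<in>cfun X. (\<forall>x\<in>A. \<phi> x = 0) \<longrightarrow> F \<phi> \<le> 0}"
    then have F: "F \<in> OSf_set X" and vanish: "\<And>\<phi>. \<phi> \<in> cfun X \<Longrightarrow> \<forall>x\<in>A. \<phi> x = 0 \<Longrightarrow> F \<phi> \<le> 0"
      by auto
    have "\<exists>G\<in>OSf_set XA. push XA X (comp_incl X A) G = F"
    proof (rule OSf_lift [OF XA i OSf_ext [OF F]])
      fix \<phi> assume \<phi>: "\<phi> \<in> cfun X"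
      obtain \<mu> where \<mu>: "\<mu> \<in> P_f X" "\<mu> \<phi> = F \<phi>" "below X \<mu> F"
        using OSf_attained [OF X F \<phi>] by blast
      have "\<exists>\<nu>\<in>P_f XA. push XA X (comp_incl X A) \<nu> = \<mu>"
        unfolding XA_def
        using belowD [OF \<mu>(3)] vanish by (intro P_f_restrict [OF X A \<mu>(1)]) (meson order_trans)
      with \<mu> show "\<exists>\<nu>\<in>P_f XA. push XA X (comp_incl X A) \<nu> \<phi> = F \<phi> \<and>
          below X (push XA X (comp_incl X A) \<nu>) F"
        by auto
    qed
    then show "F \<in> push XA X (comp_incl X A) ` OSf_set XA"
      by auto
  qed
  finally show ?thesis .
qed

text \<open>A measure below a functional that comes from each \<open>A \<in> \<A>\<close> has all its atoms in each \<open>A\<close>.\<close>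

theorem OSf_preserves_intersections:
  "functor_preserves_intersections (OSf :: 'a topology \<Rightarrow> _) OSf_map"
  unfolding functor_preserves_intersections_def
proof (intro allI impI)
  fix X :: "'a topology" and \<A>
  assume X: "comp_obj X" and \<A>: "\<forall>A\<in>\<A>. closedin X A"
  let ?B = "topspace X \<inter> \<Inter>\<A>"
  have B: "closedin X ?B"
    using \<A> closedin_Inter [of "insert (topspace X) \<A>" X] by auto
  show "functor_sub OSf OSf_map X ?B = topspace (OSf X) \<inter> (\<Inter>A\<in>\<A>. functor_sub OSf OSf_map X A)"
  proof (intro equalityI subsetI)
    fix F assume "F \<in> functor_sub OSf OSf_map X ?B"
    then show "F \<in> topspace (OSf X) \<inter> (\<Inter>A\<in>\<A>. functor_sub OSf OSf_map X A)"
      using \<A> by (auto simp: functor_sub_OSf X B)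
  next
    fix F assume "F \<in> topspace (OSf X) \<inter> (\<Inter>A\<in>\<A>. functor_sub OSf OSf_map X A)"
    then have F: "F \<in> OSf_set X"
      and vanish: "\<And>A \<phi>. A \<in> \<A> \<Longrightarrow> \<phi> \<in> cfun X \<Longrightarrow> \<forall>x\<in>A. \<phi> x = 0 \<Longrightarrow> F \<phi> \<le> 0"
      using \<A> by (auto simp: functor_sub_OSf X)
    have "F \<phi> \<le> 0" if \<phi>: "\<phi> \<in> cfun X" "\<forall>x\<in>?B. \<phi> x = 0" for \<phi>
    proof -
      obtain \<mu> where \<mu>: "\<mu> \<in> P_f X" "\<mu> \<phi> = F \<phi>" "below X \<mu> F"
        using OSf_attained [OF X F \<phi>(1)] by blast
      obtain S \<alpha> x\<^sub>0 where S: "finite S" "S \<subseteq> topspace X" "\<forall>x\<in>S. 0 < \<alpha> x" "sum \<alpha> S = 1"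
        "x\<^sub>0 \<in> S" "1 - 1 / (real (card S) + 1) \<le> \<alpha> x\<^sub>0" and \<mu>_eq: "\<mu> = comb X S \<alpha> (\<lambda>x. x)"
        using \<mu>(1) by (rule P_f_obtain)
      have "x \<in> A" if x: "x \<in> S" and A: "A \<in> \<A>" for x A
      proof (rule comb_support [OF X _ S(1) _ S(3) _ x])
        show "closedin X A"
          using \<A> A by blast
        show "comb X S \<alpha> (\<lambda>x. x) \<psi> \<le> 0" if \<psi>: "\<psi> \<in> cfun X" "\<forall>x\<in>A. \<psi> x = 0" for \<psi>
          using belowD [OF \<mu>(3) \<psi>(1)] vanish [OF A \<psi>] unfolding \<mu>_eq by linarith
      qed (use S(2) in blast)
      then have "\<forall>x\<in>S. \<phi> x = 0"
        using S(2) \<phi>(2) by blast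
      then have "\<mu> \<phi> = 0"
        by (simp add: \<mu>_eq comb_apply [OF \<phi>(1)])
      with \<mu>(2) show ?thesis
        by simp
    qed
    with F show "F \<in> functor_sub OSf OSf_map X ?B"
      by (simp add: functor_sub_OSf X B)
  qed
qed

text \<open>If \<open>\<mu>\<close> lies below \<open>F\<close>, its image lies below the image of \<open>F\<close>; when the latter comes from \<open>B\<close>, the
  atoms of \<open>\<mu>\<close> are mapped into \<open>B\<close>. No cancellation can occur, because all weights are positive.\<close>

theorem OSf_preserves_preimages:
  "functor_preserves_preimages
     (OSf :: 'a topology \<Rightarrow> _) (OSf :: 'b topology \<Rightarrow> _) OSf_map OSf_map OSf_map"
  unfolding functor_preserves_preimages_def
proof (intro allI impI)
  fix X :: "'a topology" and Y :: "'b topology" and f B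
  assume X: "comp_obj X" and Y: "comp_obj Y" and f: "f \<in> comp_hom X Y" and B: "closedin Y B"
  let ?A = "{x \<in> topspace X. f x \<in> B}"
  have A: "closedin X ?A"
    by (rule closedin_continuous_map_preimage [OF comp_hom_cont [OF f] B])
  show "functor_sub OSf OSf_map X ?A =
      {F \<in> topspace (OSf X). OSf_map X Y f F \<in> functor_sub OSf OSf_map Y B}"
  proof (intro equalityI subsetI)
    fix F assume "F \<in> functor_sub OSf OSf_map X ?A"
    then have F: "F \<in> OSf_set X"
      and vanish: "\<And>\<phi>. \<phi> \<in> cfun X \<Longrightarrow> \<forall>x\<in>?A. \<phi> x = 0 \<Longrightarrow> F \<phi> \<le> 0"
      by (auto simp: functor_sub_OSf X A)
    have "push X Y f F \<phi> \<le> 0" if "\<phi> \<in> cfun Y" "\<forall>y\<in>B. \<phi> y = 0" for \<phi>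
      using vanish [OF cfun_comp [OF f that(1)]] that(2) by (simp add: push_apply [OF that(1)])
    then show "F \<in> {F \<in> topspace (OSf X). OSf_map X Y f F \<in> functor_sub OSf OSf_map Y B}"
      using F push_OSf_set [OF X Y f F] by (simp add: X functor_sub_OSf Y B OSf_map_apply)
  next
    fix F assume "F \<in> {F \<in> topspace (OSf X). OSf_map X Y f F \<in> functor_sub OSf OSf_map Y B}"
    then have F: "F \<in> OSf_set X"
      and vanish: "\<And>\<phi>. \<phi> \<in> cfun Y \<Longrightarrow> \<forall>y\<in>B. \<phi> y = 0 \<Longrightarrow> push X Y f F \<phi> \<le> 0"
      by (auto simp: X functor_sub_OSf Y B OSf_map_apply)
    have "F \<phi> \<le> 0" if \<phi>: "\<phi> \<in> cfun X" "\<forall>x\<in>?A. \<phi> x = 0" for \<phi>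
    proof -
      obtain \<mu> where \<mu>: "\<mu> \<in> P_f X" "\<mu> \<phi> = F \<phi>" "below X \<mu> F"
        using OSf_attained [OF X F \<phi>(1)] by blast
      obtain S \<alpha> x\<^sub>0 where S: "finite S" "S \<subseteq> topspace X" "\<forall>x\<in>S. 0 < \<alpha> x" "sum \<alpha> S = 1"
        "x\<^sub>0 \<in> S" "1 - 1 / (real (card S) + 1) \<le> \<alpha> x\<^sub>0" and \<mu>_eq: "\<mu> = comb X S \<alpha> (\<lambda>x. x)"
        using \<mu>(1) by (rule P_f_obtain)
      have push_\<mu>: "push X Y f \<mu> = comb Y S \<alpha> f"
        unfolding \<mu>_eq using S(2) by (intro push_comb [OF f]) blast
      have "f x \<in> B" if x: "x \<in> S" for x
      proof (rule comb_support [OF Y B S(1) _ S(3) _ x])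
        show "f y \<in> topspace Y" if "y \<in> S" for y
          using comp_hom_in [OF f] S(2) that by blast
        show "comb Y S \<alpha> f \<psi> \<le> 0" if \<psi>: "\<psi> \<in> cfun Y" "\<forall>y\<in>B. \<psi> y = 0" for \<psi>
          using belowD [OF push_below [OF f \<mu>(3)] \<psi>(1)] vanish [OF \<psi>] unfolding push_\<mu> by linarith
      qed
      then have "\<forall>x\<in>S. \<phi> x = 0"
        using S(2) \<phi>(2) by blast
      then have "\<mu> \<phi> = 0"
        by (simp add: \<mu>_eq comb_apply [OF \<phi>(1)])
      with \<mu>(2) show ?thesis
        by simp
    qed
    with F show "F \<in> functor_sub OSf OSf_map X ?A"
      by (simp add: functor_sub_OSf X A)
  qed
qed

theorem OSf_preserves_point_and_empty:
  "functor_preserves_point_and_empty (OSf :: 'a topology \<Rightarrow> _)"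
  unfolding functor_preserves_point_and_empty_def
proof (intro conjI allI impI)
  fix X :: "'a topology" assume "\<exists>x. topspace X = {x}"
  then obtain x where x: "topspace X = {x}"
    by blast
  have X: "comp_obj X"
    by (auto simp: comp_obj_def Hausdorff_space_def x compact_space_def intro: finite_imp_compactin)
  have dirac: "\<mu> \<phi> = \<phi> x" if "\<mu> \<in> P_f X" "\<phi> \<in> cfun X" for \<mu> \<phi>
  proof -
    have "\<phi> = (\<lambda>y\<in>topspace X. \<phi> x)"
      by (rule cfun_eqI [OF that(2) cfun_const]) (simp add: x)
    then show ?thesis
      using P_const that(1) P_f_sub_P_set by (metis subsetD)
  qed
  have "dirac X x \<in> OSf_set X"
    by (rule dirac_in_OSf_set [OF X]) (simp add: x)
  moreover have "F = dirac X x" if F: "F \<in> OSf_set X" for F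
    using OSf_attained [OF X F] dirac OSf_ext [OF F]
    by (intro functional_eqI [of _ X]) (auto simp: dirac_def, metis)
  ultimately have "topspace (OSf X) = {dirac X x}"
    unfolding topspace_OSf [OF X] by blast
  then show "\<exists>\<mu>. topspace (OSf X) = {\<mu>}"
    by blast
next
  fix X :: "'a topology" assume e: "topspace X = {}"
  then have X: "comp_obj X"
    by (simp add: comp_obj_def Hausdorff_space_def compact_space_def)
  have "P_f X = {}"
    unfolding P_f_def by (auto simp: e)
  then have "OSf_set X = {}"
    using OSf_attained [OF X _ cfun_const] by blast
  then show "topspace (OSf X) = {}"
    using X by simp
qed



section \<open>Uniform approximation of functions\<close>

text \<open>Uniform density, by functions from below; the one-sided form is preserved by finite maxima.\<close>

definition approximating :: "'a topology \<Rightarrow> ('a \<Rightarrow> real) set \<Rightarrow> bool" where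
  "approximating X D \<longleftrightarrow> D \<subseteq> cfun X \<and>
     (\<forall>\<phi>\<in>cfun X. \<forall>e>0. \<exists>g\<in>D. \<forall>y\<in>topspace X. g y \<le> \<phi> y \<and> \<phi> y < g y + e)"

text \<open>A Stone--Weierstrass theorem that uses only maxima. Around each point \<open>x\<close> there is a function
  in \<open>D\<close> that lies below \<open>\<phi>\<close> everywhere and is close to it at \<open>x\<close>: take in \<open>sep\<close> a value \<open>b\<close> slightly
  less than \<open>\<phi> x\<close>, a neighbourhood where \<open>\<phi>\<close> stays above \<open>b\<close>, and for \<open>a\<close> a lower bound of \<open>\<phi>\<close>. By
  compactness a finite maximum of such functions is close to \<open>\<phi>\<close> at all points. Only rational \<open>a\<close> and
  \<open>b\<close> are needed, which keeps \<open>D\<close> small in the application to weight.\<close>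

lemma approximating_if_max_closed:
  assumes X: "comp_obj X" and D: "D \<subseteq> cfun X" "D \<noteq> {}"
    and max: "\<And>g h. g \<in> D \<Longrightarrow> h \<in> D \<Longrightarrow> (\<lambda>x\<in>topspace X. max (g x) (h x)) \<in> D"
    and sep: "\<And>x V a b. \<lbrakk>x \<in> topspace X; openin X V; x \<in> V; a \<in> \<rat>; b \<in> \<rat>; a \<le> b\<rbrakk> \<Longrightarrow>
      \<exists>g\<in>D. g x = b \<and> (\<forall>y\<in>topspace X. g y \<le> b) \<and> (\<forall>y\<in>topspace X - V. g y \<le> a)"
  shows "approximating X D"
  unfolding approximating_def
proof (intro conjI ballI allI impI D(1))
  fix \<phi> and e :: real assume \<phi>: "\<phi> \<in> cfun X" and e: "0 < e"
  show "\<exists>g\<in>D. \<forall>y\<in>topspace X. g y \<le> \<phi> y \<and> \<phi> y < g y + e"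
  proof (cases "topspace X = {}")
    case True
    with D(2) show ?thesis by auto
  next
    case False
    obtain M where M: "\<And>y. y \<in> topspace X \<Longrightarrow> \<bar>\<phi> y\<bar> \<le> M"
      using cfun_bounded [OF X \<phi>] by blast
    have "\<exists>g\<in>D. (\<forall>y\<in>topspace X. g y \<le> \<phi> y) \<and> \<phi> x < g x + e" if x: "x \<in> topspace X" for x
    proof -
      obtain b where b: "b \<in> \<rat>" "\<phi> x - e < b" "b < \<phi> x - e / 2"
        using Rats_dense_in_real [of "\<phi> x - e" "\<phi> x - e / 2"] e by auto
      have "min b (- M) - 1 < min b (- M)"
        by linarith
      then obtain a where a: "a \<in> \<rat>" "a < min b (- M)"
        using Rats_dense_in_real by blast
      let ?V = "{y \<in> topspace X. \<phi> x - e / 2 < \<phi> y}"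
      have "openin X ?V"
        by (rule openin_Collect_less) (simp_all add: cfunD [OF \<phi>])
      then obtain g where g: "g \<in> D" "g x = b" "\<And>y. y \<in> topspace X \<Longrightarrow> g y \<le> b"
        "\<And>y. y \<in> topspace X - ?V \<Longrightarrow> g y \<le> a"
        using sep [of x ?V a b] x a b e by auto
      have "g y \<le> \<phi> y" if y: "y \<in> topspace X" for y
      proof (cases "y \<in> ?V")
        case True
        then show ?thesis using g(3) [OF y] b(3) by auto
      next
        case False
        then have "g y \<le> a" using g(4) y by blast
        then show ?thesis using a(2) M [OF y] by linarith
      qed
      with g b(2) show ?thesis by (intro bexI [of _ g]) auto
    qed
    then obtain g where g: "\<And>x. x \<in> topspace X \<Longrightarrow> g x \<in> D"
      "\<And>x y. x \<in> topspace X \<Longrightarrow> y \<in> topspace X \<Longrightarrow> g x y \<le> \<phi> y"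
      "\<And>x. x \<in> topspace X \<Longrightarrow> \<phi> x < g x x + e"
      by metis
    have "\<exists>T. finite T \<and> T \<subseteq> topspace X \<and> \<not> (\<exists>y\<in>topspace X. \<forall>x\<in>T. g x y \<le> \<phi> y - e)"
    proof (rule ccontr)
      assume *: "\<nexists>T. finite T \<and> T \<subseteq> topspace X \<and> \<not> (\<exists>y\<in>topspace X. \<forall>x\<in>T. g x y \<le> \<phi> y - e)"
      have "\<exists>y\<in>topspace X. \<forall>x\<in>topspace X. g x y \<le> \<phi> y - e"
      proof (rule compactin_common_point)
        show "compactin X (topspace X)"
          using X by (simp add: comp_obj_def compact_space_def)
        show "closedin X {y \<in> topspace X. g x y \<le> \<phi> y - e}" if "x \<in> topspace X" for x
          using g(1) [OF that] D(1) \<phi>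
          by (intro closedin_Collect_le continuous_map_diff) (auto simp: cfunD)
      qed (use * in blast)
      then show False
        using g(3) by force
    qed
    then obtain T where T: "finite T" "T \<subseteq> topspace X"
      "\<And>y. y \<in> topspace X \<Longrightarrow> \<exists>x\<in>T. \<phi> y < g x y + e"
      by (force simp: not_le)
    have "\<exists>h\<in>D. (\<forall>y\<in>topspace X. h y \<le> \<phi> y) \<and> (\<forall>x\<in>T. \<forall>y\<in>topspace X. g x y \<le> h y)"
      using T(1,2)
    proof (induction T)
      case empty
      obtain x where "x \<in> topspace X"
        using False by blast
      with g(1,2) show ?case by auto
    next
      case (insert x T)
      then obtain h where h: "h \<in> D" "\<forall>y\<in>topspace X. h y \<le> \<phi> y"
        "\<forall>x\<in>T. \<forall>y\<in>topspace X. g x y \<le> h y"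
        by auto
      have x: "x \<in> topspace X"
        using insert.prems by simp
      show ?case
        using max [OF h(1) g(1) [OF x]] h(2,3) g(2) [OF x]
        by (intro bexI [of _ "\<lambda>y\<in>topspace X. max (h y) (g x y)"]) (auto simp: le_max_iff_disj)
    qed
    with T(3) show ?thesis
      by (meson add_le_cancel_right order_less_le_trans)
  qed
qed

lemma OSf_close:
  assumes "comp_obj X" "F \<in> OSf_set X" "\<phi> \<in> cfun X" "\<psi> \<in> cfun X"
    and "\<And>x. x \<in> topspace X \<Longrightarrow> \<phi> x \<le> \<psi> x + e"
  shows "F \<phi> \<le> F \<psi> + e"
proof -
  have "F \<phi> \<le> F (\<lambda>x\<in>topspace X. \<psi> x + e)"
    by (rule OSf_mono [OF assms(1-3) cfun_add_const [OF assms(4)]]) (simp add: assms(5))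
  then show ?thesis
    by (simp add: OSf_add_const [OF assms(1,2,4)])
qed

lemma approximatingE:
  assumes "comp_obj X" "approximating X D" "\<phi> \<in> cfun X" "0 < e"
  obtains g where "g \<in> D" "\<forall>F\<in>OSf_set X. F g \<le> F \<phi> \<and> F \<phi> \<le> F g + e"
proof -
  obtain g where g: "g \<in> D" "g \<in> cfun X" "\<And>y. y \<in> topspace X \<Longrightarrow> g y \<le> \<phi> y"
    "\<And>y. y \<in> topspace X \<Longrightarrow> \<phi> y \<le> g y + e"
    using assms(2-4) unfolding approximating_def by (metis less_imp_le subsetD)
  show thesis
  proof (rule that [OF g(1)], intro ballI conjI)
    fix F assume F: "F \<in> OSf_set X"
    show "F g \<le> F \<phi>"
      by (rule OSf_mono [OF assms(1) F g(2) assms(3) g(3)])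
    show "F \<phi> \<le> F g + e"
      by (rule OSf_close [OF assms(1) F assms(3) g(2,4)])
  qed
qed

lemma OSf_eqI_approximating:
  assumes X: "comp_obj X" and D: "approximating X D" and F: "F \<in> OSf_set X" and G: "G \<in> OSf_set X"
    and eq: "\<And>g. g \<in> D \<Longrightarrow> F g = G g"
  shows "F = G"
proof (rule functional_eqI [OF OSf_ext [OF F] OSf_ext [OF G]])
  fix \<phi> assume \<phi>: "\<phi> \<in> cfun X"
  have "F \<phi> \<le> G \<phi> + e \<and> G \<phi> \<le> F \<phi> + e" if e: "0 < e" for e
  proof -
    obtain g where g: "g \<in> D" "\<forall>F\<in>OSf_set X. F g \<le> F \<phi> \<and> F \<phi> \<le> F g + e"
      by (rule approximatingE [OF X D \<phi> e])
    show ?thesis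
      using eq [OF g(1)] bspec [OF g(2) F] bspec [OF g(2) G] by linarith
  qed
  note near = this
  have "F \<phi> \<le> G \<phi>"
    by (rule field_le_epsilon) (use near in blast)
  moreover have "G \<phi> \<le> F \<phi>"
    by (rule field_le_epsilon) (use near in blast)
  ultimately show "F \<phi> = G \<phi>"
    by (rule antisym)
qed


section \<open>Weight\<close>

lemma is_base_iff:
  "is_base B X \<longleftrightarrow> (\<forall>V\<in>B. openin X V) \<and> (\<forall>U x. openin X U \<and> x \<in> U \<longrightarrow> (\<exists>V\<in>B. x \<in> V \<and> V \<subseteq> U))"
  unfolding is_base_def openin_topology_base_unique by blast

lemma lepoll_iff_ordLeq: "A \<lesssim> B \<longleftrightarrow> (card_of A, card_of B) \<in> ordLeq"
  unfolding lepoll_def card_of_ordLeq ..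

lemma Times_lepoll:
  assumes "infinite C" "A \<lesssim> C" "B \<lesssim> C"
  shows "A \<times> B \<lesssim> C"
proof -
  have "C \<times> C \<approx> C"
    using card_of_Times_same_infinite [OF assms(1)] by (simp add: eqpoll_iff_card_of_ordIso)
  with times_lepoll_mono [OF assms(2,3)] show ?thesis
    using lepoll_trans2 by blast
qed

lemma countable_lepoll_infinite:
  assumes "countable A" "infinite C"
  shows "A \<lesssim> C"
proof -
  have "A \<lesssim> (UNIV :: nat set)"
    using assms(1) unfolding countable_def lepoll_def by auto
  then show ?thesis
    using assms(2) infinite_le_lepoll lepoll_trans by blast
qed

lemma Fpow_lepoll:
  assumes C: "infinite C" and A: "A \<lesssim> C"
  shows "Fpow A \<lesssim> C"
proof -
  define S where "S n = {T. finite T \<and> T \<subseteq> A \<and> card T = n}" for n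
  have "S n \<lesssim> C" for n
  proof (induction n)
    case 0
    have "S 0 = {{}}"
      by (auto simp: S_def)
    then show ?case
      using C countable_lepoll_infinite [of "S 0"] by simp
  next
    case (Suc n)
    have "S (Suc n) \<subseteq> (\<lambda>(a, T). insert a T) ` (A \<times> S n)"
    proof
      fix T assume "T \<in> S (Suc n)"
      then have T: "finite T" "T \<subseteq> A" "card T = Suc n"
        by (auto simp: S_def)
      then obtain a T' where "T = insert a T'" "a \<notin> T'" "card T' = n" "finite T'"
        by (metis card_Suc_eq_finite)
      with T show "T \<in> (\<lambda>(a, T). insert a T) ` (A \<times> S n)"
        by (intro image_eqI [of _ _ "(a, T')"]) (auto simp: S_def)
    qed
    then have "S (Suc n) \<lesssim> A \<times> S n"
      by (rule subset_image_lepoll)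
    also have "\<dots> \<lesssim> C"
      by (rule Times_lepoll [OF C A Suc])
    finally show ?case .
  qed
  then have "(\<Union>n. S n) \<lesssim> C"
    using card_of_UNION_ordLeq_infinite [of C UNIV S] C countable_lepoll_infinite [of "UNIV :: nat set" C]
    by (simp add: lepoll_iff_ordLeq)
  moreover have "Fpow A = (\<Union>n. S n)"
    by (auto simp: Fpow_def S_def)
  ultimately show ?thesis
    by simp
qed

lemma infinite_base:
  assumes B: "is_base B X" and X: "Hausdorff_space X" "infinite (topspace X)"
  shows "infinite B"
proof
  assume "finite B"
  have "U \<in> Union ` Pow B" if U: "openin X U" for U
  proof -
    have "U = \<Union>{V \<in> B. V \<subseteq> U}"
      using U B unfolding is_base_iff by blast
    then show ?thesis
      by blast
  qed
  moreover have "openin X (topspace X - {x})" if "x \<in> topspace X" for x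
    using closedin_Hausdorff_singleton [OF X(1) that] by blast
  ultimately have "(\<lambda>x. topspace X - {x}) ` topspace X \<subseteq> Union ` Pow B"
    by blast
  then have "finite ((\<lambda>x. topspace X - {x}) ` topspace X)"
    using \<open>finite B\<close> by (meson finite_Pow_iff finite_imageI finite_subset)
  moreover have "inj_on (\<lambda>x. topspace X - {x}) (topspace X)"
    by (rule inj_onI) blast
  ultimately show False
    using X(2) finite_imageD by blast
qed

lemma continuous_map_dirac: "comp_obj X \<Longrightarrow> continuous_map X (OSf X) (dirac X)"
  unfolding OSf_eq continuous_map_in_subtopology continuous_map_componentwise
  by (auto simp: dirac_def dirac_in_OSf_set [unfolded dirac_def] cfunD)

text \<open>\<open>X\<close> embeds into \<open>OSf X\<close> through Dirac measures: the Urysohn function \<open>u\<close> gives the open set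
  \<open>{F. 0 < F u}\<close>, which meets the image of \<open>X\<close> inside that of \<open>U\<close>.\<close>

lemma base_from_OSf:
  assumes X: "comp_obj X" and B: "is_base B (OSf X)"
  shows "is_base ((\<lambda>W. {x \<in> topspace X. dirac X x \<in> W}) ` B) X"
  unfolding is_base_iff
proof (intro conjI ballI allI impI)
  fix V assume "V \<in> (\<lambda>W. {x \<in> topspace X. dirac X x \<in> W}) ` B"
  then show "openin X V"
    using B openin_continuous_map_preimage [OF continuous_map_dirac [OF X]] by (auto simp: is_base_iff)
next
  fix U x assume U: "openin X U \<and> x \<in> U"
  then have x: "x \<in> topspace X"
    using openin_subset by blast
  have "closedin X (topspace X - U)"
    using U by blast
  then obtain u where u: "u \<in> cfun X" "u x = 1" "\<forall>y\<in>topspace X - U. u y = 0"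
    "\<forall>y\<in>topspace X. 0 \<le> u y \<and> u y \<le> 1"
    by (rule Urysohn_off_closed [OF X _ x]) (use U in auto)
  let ?O = "{F \<in> topspace (OSf X). 0 < F u}"
  have "openin (OSf X) ?O"
    unfolding OSf_eq [OF X]
    by (intro openin_Collect_less continuous_map_from_subtopology continuous_map_eval u(1)) simp
  moreover have "dirac X x \<in> ?O"
    using dirac_in_OSf_set [OF X x] u by (simp add: X dirac_def)
  ultimately obtain W where W: "W \<in> B" "dirac X x \<in> W" "W \<subseteq> ?O"
    using B unfolding is_base_iff by blast
  have "y \<in> U" if "y \<in> topspace X" "dirac X y \<in> W" for y
  proof (rule ccontr)
    assume "y \<notin> U"
    then have "u y = 0"
      using u(3) that(1) by blast
    moreover have "0 < dirac X y u"
      using W(3) that(2) by blast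
    ultimately show False
      using u(1) by (simp add: dirac_def)
  qed
  with W x show "\<exists>V\<in>(\<lambda>W. {x \<in> topspace X. dirac X x \<in> W}) ` B. x \<in> V \<and> V \<subseteq> U"
    by (intro bexI [of _ "{x \<in> topspace X. dirac X x \<in> W}"]) auto
qed

text \<open>For each pair of basic open sets that can be separated fix one separating function \<open>u\<close>, and let
  \<open>D\<close> consist of the finite maxima of the functions \<open>a + (b - a) * u\<close> with rational \<open>a\<close>, \<open>b\<close>.\<close>

lemma small_approximating_set:
  assumes X: "comp_obj X" and B: "is_base B X" "infinite B"
  obtains D where "approximating X D" "D \<lesssim> B"
proof -
  define sep where "sep p w \<longleftrightarrow> w \<in> cfun X \<and> (\<forall>y\<in>topspace X. w y \<le> 1) \<and> (\<forall>y\<in>fst p. w y = 1) \<and>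
    (\<forall>y\<in>topspace X - snd p. w y \<le> 0)" for p :: "'a set \<times> 'a set" and w
  define u where "u p = (if \<exists>w. sep p w then SOME w. sep p w else (\<lambda>x\<in>topspace X. 0))" for p
  have u: "sep p (u p)" if "sep p w" for p w
  proof -
    have "\<exists>w. sep p w"
      using that by blast
    then show ?thesis
      unfolding u_def by (simp add: someI_ex)
  qed
  have u_cfun: "u p \<in> cfun X" for p
  proof (cases "\<exists>w. sep p w")
    case True
    then have "sep p (u p)"
      using u by blast
    then show ?thesis
      by (simp add: sep_def)
  qed (simp add: u_def)
  define h where "h = (\<lambda>(p, a, b) x. a + (b - a) * u p x)"
  have h_cont: "continuous_map X euclideanreal (h i)" for i
  proof -
    have "continuous_map X euclideanreal (\<lambda>x. a + (b - a) * u p x)" for a b p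
      using cfunD [OF u_cfun [of p]] by (intro continuous_map_add continuous_map_real_mult_left) auto
    then show ?thesis
      by (simp add: h_def case_prod_beta)
  qed
  define I where "I = (B \<times> B) \<times> (\<rat> \<times> \<rat> :: (real \<times> real) set)"
  define m where "m T = (\<lambda>x\<in>topspace X. Max ((\<lambda>i. h i x) ` T))" for T
  define D where "D = m ` {T \<in> Fpow I. T \<noteq> {}}"
  have "I \<lesssim> B"
    unfolding I_def
    using countable_lepoll_infinite [OF countable_rat B(2)]
    by (intro Times_lepoll [OF B(2)] lepoll_refl)
  then have "Fpow I \<lesssim> B"
    by (rule Fpow_lepoll [OF B(2)])
  have "D \<lesssim> {T \<in> Fpow I. T \<noteq> {}}"
    unfolding D_def by (rule image_lepoll)
  also have "\<dots> \<lesssim> Fpow I"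
    by (rule subset_imp_lepoll) blast
  also note \<open>Fpow I \<lesssim> B\<close>
  finally have "D \<lesssim> B" .
  moreover have "approximating X D"
  proof (rule approximating_if_max_closed [OF X])
    have "continuous_map X euclideanreal (\<lambda>x. Max ((\<lambda>i. h i x) ` T))" if "finite T" "T \<noteq> {}" for T
      using that
    proof (induction T rule: finite_ne_induct)
      case (insert i T)
      then show ?case
        by (simp add: h_cont continuous_map_real_max)
    qed (simp add: h_cont)
    then show "D \<subseteq> cfun X"
      by (auto simp: D_def m_def Fpow_def intro!: cfunI)
    obtain V where "V \<in> B"
      using B(2) by (metis finite.emptyI ex_in_conv)
    then have "{((V, V), 0, 0)} \<in> {T \<in> Fpow I. T \<noteq> {}}"
      by (simp add: I_def Fpow_def)
    then show "D \<noteq> {}"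
      unfolding D_def by blast
  next
    fix f g assume "f \<in> D" "g \<in> D"
    then obtain S T where ST: "S \<in> Fpow I" "S \<noteq> {}" "f = m S" "T \<in> Fpow I" "T \<noteq> {}" "g = m T"
      by (auto simp: D_def)
    have "(\<lambda>x\<in>topspace X. max (f x) (g x)) = m (S \<union> T)"
      unfolding m_def ST(3,6)
      by (rule restrict_ext) (use ST in \<open>simp add: image_Un Max_Un Fpow_def\<close>)
    moreover have "S \<union> T \<in> {T \<in> Fpow I. T \<noteq> {}}"
      using ST by (auto simp: Fpow_def)
    ultimately show "(\<lambda>x\<in>topspace X. max (f x) (g x)) \<in> D"
      unfolding D_def by blast
  next
    fix x V and a b :: real
    assume x: "x \<in> topspace X" "openin X V" "x \<in> V" and ab: "a \<in> \<rat>" "b \<in> \<rat>" "a \<le> b"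
    obtain V' where V': "V' \<in> B" "x \<in> V'" "V' \<subseteq> V"
      using B(1) x unfolding is_base_iff by blast
    have "openin X V'"
      using B(1) V'(1) unfolding is_base_iff by blast
    then have "closedin X (topspace X - V')"
      by blast
    then obtain w where w: "w \<in> cfun X" "w x = 1" "\<forall>y\<in>topspace X - V'. w y = 0"
      "\<forall>y\<in>topspace X. 0 \<le> w y \<and> w y \<le> 1"
      by (rule Urysohn_off_closed [OF X _ x(1)]) (use V'(2) in auto)
    have "openin X {y \<in> topspace X. 1 / 2 < w y}"
      by (rule openin_Collect_less) (simp_all add: cfunD [OF w(1)])
    then obtain U where U: "U \<in> B" "x \<in> U" "U \<subseteq> {y \<in> topspace X. 1 / 2 < w y}"
      using B(1) x(1) w(2) unfolding is_base_iff by force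
    \<comment> \<open>Rescaling \<open>w\<close> makes it equal to \<open>1\<close> on a neighbourhood, not just at \<open>x\<close>.\<close>
    have "sep (U, V') (\<lambda>y\<in>topspace X. min 1 (2 * w y))"
      unfolding sep_def
    proof (intro conjI)
      show "(\<lambda>y\<in>topspace X. min 1 (2 * w y)) \<in> cfun X"
        using cfunD [OF w(1)] by (intro cfunI continuous_map_real_min continuous_map_real_mult_left) auto
    qed (use U w(3) in auto)
    then have s: "sep (U, V') (u (U, V'))"
      by (rule u)
    let ?i = "((U, V'), a, b)"
    have hx: "m {?i} y = a + (b - a) * u (U, V') y" if "y \<in> topspace X" for y
      using that by (simp add: m_def h_def)
    have "?i \<in> I"
      using U V' ab by (simp add: I_def)
    then have "m {?i} \<in> D"
      unfolding D_def by (auto simp: Fpow_def)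
    moreover have "m {?i} x = b"
      using s U(2) x(1) by (simp add: hx sep_def)
    moreover have "m {?i} y \<le> b" if "y \<in> topspace X" for y
    proof -
      have "(b - a) * u (U, V') y \<le> (b - a) * 1"
        using s that ab(3) by (intro mult_left_mono) (auto simp: sep_def)
      then show ?thesis
        by (simp add: hx [OF that])
    qed
    moreover have "m {?i} y \<le> a" if "y \<in> topspace X - V" for y
    proof -
      have "u (U, V') y \<le> 0"
        using s that V'(3) by (auto simp: sep_def)
      then have "(b - a) * u (U, V') y \<le> 0"
        using ab(3) by (intro mult_nonneg_nonpos) auto
      then show ?thesis
        using that by (simp add: hx)
    qed
    ultimately show "\<exists>g\<in>D. g x = b \<and> (\<forall>y\<in>topspace X. g y \<le> b) \<and> (\<forall>y\<in>topspace X - V. g y \<le> a)"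
      by blast
  qed
  ultimately show thesis
    using that by blast
qed

text \<open>Because \<open>F g \<le> F \<phi> \<le> F g + e / 3\<close> holds for all \<open>F\<close> at once, a condition on \<open>F \<phi>\<close> can be replaced
  by one on \<open>F g\<close> with \<open>g \<in> D\<close> and rational bounds.\<close>

lemma base_of_OSf:
  assumes X: "comp_obj X" and D: "approximating X D"
  shows "is_base ((\<lambda>T. {F \<in> OSf_set X. \<forall>(g, a, b)\<in>T. a < F g \<and> F g < b}) ` Fpow (D \<times> \<rat> \<times> \<rat>)) (OSf X)"
    (is "is_base (?N ` _) _")
  unfolding is_base_iff
proof (intro conjI ballI allI impI)
  fix V assume "V \<in> ?N ` Fpow (D \<times> \<rat> \<times> \<rat>)"
  then obtain T where T: "finite T" "T \<subseteq> D \<times> \<rat> \<times> \<rat>" and V: "V = ?N T"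
    by (auto simp: Fpow_def)
  have "openin (OSf X) {F \<in> topspace (OSf X). \<forall>i\<in>T. case i of (g, a, b) \<Rightarrow> a < F g \<and> F g < b}"
  proof (rule openin_Collect_finite_ball [OF T(1)])
    fix i assume "i \<in> T"
    moreover obtain g a b where i_eq: "i = (g, a, b)"
      by (cases i)
    ultimately have i: "i = (g, a, b)" "g \<in> cfun X"
      using T(2) D by (auto simp: approximating_def)
    have ev: "continuous_map (OSf X) euclideanreal (\<lambda>F. F g)"
      unfolding OSf_eq [OF X] by (rule continuous_map_from_subtopology [OF continuous_map_eval [OF i(2)]])
    have "openin (OSf X) ({F \<in> topspace (OSf X). a < F g} \<inter> {F \<in> topspace (OSf X). F g < b})"
      by (intro openin_Int openin_Collect_less ev) auto
    moreover have "{F \<in> topspace (OSf X). a < F g} \<inter> {F \<in> topspace (OSf X). F g < b} =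
        {F \<in> topspace (OSf X). case i of (g, a, b) \<Rightarrow> a < F g \<and> F g < b}"
      by (auto simp: i)
    ultimately show "openin (OSf X) {F \<in> topspace (OSf X). case i of (g, a, b) \<Rightarrow> a < F g \<and> F g < b}"
      by simp
  qed
  then show "openin (OSf X) V"
    by (simp add: V X)
next
  fix W F assume WF: "openin (OSf X) W \<and> F \<in> W"
  then obtain W' where W': "openin (pw_topology X) W'" "W = W' \<inter> OSf_set X"
    unfolding OSf_eq [OF X] openin_subtopology by blast
  have F: "F \<in> OSf_set X" "F \<in> W'"
    using WF W' by auto
  obtain U where fin: "finite {\<phi> \<in> cfun X. U \<phi> \<noteq> UNIV}" and U: "\<And>\<phi>. \<phi> \<in> cfun X \<Longrightarrow> open (U \<phi>)"
    and FU: "F \<in> Pi\<^sub>E (cfun X) U" "Pi\<^sub>E (cfun X) U \<subseteq> W'"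
    using W'(1) F(2) unfolding openin_product_topology_alt by (auto simp flip: open_openin)
  have "\<exists>i\<in>D \<times> \<rat> \<times> \<rat>. F \<in> ?N {i} \<and> (\<forall>G\<in>?N {i}. G \<phi> \<in> U \<phi>)" if \<phi>: "\<phi> \<in> cfun X" for \<phi>
  proof -
    have "F \<phi> \<in> U \<phi>"
      using FU(1) \<phi> by auto
    then obtain e where e: "0 < e" "\<And>r. \<bar>r - F \<phi>\<bar> < e \<Longrightarrow> r \<in> U \<phi>"
      using U [OF \<phi>] unfolding open_real by blast
    have "0 < e / 3"
      using e(1) by simp
    then obtain g where g: "g \<in> D" "\<forall>G\<in>OSf_set X. G g \<le> G \<phi> \<and> G \<phi> \<le> G g + e / 3"
      by (rule approximatingE [OF X D \<phi>])
    obtain a where a: "a \<in> \<rat>" "F g - e / 3 < a" "a < F g"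
      using Rats_dense_in_real [of "F g - e / 3" "F g"] e(1) by auto
    obtain b where b: "b \<in> \<rat>" "F g < b" "b < F g + e / 3"
      using Rats_dense_in_real [of "F g" "F g + e / 3"] e(1) by auto
    have "G \<phi> \<in> U \<phi>" if G: "G \<in> OSf_set X" "a < G g" "G g < b" for G
      using bspec [OF g(2) F(1)] bspec [OF g(2) G(1)] G a b by (intro e(2)) linarith
    with g(1) a b F(1) show ?thesis
      by (intro bexI [of _ "(g, a, b)"]) auto
  qed
  then have "\<forall>\<phi>\<in>cfun X. \<exists>i. i \<in> D \<times> \<rat> \<times> \<rat> \<and> F \<in> ?N {i} \<and> (\<forall>G\<in>?N {i}. G \<phi> \<in> U \<phi>)"
    by blast
  from bchoice [OF this] obtain i
    where i: "\<forall>\<phi>\<in>cfun X. i \<phi> \<in> D \<times> \<rat> \<times> \<rat> \<and> F \<in> ?N {i \<phi>} \<and> (\<forall>G\<in>?N {i \<phi>}. G \<phi> \<in> U \<phi>)"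
    by blast
  define T where "T = i ` {\<phi> \<in> cfun X. U \<phi> \<noteq> UNIV}"
  have "T \<in> Fpow (D \<times> \<rat> \<times> \<rat>)"
    using fin i by (auto simp: T_def Fpow_def)
  moreover have "F \<in> ?N T"
    using i F(1) by (auto simp: T_def)
  moreover have "?N T \<subseteq> W"
  proof
    fix G assume G: "G \<in> ?N T"
    have "G \<phi> \<in> U \<phi>" if \<phi>: "\<phi> \<in> cfun X" for \<phi>
    proof (cases "U \<phi> = UNIV")
      case False
      then have "i \<phi> \<in> T"
        using \<phi> by (auto simp: T_def)
      then have "G \<in> ?N {i \<phi>}"
        using G by simp
      then show ?thesis
        using bspec [OF i \<phi>] by blast
    qed simp
    then show "G \<in> W"
      using G OSf_ext [of G X] FU(2) W'(2) by (auto simp: PiE_def)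
  qed
  ultimately show "\<exists>V\<in>?N ` Fpow (D \<times> \<rat> \<times> \<rat>). F \<in> V \<and> V \<subseteq> W"
    by (intro bexI [of _ "?N T"] conjI imageI)
qed

theorem OSf_preserves_weight:
  "functor_preserves_weight (OSf :: 'a topology \<Rightarrow> _)"
  unfolding functor_preserves_weight_def
proof (intro allI impI)
  fix X :: "'a topology" assume X: "comp_obj X" and inf: "infinite (topspace X)"
  obtain B where B: "is_base B X" "weight X = card_of B"
    and B_min: "\<And>B'. is_base B' X \<Longrightarrow> (weight X, card_of B') \<in> ordLeq"
    using weight_base [of X] by blast
  obtain B' where B': "is_base B' (OSf X)" "weight (OSf X) = card_of B'"
    and B'_min: "\<And>B''. is_base B'' (OSf X) \<Longrightarrow> (weight (OSf X), card_of B'') \<in> ordLeq"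
    using weight_base [of "OSf X"] by blast
  have "infinite B"
    using infinite_base [OF B(1)] X inf by (auto simp: comp_obj_def)
  obtain D where D: "approximating X D" "D \<lesssim> B"
    using small_approximating_set [OF X B(1) \<open>infinite B\<close>] by blast
  have "(\<rat> :: real set) \<lesssim> B"
    by (rule countable_lepoll_infinite [OF countable_rat \<open>infinite B\<close>])
  then have "D \<times> (\<rat> :: real set) \<times> (\<rat> :: real set) \<lesssim> B"
    using \<open>infinite B\<close> D(2) by (intro Times_lepoll)
  then have "Fpow (D \<times> (\<rat> :: real set) \<times> (\<rat> :: real set)) \<lesssim> B"
    by (rule Fpow_lepoll [OF \<open>infinite B\<close>])
  then have "(\<lambda>T. {F \<in> OSf_set X. \<forall>(g, a, b)\<in>T. a < F g \<and> F g < b}) ` Fpow (D \<times> \<rat> \<times> \<rat>) \<lesssim> B"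
    by (rule lepoll_trans [OF image_lepoll])
  then have "(weight (OSf X), weight X) \<in> ordLeq"
    using B'_min [OF base_of_OSf [OF X D(1)]] B(2) by (auto simp: lepoll_iff_ordLeq intro: ordLeq_transitive)
  moreover have "(\<lambda>W. {x \<in> topspace X. dirac X x \<in> W}) ` B' \<lesssim> B'"
    by (rule image_lepoll)
  then have "(weight X, weight (OSf X)) \<in> ordLeq"
    using B_min [OF base_from_OSf [OF X B'(1)]] B'(2) by (auto simp: lepoll_iff_ordLeq intro: ordLeq_transitive)
  ultimately show "(weight X, weight (OSf X)) \<in> ordIso"
    by (simp add: ordIso_iff_ordLeq)
qed



section \<open>Continuity\<close>

lemma spectrumD:
  assumes "inverse_spectrum I r X p"
  shows "I \<noteq> {}" "\<And>i j. (i, j) \<in> r \<Longrightarrow> i \<in> I \<and> j \<in> I" "\<And>i. i \<in> I \<Longrightarrow> (i, i) \<in> r"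
    "\<And>i j k. (i, j) \<in> r \<Longrightarrow> (j, k) \<in> r \<Longrightarrow> (i, k) \<in> r"
    "\<And>i. i \<in> I \<Longrightarrow> comp_obj (X i)"
    "\<And>i j. (i, j) \<in> r \<Longrightarrow> p i j \<in> comp_hom (X j) (X i)"
    "\<And>i j k y. (i, j) \<in> r \<Longrightarrow> (j, k) \<in> r \<Longrightarrow> y \<in> topspace (X k) \<Longrightarrow> p i j (p j k y) = p i k y"
proof -
  note S = assms [unfolded inverse_spectrum_def preorder_on_def]
  show "I \<noteq> {}"
    using S by blast
  show "\<And>i j. (i, j) \<in> r \<Longrightarrow> i \<in> I \<and> j \<in> I"
    using S by blast
  show "\<And>i. i \<in> I \<Longrightarrow> (i, i) \<in> r"
    using S by (auto simp: refl_on_def)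
  show "\<And>i j k. (i, j) \<in> r \<Longrightarrow> (j, k) \<in> r \<Longrightarrow> (i, k) \<in> r"
    using S by (auto dest: transD)
  show "\<And>i. i \<in> I \<Longrightarrow> comp_obj (X i)"
    using S by blast
  show "\<And>i j. (i, j) \<in> r \<Longrightarrow> p i j \<in> comp_hom (X j) (X i)"
    using S by blast
  show "p i j (p j k y) = p i k y" if "(i, j) \<in> r" "(j, k) \<in> r" "y \<in> topspace (X k)" for i j k y
  proof -
    have "p i k = compose (topspace (X k)) (p i j) (p j k)"
      using S that(1,2) by blast
    then show ?thesis
      using that(3) by (simp add: compose_def)
  qed
qed

lemma spectrum_upper_bound:
  assumes S: "inverse_spectrum I r X p" and J: "finite J" "J \<subseteq> I"
  shows "\<exists>k\<in>I. \<forall>j\<in>J. (j, k) \<in> r"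
  using J
proof (induction J)
  case empty
  then show ?case
    using spectrumD(1) [OF S] by auto
next
  case (insert j J)
  then obtain k where k: "k \<in> I" "\<forall>j\<in>J. (j, k) \<in> r"
    by auto
  obtain l where l: "l \<in> I" "(j, l) \<in> r" "(k, l) \<in> r"
    using S k(1) insert.prems unfolding inverse_spectrum_def by blast
  then show ?case
    using k spectrumD(4) [OF S] by blast
qed

lemma spectrum_limit_facts:
  fixes X :: "'i \<Rightarrow> 'a topology"
  assumes S: "inverse_spectrum I r X p"
  defines "A \<equiv> {x \<in> topspace (product_topology X I). \<forall>i j. (i, j) \<in> r \<longrightarrow> p i j (x j) = x i}"
  shows comp_obj_product: "comp_obj (product_topology X I)"
    and closedin_limit: "closedin (product_topology X I) A"
    and limit_eq: "spectrum_limit I r X p = subtopology (product_topology X I) A"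
    and comp_obj_limit: "comp_obj (spectrum_limit I r X p)"
    and topspace_limit: "topspace (spectrum_limit I r X p) = A"
    and limit_proj_hom: "\<And>i. i \<in> I \<Longrightarrow> limit_proj I r X p i \<in> comp_hom (spectrum_limit I r X p) (X i)"
proof -
  let ?\<Pi> = "product_topology X I"
  show P: "comp_obj ?\<Pi>"
    using spectrumD(5) [OF S]
    by (auto simp: comp_obj_def compact_space_product_topology Hausdorff_space_product_topology)
  have A_eq: "A = {x \<in> topspace ?\<Pi>. \<forall>ij\<in>r. p (fst ij) (snd ij) (x (snd ij)) = x (fst ij)}"
    unfolding A_def by force
  show cl: "closedin ?\<Pi> A"
    unfolding A_eq
  proof (rule closedin_Collect_ball)
    fix ij assume ij: "ij \<in> r"
    then have I: "fst ij \<in> I" "snd ij \<in> I"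
      using spectrumD(2) [OF S, of "fst ij" "snd ij"] by auto
    have "continuous_map (X (snd ij)) (X (fst ij)) (p (fst ij) (snd ij))"
      using ij spectrumD(6) [OF S, of "fst ij" "snd ij"] by (simp add: comp_hom_cont)
    then have "continuous_map ?\<Pi> (X (fst ij)) (p (fst ij) (snd ij) \<circ> (\<lambda>x. x (snd ij)))"
      by (rule continuous_map_compose [OF continuous_map_product_projection [OF I(2)]])
    moreover have "Hausdorff_space (X (fst ij))"
      using spectrumD(5) [OF S I(1)] by (simp add: comp_obj_def)
    ultimately show "closedin ?\<Pi> {x \<in> topspace ?\<Pi>. p (fst ij) (snd ij) (x (snd ij)) = x (fst ij)}"
      using closedin_continuous_maps_eq [OF _ _ continuous_map_product_projection [OF I(1)]]
      by (fastforce simp: o_def)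
  qed
  have "A = topspace ?\<Pi> \<inter> {x. \<forall>i j. (i, j) \<in> r \<longrightarrow> p i j (x j) = x i}"
    by (auto simp: A_def)
  then show eq: "spectrum_limit I r X p = subtopology ?\<Pi> A"
    unfolding spectrum_limit_def by (simp only: subtopology_restrict)
  show "comp_obj (spectrum_limit I r X p)"
    unfolding eq by (rule comp_obj_subtopology [OF P cl])
  show "topspace (spectrum_limit I r X p) = A"
    unfolding eq using closedin_subset [OF cl] by (simp add: inf_absorb2)
  show "limit_proj I r X p i \<in> comp_hom (spectrum_limit I r X p) (X i)" if "i \<in> I" for i
  proof -
    have "continuous_map (spectrum_limit I r X p) (X i) (\<lambda>x. x i)"
      unfolding eq by (rule continuous_map_from_subtopology [OF continuous_map_product_projection [OF that]])
    then have "continuous_map (spectrum_limit I r X p) (X i) (limit_proj I r X p i)"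
      by (rule continuous_map_eq) (simp add: limit_proj_def)
    then show ?thesis
      by (simp add: comp_hom_def limit_proj_def)
  qed
qed

lemma limit_proj_compat:
  assumes "inverse_spectrum I r X p" "(i, j) \<in> r" "x \<in> topspace (spectrum_limit I r X p)"
  shows "limit_proj I r X p i x = p i j (limit_proj I r X p j x)"
  using assms by (auto simp: topspace_limit limit_proj_def)

text \<open>Since the index set is directed, the finitely many coordinates restricted by a basic open set
  can all be read off from one coordinate \<open>k\<close>.\<close>

lemma limit_cylinder:
  assumes S: "inverse_spectrum I r X p" and V: "openin (spectrum_limit I r X p) V" "x \<in> V"
  obtains k W where "k \<in> I" "openin (X k) W" "x k \<in> W"
    "\<And>y. y \<in> topspace (spectrum_limit I r X p) \<Longrightarrow> y k \<in> W \<Longrightarrow> y \<in> V"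
proof -
  let ?L = "spectrum_limit I r X p"
  have xL: "x \<in> topspace ?L"
    using V openin_subset by blast
  obtain V' where V': "openin (product_topology X I) V'" and
    VV': "V = V' \<inter> {x. \<forall>i j. (i, j) \<in> r \<longrightarrow> p i j (x j) = x i}"
    using V(1) unfolding spectrum_limit_def openin_subtopology by blast
  have "x \<in> V'"
    using V(2) VV' by simp
  with V' have "\<exists>U. finite {i \<in> I. U i \<noteq> topspace (X i)} \<and> (\<forall>i\<in>I. openin (X i) (U i)) \<and>
      x \<in> Pi\<^sub>E I U \<and> Pi\<^sub>E I U \<subseteq> V'"
    unfolding openin_product_topology_alt by (rule bspec)
  then obtain U where fin: "finite {i \<in> I. U i \<noteq> topspace (X i)}" and U: "\<forall>i\<in>I. openin (X i) (U i)"
    and xU: "x \<in> Pi\<^sub>E I U" "Pi\<^sub>E I U \<subseteq> V'"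
    by (elim exE conjE)
  define J where "J = {i \<in> I. U i \<noteq> topspace (X i)}"
  obtain k where k: "k \<in> I" "\<And>j. j \<in> J \<Longrightarrow> (j, k) \<in> r"
    using spectrum_upper_bound [OF S, of J] fin unfolding J_def by blast
  define W where "W = {y \<in> topspace (X k). \<forall>j\<in>J. p j k y \<in> U j}"
  have inL: "y k \<in> topspace (X k)" "\<And>j. j \<in> J \<Longrightarrow> p j k (y k) = y j" "y \<in> Pi\<^sub>E I (\<lambda>i. topspace (X i))"
    if "y \<in> topspace ?L" for y
    using that k unfolding topspace_limit [OF S] by (auto simp: PiE_iff)
  show thesis
  proof (rule that [OF k(1)])
    show "openin (X k) W"
      unfolding W_def
    proof (rule openin_Collect_finite_ball)
      show "finite J"
        using fin by (simp add: J_def)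
      show "openin (X k) {y \<in> topspace (X k). p j k y \<in> U j}" if j: "j \<in> J" for j
        using spectrumD(6) [OF S k(2) [OF j]] U j
        by (intro openin_continuous_map_preimage [of _ "X j"]) (auto simp: J_def comp_hom_cont)
    qed
    show "x k \<in> W"
      using inL [OF xL] xU(1) by (auto simp: W_def J_def PiE_iff)
    fix y assume y: "y \<in> topspace ?L" "y k \<in> W"
    have "y i \<in> U i" if i: "i \<in> I" for i
    proof (cases "i \<in> J")
      case True
      then have "p i k (y k) \<in> U i"
        using y(2) by (simp add: W_def)
      then show ?thesis
        by (simp add: inL(2) [OF y(1) True])
    next
      case False
      then show ?thesis
        using inL(3) [OF y(1)] i by (auto simp: J_def)
    qed
    then have "y \<in> Pi\<^sub>E I U"
      using inL(3) [OF y(1)] by (simp add: PiE_iff)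
    then have "y \<in> V'"
      using xU(2) by blast
    then show "y \<in> V"
      using y(1) unfolding VV' topspace_limit [OF S] by blast
  qed
qed

text \<open>A function that factors through the \<open>i\<close>-th projection also factors through the \<open>k\<close>-th one for
  \<open>k\<close> above \<open>i\<close>, so directedness gives closure under maxima.\<close>

lemma approximating_limit:
  assumes S: "inverse_spectrum I r X p"
  defines "L \<equiv> spectrum_limit I r X p"
  shows "approximating L {\<lambda>x\<in>topspace L. \<phi> (limit_proj I r X p i x) |i \<phi>. i \<in> I \<and> \<phi> \<in> cfun (X i)}"
    (is "approximating L ?D")
proof (rule approximating_if_max_closed)
  show "comp_obj L"
    unfolding L_def by (rule comp_obj_limit [OF S])
  have hom: "limit_proj I r X p i \<in> comp_hom L (X i)" if "i \<in> I" for i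
    unfolding L_def by (rule limit_proj_hom [OF S that])
  show "?D \<subseteq> cfun L"
    using cfun_comp [OF hom] by blast
  obtain i where "i \<in> I"
    using spectrumD(1) [OF S] by blast
  then show "?D \<noteq> {}"
    using cfun_const [where X = "X i"] by blast
  have raise: "\<exists>\<psi>\<in>cfun (X k). (\<lambda>x\<in>topspace L. \<phi> (limit_proj I r X p i x)) =
      (\<lambda>x\<in>topspace L. \<psi> (limit_proj I r X p k x))"
    if ik: "(i, k) \<in> r" and \<phi>: "\<phi> \<in> cfun (X i)" for i k \<phi>
  proof (intro bexI [of _ "\<lambda>y\<in>topspace (X k). \<phi> (p i k y)"] restrict_ext)
    show "(\<lambda>y\<in>topspace (X k). \<phi> (p i k y)) \<in> cfun (X k)"
      by (rule cfun_comp [OF spectrumD(6) [OF S ik] \<phi>])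
    fix x assume x: "x \<in> topspace L"
    have "limit_proj I r X p k x \<in> topspace (X k)"
      using hom spectrumD(2) [OF S ik] x comp_hom_in by metis
    then show "\<phi> (limit_proj I r X p i x) = (\<lambda>y\<in>topspace (X k). \<phi> (p i k y)) (limit_proj I r X p k x)"
      using limit_proj_compat [OF S ik] x by (simp add: L_def)
  qed
  show "(\<lambda>x\<in>topspace L. max (g x) (h x)) \<in> ?D" if gh: "g \<in> ?D" "h \<in> ?D" for g h
  proof -
    obtain i \<phi> where i: "i \<in> I" "\<phi> \<in> cfun (X i)" "g = (\<lambda>x\<in>topspace L. \<phi> (limit_proj I r X p i x))"
      using gh(1) unfolding mem_Collect_eq by (elim exE conjE)
    obtain j \<psi> where j: "j \<in> I" "\<psi> \<in> cfun (X j)" "h = (\<lambda>x\<in>topspace L. \<psi> (limit_proj I r X p j x))"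
      using gh(2) unfolding mem_Collect_eq by (elim exE conjE)
    obtain k where k: "k \<in> I" "(i, k) \<in> r" "(j, k) \<in> r"
      using spectrum_upper_bound [OF S, of "{i, j}"] i(1) j(1) by auto
    obtain \<phi>' where \<phi>': "\<phi>' \<in> cfun (X k)" "g = (\<lambda>x\<in>topspace L. \<phi>' (limit_proj I r X p k x))"
      using raise [OF k(2) i(2)] i(3) by auto
    obtain \<psi>' where \<psi>': "\<psi>' \<in> cfun (X k)" "h = (\<lambda>x\<in>topspace L. \<psi>' (limit_proj I r X p k x))"
      using raise [OF k(3) j(2)] j(3) by auto
    let ?m = "\<lambda>y\<in>topspace (X k). max (\<phi>' y) (\<psi>' y)"
    have "?m \<in> cfun (X k)"
      by (intro cfunI continuous_map_real_max cfunD \<phi>'(1) \<psi>'(1))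
    moreover have "(\<lambda>x\<in>topspace L. max (g x) (h x)) = (\<lambda>x\<in>topspace L. ?m (limit_proj I r X p k x))"
      using comp_hom_in [OF hom [OF k(1)]] by (intro restrict_ext) (simp add: \<phi>'(2) \<psi>'(2))
    ultimately show ?thesis
      using k(1) by blast
  qed
  show "\<exists>g\<in>?D. g x = b \<and> (\<forall>y\<in>topspace L. g y \<le> b) \<and> (\<forall>y\<in>topspace L - V. g y \<le> a)"
    if x: "x \<in> topspace L" "openin L V" "x \<in> V" and ab: "a \<le> b" for x V a b
  proof -
    obtain k W where k: "k \<in> I" and W: "openin (X k) W" "x k \<in> W"
      "\<And>y. y \<in> topspace L \<Longrightarrow> y k \<in> W \<Longrightarrow> y \<in> V"
      using limit_cylinder [OF S x(2,3) [unfolded L_def]] unfolding L_def by blast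
    have Xk: "comp_obj (X k)"
      by (rule spectrumD(5) [OF S k])
    have coord: "limit_proj I r X p k y = y k" "y k \<in> topspace (X k)" if "y \<in> topspace L" for y
    proof -
      show "limit_proj I r X p k y = y k"
        using that by (simp add: limit_proj_def L_def)
      with comp_hom_in [OF hom [OF k] that] show "y k \<in> topspace (X k)"
        by simp
    qed
    have "closedin (X k) (topspace (X k) - W)"
      using W(1) by blast
    then obtain u where u: "u \<in> cfun (X k)" "u (x k) = 1" "\<forall>y\<in>topspace (X k) - W. u y = 0"
      "\<forall>y\<in>topspace (X k). 0 \<le> u y \<and> u y \<le> 1"
      by (rule Urysohn_off_closed [OF Xk _ coord(2) [OF x(1)]]) (use W(2) in auto)
    let ?\<phi> = "\<lambda>y\<in>topspace (X k). a + (b - a) * u y"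
    let ?g = "\<lambda>y\<in>topspace L. ?\<phi> (limit_proj I r X p k y)"
    have "?\<phi> \<in> cfun (X k)"
      using cfunD [OF u(1)] by (intro cfunI continuous_map_add continuous_map_real_mult_left) auto
    then have "?g \<in> ?D"
      using k by blast
    moreover have g: "?g y = a + (b - a) * u (y k)" if "y \<in> topspace L" for y
      using that coord [OF that] by simp
    have "?g x = b"
      using g [OF x(1)] u(2) by simp
    moreover have "?g y \<le> b" if y: "y \<in> topspace L" for y
    proof -
      have "(b - a) * u (y k) \<le> (b - a) * 1"
        using u(4) coord(2) [OF y] ab by (intro mult_left_mono) auto
      then show ?thesis
        using g [OF y] by simp
    qed
    moreover have "?g y \<le> a" if y: "y \<in> topspace L - V" for y
    proof -
      have "y k \<in> topspace (X k) - W"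
        using y W(3) coord(2) by blast
      then show ?thesis
        using g [of y] u(3) y by simp
    qed
    ultimately show ?thesis
      by blast
  qed
qed

text \<open>The bonding maps need not be surjective, so measures on a single \<open>X k\<close> cannot be lifted to the
  limit directly. They can be lifted to the product \<open>Q\<close>: the map \<open>s k\<close> fills in the coordinates below
  \<open>k\<close> by the bonding maps and all others by fixed points \<open>c i\<close>. The lifted measures satisfy the
  closed conditions attached to all indices below \<open>k\<close>: to lie below \<open>z\<close> there, to be supported in
  \<open>C k\<close>, where the coordinates below \<open>k\<close> are compatible, and to attain the value at \<open>\<phi>\<close>. Hence by
  compactness some measure in \<open>P_f Q\<close> satisfies all of them, and it lives on the limit.\<close>

lemma limit_lift:
  fixes X :: "'i \<Rightarrow> 'a topology"
  assumes S: "inverse_spectrum I r X p"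
    and z: "\<And>i. i \<in> I \<Longrightarrow> z i \<in> OSf_set (X i)"
    and compat: "\<And>i j. (i, j) \<in> r \<Longrightarrow> push (X j) (X i) (p i j) (z j) = z i"
    and i0: "i\<^sub>0 \<in> I" and \<phi>: "\<phi> \<in> cfun (X i\<^sub>0)"
  defines "L \<equiv> spectrum_limit I r X p"
  shows "\<exists>\<mu>\<in>P_f L. push L (X i\<^sub>0) (limit_proj I r X p i\<^sub>0) \<mu> \<phi> = z i\<^sub>0 \<phi> \<and>
    (\<forall>j\<in>I. below (X j) (push L (X j) (limit_proj I r X p j) \<mu>) (z j))"
proof -
  define Q where "Q = product_topology X I"
  have Q: "comp_obj Q"
    unfolding Q_def by (rule comp_obj_product [OF S])
  have topQ: "topspace Q = (\<Pi>\<^sub>E i\<in>I. topspace (X i))"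
    by (simp add: Q_def)
  have Xi: "comp_obj (X i)" if "i \<in> I" for i
    by (rule spectrumD(5) [OF S that])
  define \<pi> where "\<pi> i = (\<lambda>x\<in>topspace Q. x i)" for i
  have \<pi>: "\<pi> i \<in> comp_hom Q (X i)" if "i \<in> I" for i
  proof -
    have "continuous_map Q (X i) (\<lambda>x. x i)"
      unfolding Q_def by (rule continuous_map_product_projection [OF that])
    then have "continuous_map Q (X i) (\<pi> i)"
      by (rule continuous_map_eq) (simp add: \<pi>_def)
    then show ?thesis
      by (simp add: comp_hom_def \<pi>_def)
  qed
  have "\<exists>x. x \<in> topspace (X i)" if i: "i \<in> I" for i
  proof -
    obtain \<mu> where "\<mu> \<in> P_f (X i)"
      using OSf_attained [OF Xi [OF i] z [OF i] cfun_const] by blast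
    then show ?thesis
      by (rule P_f_obtain) blast
  qed
  then obtain c where c: "\<And>i. i \<in> I \<Longrightarrow> c i \<in> topspace (X i)"
    by metis
  define s where "s k = (\<lambda>y\<in>topspace (X k). \<lambda>i\<in>I. if (i, k) \<in> r then p i k y else c i)" for k
  have s: "s k \<in> comp_hom (X k) Q" for k
  proof -
    have "continuous_map (X k) Q (\<lambda>y. \<lambda>i\<in>I. if (i, k) \<in> r then p i k y else c i)"
      unfolding Q_def continuous_map_componentwise
    proof (intro conjI ballI)
      fix i assume i: "i \<in> I"
      show "continuous_map (X k) (X i) (\<lambda>y. (\<lambda>i\<in>I. if (i, k) \<in> r then p i k y else c i) i)"
        using i spectrumD(6) [OF S, of i k] c [OF i]
        by (cases "(i, k) \<in> r") (simp_all add: comp_hom_cont)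
    qed auto
    then have "continuous_map (X k) Q (s k)"
      by (rule continuous_map_eq) (simp add: s_def)
    then show ?thesis
      by (simp add: comp_hom_def s_def)
  qed
  define C where "C k = {x \<in> topspace Q. \<forall>i. (i, k) \<in> r \<longrightarrow> p i k (x k) = x i}" for k
  have C: "closedin Q (C k)" if k: "k \<in> I" for k
  proof -
    have "C k = {x \<in> topspace Q. \<forall>i\<in>{i. (i, k) \<in> r}. p i k (x k) = x i}"
      by (auto simp: C_def)
    also have "closedin Q \<dots>"
    proof (rule closedin_Collect_ball)
      fix i assume "i \<in> {i. (i, k) \<in> r}"
      then have i: "(i, k) \<in> r" "i \<in> I"
        using spectrumD(2) [OF S] by auto
      have "continuous_map Q (X i) (p i k \<circ> (\<lambda>x. x k))"
        unfolding Q_def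
        by (rule continuous_map_compose [of _ "X k"], rule continuous_map_product_projection [OF k],
            rule comp_hom_cont [OF spectrumD(6) [OF S i(1)]])
      moreover have "continuous_map Q (X i) (\<lambda>x. x i)"
        unfolding Q_def by (rule continuous_map_product_projection [OF i(2)])
      moreover have "Hausdorff_space (X i)"
        using Xi [OF i(2)] by (simp add: comp_obj_def)
      ultimately show "closedin Q {x \<in> topspace Q. p i k (x k) = x i}"
        using closedin_continuous_maps_eq [of "X i" Q "p i k \<circ> (\<lambda>x. x k)" "\<lambda>x. x i"] by (simp add: o_def)
    qed
    finally show ?thesis .
  qed
  have "\<exists>\<mu>\<in>P_f Q. \<forall>k\<in>I. below (X k) (push Q (X k) (\<pi> k) \<mu>) (z k) \<and>
      (\<forall>\<psi>\<in>cfun Q. (\<forall>x\<in>C k. \<psi> x = 0) \<longrightarrow> \<mu> \<psi> \<le> 0) \<and> push Q (X i\<^sub>0) (\<pi> i\<^sub>0) \<mu> \<phi> = z i\<^sub>0 \<phi>"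
  proof (rule compactin_common_point [OF compactin_P_f [OF Q]])
    fix k assume k: "k \<in> I"
    have "closedin (pw_topology Q) {\<mu> \<in> topspace (pw_topology Q). push Q (X i\<^sub>0) (\<pi> i\<^sub>0) \<mu> \<phi> = z i\<^sub>0 \<phi>}"
      unfolding push_apply [OF \<phi>]
      by (intro closedin_Collect_eq continuous_map_eval cfun_comp [OF \<pi> [OF i0] \<phi>]) simp
    moreover have "closedin (pw_topology Q) {\<mu> \<in> topspace (pw_topology Q).
        \<forall>\<psi>\<in>cfun Q. (\<forall>x\<in>C k. \<psi> x = 0) \<longrightarrow> \<mu> \<psi> \<le> 0}"
      by (rule closedin_Collect_ball, rule closedin_Collect_imp, rule closedin_Collect_le,
          rule continuous_map_eval) simp_all
    ultimately show "closedin (pw_topology Q) {\<mu> \<in> topspace (pw_topology Q).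
        below (X k) (push Q (X k) (\<pi> k) \<mu>) (z k) \<and>
        (\<forall>\<psi>\<in>cfun Q. (\<forall>x\<in>C k. \<psi> x = 0) \<longrightarrow> \<mu> \<psi> \<le> 0) \<and> push Q (X i\<^sub>0) (\<pi> i\<^sub>0) \<mu> \<phi> = z i\<^sub>0 \<phi>}"
      by (intro closedin_Collect_conj closedin_push_below \<pi> [OF k])
  next
    fix J assume J: "finite J" "J \<subseteq> I"
    have "\<exists>k\<in>I. \<forall>j\<in>insert i\<^sub>0 J. (j, k) \<in> r"
      by (rule spectrum_upper_bound [OF S]) (use J i0 in auto)
    then obtain k where k: "k \<in> I" "(i\<^sub>0, k) \<in> r" "\<And>j. j \<in> J \<Longrightarrow> (j, k) \<in> r"
      by auto
    let ?\<psi> = "\<lambda>y\<in>topspace (X k). \<phi> (p i\<^sub>0 k y)"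
    have hom: "p j k \<in> comp_hom (X k) (X j)" if "(j, k) \<in> r" for j
      by (rule spectrumD(6) [OF S that])
    obtain \<mu> where \<mu>: "\<mu> \<in> P_f (X k)" "\<mu> \<in> P_set (X k)" "\<mu> ?\<psi> = z k ?\<psi>" "below (X k) \<mu> (z k)"
      by (rule OSf_attained [OF Xi [OF k(1)] z [OF k(1)] cfun_comp [OF hom [OF k(2)] \<phi>]])
    have \<pi>s: "\<pi> j (s k y) = p j k y" if "(j, k) \<in> r" "y \<in> topspace (X k)" for j y
      using that comp_hom_in [OF s that(2)] spectrumD(2) [OF S that(1)] by (simp add: \<pi>_def s_def)
    have push_s: "push Q (X j) (\<pi> j) (push (X k) Q (s k) \<mu>) = push (X k) (X j) (p j k) \<mu>"
      if j: "(j, k) \<in> r" for j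
      using spectrumD(2) [OF S j] \<pi>s [OF j] by (intro push_compose [OF s \<pi>]) auto
    show "\<exists>\<mu>\<in>P_f Q. \<forall>j\<in>J. below (X j) (push Q (X j) (\<pi> j) \<mu>) (z j) \<and>
        (\<forall>\<psi>\<in>cfun Q. (\<forall>x\<in>C j. \<psi> x = 0) \<longrightarrow> \<mu> \<psi> \<le> 0) \<and> push Q (X i\<^sub>0) (\<pi> i\<^sub>0) \<mu> \<phi> = z i\<^sub>0 \<phi>"
    proof (intro bexI [of _ "push (X k) Q (s k) \<mu>"] ballI conjI impI)
      show "push (X k) Q (s k) \<mu> \<in> P_f Q"
        by (rule push_P_f [OF s \<mu>(1)])
      show "push Q (X i\<^sub>0) (\<pi> i\<^sub>0) (push (X k) Q (s k) \<mu>) \<phi> = z i\<^sub>0 \<phi>"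
        unfolding push_s [OF k(2)] push_apply [OF \<phi>] \<mu>(3)
        using compat [OF k(2)] push_apply [OF \<phi>] by metis
      fix j assume j: "j \<in> J"
      then have jk: "(j, k) \<in> r"
        by (rule k(3))
      show "below (X j) (push Q (X j) (\<pi> j) (push (X k) Q (s k) \<mu>)) (z j)"
        using push_below [OF hom [OF jk] \<mu>(4)] unfolding push_s [OF jk] compat [OF jk] .
      fix \<psi> assume \<psi>: "\<psi> \<in> cfun Q" "\<forall>x\<in>C j. \<psi> x = 0"
      have "s k y \<in> C j" if y: "y \<in> topspace (X k)" for y
        unfolding C_def
      proof (intro CollectI conjI allI impI)
        show "s k y \<in> topspace Q"
          by (rule comp_hom_in [OF s y])
        fix i assume ij: "(i, j) \<in> r"
        then have "(i, k) \<in> r"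
          using jk by (rule spectrumD(4) [OF S])
        then show "p i j (s k y j) = s k y i"
          using y jk spectrumD(7) [OF S ij jk y] spectrumD(2) [OF S ij] by (simp add: s_def)
      qed
      then have "(\<lambda>y\<in>topspace (X k). \<psi> (s k y)) = (\<lambda>y\<in>topspace (X k). 0)"
        using \<psi>(2) by (intro restrict_ext) simp
      then show "push (X k) Q (s k) \<mu> \<psi> \<le> 0"
        using P_const [OF \<mu>(2)] by (simp add: push_apply [OF \<psi>(1)])
    qed
  qed
  then obtain \<mu> where \<mu>: "\<mu> \<in> P_f Q" "\<forall>k\<in>I. below (X k) (push Q (X k) (\<pi> k) \<mu>) (z k)"
    and supp: "\<forall>k\<in>I. \<forall>\<psi>\<in>cfun Q. (\<forall>x\<in>C k. \<psi> x = 0) \<longrightarrow> \<mu> \<psi> \<le> 0"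
    and val: "push Q (X i\<^sub>0) (\<pi> i\<^sub>0) \<mu> \<phi> = z i\<^sub>0 \<phi>"
    using i0 by blast
  define A where "A = {x \<in> topspace Q. \<forall>i j. (i, j) \<in> r \<longrightarrow> p i j (x j) = x i}"
  have L: "L = subtopology Q A" "topspace L = A" and A: "closedin Q A"
    unfolding L_def A_def Q_def by (rule limit_eq [OF S] topspace_limit [OF S] closedin_limit [OF S])+
  obtain T \<alpha> x\<^sub>0 where T: "finite T" "T \<subseteq> topspace Q" "\<forall>x\<in>T. 0 < \<alpha> x" "sum \<alpha> T = 1"
    "x\<^sub>0 \<in> T" "1 - 1 / (real (card T) + 1) \<le> \<alpha> x\<^sub>0" and \<mu>_eq: "\<mu> = comb Q T \<alpha> (\<lambda>x. x)"
    using \<mu>(1) by (rule P_f_obtain)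
  have "x \<in> C k" if "x \<in> T" "k \<in> I" for x k
    using T(2) supp that(2)
    by (intro comb_support [OF Q C [OF that(2)] T(1) _ T(3) _ that(1)]) (auto simp: \<mu>_eq)
  then have "T \<subseteq> A"
    using T(2) spectrumD(2) [OF S] unfolding A_def C_def by blast
  have "\<exists>\<nu>\<in>P_f (subtopology Q A). push (subtopology Q A) Q (comp_incl Q A) \<nu> = \<mu>"
  proof (rule P_f_restrict [OF Q A \<mu>(1)])
    fix \<psi> assume \<psi>: "\<psi> \<in> cfun Q" "\<forall>x\<in>A. \<psi> x = 0"
    then show "\<mu> \<psi> \<le> 0"
      using \<open>T \<subseteq> A\<close> unfolding \<mu>_eq comb_apply [OF \<psi>(1)] by (intro sum_nonpos) auto
  qed
  then obtain \<nu> where \<nu>: "\<nu> \<in> P_f L" "push L Q (comp_incl Q A) \<nu> = \<mu>"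
    unfolding L(1) by blast
  have "push L (X j) (limit_proj I r X p j) \<nu> = push Q (X j) (\<pi> j) \<mu>" if j: "j \<in> I" for j
    unfolding \<nu>(2) [symmetric]
  proof (rule push_compose [symmetric])
    show "comp_incl Q A \<in> comp_hom L Q"
      unfolding L(1) by (rule comp_incl_hom)
    show "\<pi> j \<in> comp_hom Q (X j)"
      by (rule \<pi> [OF j])
    fix x assume x: "x \<in> topspace L"
    then have "x \<in> topspace Q"
      unfolding L(2) A_def by blast
    with x show "limit_proj I r X p j x = \<pi> j (comp_incl Q A x)"
      using L by (simp add: limit_proj_def L_def [symmetric] \<pi>_def comp_incl_def)
  qed
  note eq = this
  show ?thesis
  proof (intro bexI [OF _ \<nu>(1)] conjI ballI)
    show "push L (X i\<^sub>0) (limit_proj I r X p i\<^sub>0) \<nu> \<phi> = z i\<^sub>0 \<phi>"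
      unfolding eq [OF i0] by (rule val)
    fix j assume j: "j \<in> I"
    show "below (X j) (push L (X j) (limit_proj I r X p j) \<nu>) (z j)"
      unfolding eq [OF j] using \<mu>(2) j by blast
  qed
qed

text \<open>A continuous bijection from a compact space to a Hausdorff space is a homeomorphism.
  Injectivity is \<open>approximating_limit\<close>, surjectivity is \<open>limit_lift\<close>.\<close>

theorem OSf_continuous:
  "functor_continuous TYPE('i)
     (OSf :: 'a topology \<Rightarrow> _) (OSf :: ('i \<Rightarrow> 'a) topology \<Rightarrow> _) OSf_map OSf_map"
  unfolding functor_continuous_def
proof (intro allI impI)
  fix I :: "'i set" and r and X :: "'i \<Rightarrow> 'a topology" and p
  assume S: "inverse_spectrum I r X p"
  define L where "L = spectrum_limit I r X p"
  define q where "q = limit_proj I r X p"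
  define M where "M = spectrum_limit I r (\<lambda>i. OSf (X i)) (\<lambda>i j. OSf_map (X j) (X i) (p i j))"
  define h where "h F = (\<lambda>i\<in>I. OSf_map L (X i) (q i) F)" for F
  have L: "comp_obj L"
    unfolding L_def by (rule comp_obj_limit [OF S])
  have Xi: "comp_obj (X i)" if "i \<in> I" for i
    by (rule spectrumD(5) [OF S that])
  have q: "q i \<in> comp_hom L (X i)" if "i \<in> I" for i
    unfolding q_def L_def by (rule limit_proj_hom [OF S that])
  have hi: "h F i = push L (X i) (q i) F" if "F \<in> OSf_set L" "i \<in> I" for F i
    using that by (simp add: h_def OSf_map_apply [OF L])
  have hi_in: "h F i \<in> OSf_set (X i)" if "F \<in> OSf_set L" "i \<in> I" for F i
    unfolding hi [OF that] by (rule push_OSf_set [OF L Xi [OF that(2)] q [OF that(2)] that(1)])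
  have topM: "z \<in> topspace M \<longleftrightarrow> z \<in> (\<Pi>\<^sub>E i\<in>I. OSf_set (X i)) \<and>
      (\<forall>i j. (i, j) \<in> r \<longrightarrow> push (X j) (X i) (p i j) (z j) = z i)" for z
  proof -
    have "(\<Pi>\<^sub>E i\<in>I. topspace (OSf (X i))) = (\<Pi>\<^sub>E i\<in>I. OSf_set (X i))"
      by (rule PiE_cong) (simp add: Xi)
    moreover have "OSf_map (X j) (X i) (p i j) (z j) = push (X j) (X i) (p i j) (z j)"
      if "z \<in> (\<Pi>\<^sub>E i\<in>I. OSf_set (X i))" "(i, j) \<in> r" for i j
      using spectrumD(2) [OF S that(2)] that(1) by (intro OSf_map_apply Xi) auto
    ultimately show ?thesis
      unfolding M_def spectrum_limit_def topspace_subtopology topspace_product_topology by auto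
  qed
  have h_in: "h F \<in> topspace M" if F: "F \<in> OSf_set L" for F
    unfolding topM
  proof (intro conjI allI impI)
    show "h F \<in> (\<Pi>\<^sub>E i\<in>I. OSf_set (X i))"
      using hi_in [OF F] by (auto simp: h_def)
    fix i j assume ij: "(i, j) \<in> r"
    then have I: "i \<in> I" "j \<in> I"
      using spectrumD(2) [OF S] by auto
    show "push (X j) (X i) (p i j) (h F j) = h F i"
      unfolding hi [OF F I(1)] hi [OF F I(2)]
      by (rule push_compose [OF q [OF I(2)] spectrumD(6) [OF S ij]])
        (simp add: q_def L_def limit_proj_compat [OF S ij])
  qed
  have "homeomorphic_map (OSf L) M h"
  proof (rule continuous_imp_homeomorphic_map)
    have "continuous_map (OSf L) (product_topology (\<lambda>i. OSf (X i)) I) h"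
      unfolding continuous_map_componentwise
    proof (intro conjI ballI)
      fix i assume i: "i \<in> I"
      have "continuous_map (OSf L) (OSf (X i)) (OSf_map L (X i) (q i))"
        by (rule comp_hom_cont [OF OSf_map_hom [OF L Xi [OF i] q [OF i]]])
      then show "continuous_map (OSf L) (OSf (X i)) (\<lambda>F. h F i)"
        using i by (simp add: h_def)
    qed (auto simp: h_def)
    moreover have "h F \<in> {z. \<forall>i j. (i, j) \<in> r \<longrightarrow> OSf_map (X j) (X i) (p i j) (z j) = z i}"
      if "F \<in> topspace (OSf L)" for F
      using h_in [of F] that L unfolding M_def spectrum_limit_def by simp
    ultimately show "continuous_map (OSf L) M h"
      unfolding M_def spectrum_limit_def continuous_map_in_subtopology by blast
    show "compact_space (OSf L)"
      using comp_obj_OSf [OF L] by (simp add: comp_obj_def)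
    have "Hausdorff_space (product_topology (\<lambda>i. OSf (X i)) I)"
      using comp_obj_OSf [OF Xi] by (auto simp: comp_obj_def Hausdorff_space_product_topology)
    then show "Hausdorff_space M"
      unfolding M_def spectrum_limit_def by (rule Hausdorff_space_subtopology)
    show "inj_on h (topspace (OSf L))"
    proof (rule inj_onI)
      fix F G assume "F \<in> topspace (OSf L)" "G \<in> topspace (OSf L)" and eq: "h F = h G"
      then have FG: "F \<in> OSf_set L" "G \<in> OSf_set L"
        using L by auto
      show "F = G"
      proof (rule OSf_eqI_approximating [OF L approximating_limit [OF S, folded L_def] FG])
        fix g assume "g \<in> {\<lambda>x\<in>topspace L. \<phi> (limit_proj I r X p i x) |i \<phi>. i \<in> I \<and> \<phi> \<in> cfun (X i)}"
        then obtain i \<phi> where i: "i \<in> I" "\<phi> \<in> cfun (X i)" "g = (\<lambda>x\<in>topspace L. \<phi> (q i x))"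
          unfolding q_def by blast
        have "push L (X i) (q i) F \<phi> = push L (X i) (q i) G \<phi>"
          using eq hi FG i(1) by metis
        then show "F g = G g"
          unfolding push_apply [OF i(2)] i(3) .
      qed
    qed
    show "h ` topspace (OSf L) = topspace M"
    proof (intro equalityI subsetI)
      fix z assume "z \<in> topspace M"
      then have z: "z \<in> (\<Pi>\<^sub>E i\<in>I. OSf_set (X i))"
        and compat: "\<And>i j. (i, j) \<in> r \<Longrightarrow> push (X j) (X i) (p i j) (z j) = z i"
        unfolding topM by auto
      have zi: "z i \<in> OSf_set (X i)" if "i \<in> I" for i
        using z that by auto
      have "\<exists>G\<in>OSf_set L. \<forall>i\<in>I. push L (X i) (q i) G = z i"
      proof (rule OSf_common_lift [OF L spectrumD(1) [OF S] q])
        show "z i \<in> extensional (cfun (X i))" if "i \<in> I" for i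
          by (rule OSf_ext [OF zi [OF that]])
        show "\<exists>\<mu>\<in>P_f L. push L (X i) (q i) \<mu> \<phi> = z i \<phi> \<and>
            (\<forall>j\<in>I. below (X j) (push L (X j) (q j) \<mu>) (z j))"
          if "i \<in> I" "\<phi> \<in> cfun (X i)" for i \<phi>
          unfolding L_def q_def by (rule limit_lift [OF S zi compat that])
      qed
      then obtain G where G: "G \<in> OSf_set L" "\<And>i. i \<in> I \<Longrightarrow> push L (X i) (q i) G = z i"
        by blast
      have "h G = z"
      proof (rule extensionalityI [of _ I])
        show "z \<in> extensional I"
          using z by (simp add: PiE_def)
      qed (simp_all add: h_def OSf_map_apply [OF L G(1)] G(2))
      then show "z \<in> h ` topspace (OSf L)"
        using G(1) L by auto
    qed (use h_in L in auto)
  qed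
  then show "homeomorphic_map (OSf (spectrum_limit I r X p))
      (spectrum_limit I r (\<lambda>i. OSf (X i)) (\<lambda>i j. OSf_map (X j) (X i) (p i j)))
      (\<lambda>\<mu>. \<lambda>i\<in>I. OSf_map (spectrum_limit I r X p) (X i) (limit_proj I r X p i) \<mu>)"
    unfolding L_def M_def h_def q_def .
qed

theorem theorem2p1:
  shows
    "comp_functor
       (OSf :: 'a topology \<Rightarrow> _) (OSf :: 'b topology \<Rightarrow> _) (OSf :: 'c topology \<Rightarrow> _)
       OSf_map OSf_map OSf_map OSf_map \<and>
     functor_continuous TYPE('i)
       (OSf :: 'a topology \<Rightarrow> _) (OSf :: ('i \<Rightarrow> 'a) topology \<Rightarrow> _) OSf_map OSf_map \<and>
     functor_preserves_weight (OSf :: 'a topology \<Rightarrow> _) \<and>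
     functor_monomorphic
       (OSf :: 'a topology \<Rightarrow> _) (OSf_map :: 'a topology \<Rightarrow> 'b topology \<Rightarrow> _) \<and>
     functor_epimorphic
       (OSf :: 'a topology \<Rightarrow> _) (OSf :: 'b topology \<Rightarrow> _) OSf_map \<and>
     functor_preserves_intersections (OSf :: 'a topology \<Rightarrow> _) OSf_map \<and>
     functor_preserves_preimages
       (OSf :: 'a topology \<Rightarrow> _) (OSf :: 'b topology \<Rightarrow> _) OSf_map OSf_map OSf_map \<and>
     functor_preserves_point_and_empty (OSf :: 'a topology \<Rightarrow> _)"
  by (intro conjI OSf_functor OSf_continuous OSf_preserves_weight OSf_monomorphic OSf_epimorphic
      OSf_preserves_intersections OSf_preserves_preimages OSf_preserves_point_and_empty)

end
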